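(* Let $\Phi:T\times\mathbb{R}^n\rightrightarrows\mathbb{R}^m$ be a set-valued normal integrand on a complete finite measure space $(T,\mathcal{A},\mu)$, and let $\bar x\in\operatorname{dom}E_\Phi$. Suppose that there exist $\rho>0$ and $\kappa\in L^1(T,\mathbb{R}_+)$ such that $\Phi_t(x)$ is convex for all $x\in\mathbb{B}_\rho(\bar x)$ and a.e. $t\in T_{na}$, and $\Phi_t(x)\subset\kappa(t)\mathbb{B}$ for all $x\in\mathbb{B}_\rho(\bar x)$ and a.e. $t\in T$. Suppose that $E_\Phi(\bar x)$ is a singleton and that $\Phi$ is integrably locally Lipschitzian around $\bar x$. Let $y^*\in\mathbb{R}^m$, and suppose that for a.e. $t\in T$ we have $\Phi_t(\bar x)=\{\bar{\mathsf y}(t)\}$ and $\Phi_t$ is coderivative regular at $(\bar x,\bar{\mathsf y}(t))$ for $y^*$. Then $$\hat D^*E_\Phi(\bar x)(y^* )=D^*E_\Phi(\bar x)(y^* )=\int_T D^*\Phi_t(\bar x)(y^* )\,d\mu.$$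
   Context: $\mathbb{R}_+:=\{\alpha\in\mathbb{R}:\alpha>0\}$; $L^p(T,\cdot)$ are the usual Lebesgue spaces; $\mathbb{B}_r(\cdot)$ is the closed ball, $\mathbb{B}$ the closed unit ball. $T=T_{pa}\cup T_{na}$ is the disjoint measurable decomposition of $T$ such that $\mu(\cdot\cap T_{pa})$ is purely atomic and $\mu(\cdot\cap T_{na})$ is nonatomic. For $\Phi:T\times\mathbb{R}^n\rightrightarrows\mathbb{R}^m$ write $\Phi_t:=\Phi(t,\cdot)$. $\Phi$ is a set-valued normal integrand if $\operatorname{gph}\Phi_t$ is closed for all $t\in T$ and $\operatorname{gph}\Phi\in\mathcal{A}\otimes\mathcal{B}(\mathbb{R}^n\times\mathbb{R}^m)$. The (Aumann) integral of $F:T\rightrightarrows\mathbb{R}^d$ is $\int_TF(t)d\mu=\{\int_T\mathsf{v}\,d\mu:\mathsf{v}\in L^1(T,\mathbb{R}^d),\ \mathsf{v}(t)\in F(t)\text{ a.e.}\}$. $E_\Phi(x):=\int_T\Phi_t(x)d\mu$. Integrably locally Lipschitzian around $\bar x$: there exist $\eta>0$, $\ell\in L^1(T,\mathbb{R}_+)$ and $\hat T\in\mathcal{A}$ with $\mu(T\setminus\hat T)=0$ such that $\Phi_t(x)\subset\Phi_t(x')+\ell(t)\|x-x'\|\mathbb{B}$ for all $t\in\hat T$ and $x,x'\in\mathbb{B}_\eta(\bar x)$. Regular normal cone: $\hat N(\bar z;\Omega)=\{z^*:\limsup_{z\to\bar z,z\in\Omega}\langle z^*,z-\bar z\rangle/\|z-\bar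 z\|\le0\}$ for $\bar z\in\Omega$, $\emptyset$ otherwise. Limiting normal cone: $N(\bar z;\Omega)=\{z^*:\exists z_k\to\bar z,\ z_k^*\to z^*,\ z_k^*\in\hat N(z_k;\Omega)\}$. Regular and limiting coderivatives at $(x,y)\in\operatorname{gph}G$: $\hat D^*G(x,y)(y^* )=\{x^*:(x^*,-y^* )\in\hat N((x,y);\operatorname{gph}G)\}$, $D^*G(x,y)(y^* )=\{x^*:(x^*,-y^* )\in N((x,y);\operatorname{gph}G)\}$; the point $y$ is omitted from the notation when $G(x)=\{y\}$ is a singleton. $G$ is coderivative regular at $(x,y)\in\operatorname{gph}G$ for $y^*$ if $D^*G(x,y)(y^* )=\hat D^*G(x,y)(y^* )$. *)

theory Defs
  imports "HOL-Analysis.Analysis"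
begin

definition measure_atom :: "'t measure \<Rightarrow> 't set \<Rightarrow> bool" where
  "measure_atom M A \<longleftrightarrow> A \<in> sets M \<and> 0 < emeasure M A \<and>
     (\<forall>B\<in>sets M. B \<subseteq> A \<longrightarrow> emeasure M B = 0 \<or> emeasure M (A - B) = 0)"

definition nonatomic :: "'t measure \<Rightarrow> bool" where
  "nonatomic M \<longleftrightarrow> (\<nexists>A. measure_atom M A)"

definition purely_atomic :: "'t measure \<Rightarrow> bool" where
  "purely_atomic M \<longleftrightarrow>
     (\<forall>B\<in>sets M. 0 < emeasure M B \<longrightarrow> (\<exists>A\<subseteq>B. measure_atom M A))"

text \<open>\<open>density M (indicator S)\<close> is the trace measure \<open>A \<mapsto> \<mu> (A \<inter> S)\<close> on the whole space.
  The decomposition is unique only up to null sets, hence a predicate.\<close>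

definition atomic_decomposition :: "'t measure \<Rightarrow> 't set \<Rightarrow> 't set \<Rightarrow> bool" where
  "atomic_decomposition M Tpa Tna \<longleftrightarrow>
     Tpa \<in> sets M \<and> Tna \<in> sets M \<and> Tpa \<inter> Tna = {} \<and> Tpa \<union> Tna = space M \<and>
     purely_atomic (density M (indicator Tpa)) \<and> nonatomic (density M (indicator Tna))"

definition gph :: "('a \<Rightarrow> 'b set) \<Rightarrow> ('a \<times> 'b) set" where
  "gph G = {(x, y). y \<in> G x}"

definition setval_dom :: "('a \<Rightarrow> 'b set) \<Rightarrow> 'a set" where
  "setval_dom G = {x. G x \<noteq> {}}"

definition normal_integrand ::
  "'t measure \<Rightarrow> ('t \<Rightarrow> 'a::euclidean_space \<Rightarrow> 'b::euclidean_space set) \<Rightarrow> bool" where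
  "normal_integrand M \<Phi> \<longleftrightarrow>
     (\<forall>t\<in>space M. closed (gph (\<Phi> t))) \<and>
     {(t, z). t \<in> space M \<and> z \<in> gph (\<Phi> t)} \<in> sets (M \<Otimes>\<^sub>M (borel :: ('a \<times> 'b) measure))"

text \<open>\<open>L\<^sup>1(T, \<real>\<^sub>+)\<close>, where \<open>\<real>\<^sub>+\<close> consists of the strictly positive reals.\<close>

definition L1_pos :: "'t measure \<Rightarrow> ('t \<Rightarrow> real) set" where
  "L1_pos M = {f. integrable M f \<and> (AE t in M. 0 < f t)}"

definition aumann_integral ::
  "'t measure \<Rightarrow> ('t \<Rightarrow> 'b::euclidean_space set) \<Rightarrow> 'b set" where
  "aumann_integral M F = {integral\<^sup>L M v | v. integrable M v \<and> (AE t in M. v t \<in> F t)}"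

definition expected_map ::
  "'t measure \<Rightarrow> ('t \<Rightarrow> 'a \<Rightarrow> 'b::euclidean_space set) \<Rightarrow> 'a \<Rightarrow> 'b set" where
  "expected_map M \<Phi> x = aumann_integral M (\<lambda>t. \<Phi> t x)"

definition integrably_locally_Lipschitz ::
  "'t measure \<Rightarrow> ('t \<Rightarrow> 'a::euclidean_space \<Rightarrow> 'b::euclidean_space set) \<Rightarrow> 'a \<Rightarrow> bool" where
  "integrably_locally_Lipschitz M \<Phi> xbar \<longleftrightarrow>
     (\<exists>\<eta>>0. \<exists>l\<in>L1_pos M. \<exists>That\<in>sets M. emeasure M (space M - That) = 0 \<and>
        (\<forall>t\<in>That. \<forall>x\<in>cball xbar \<eta>. \<forall>x'\<in>cball xbar \<eta>.
           \<Phi> t x \<subseteq> {u + (l t * norm (x - x')) *\<^sub>R b | u b. u \<in> \<Phi> t x' \<and> b \<in> cball 0 1}))"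

text \<open>At an isolated point of \<open>S\<close> the filter is trivial and the upper limit is \<open>-\<infinity>\<close>, so every
  vector is a regular normal there.\<close>

definition regular_normal_cone :: "'a::euclidean_space \<Rightarrow> 'a set \<Rightarrow> 'a set" where
  "regular_normal_cone zbar S =
     (if zbar \<in> S
      then {zs. Limsup (at zbar within S) (\<lambda>z. ereal (inner zs (z - zbar) / norm (z - zbar))) \<le> 0}
      else {})"

definition limiting_normal_cone :: "'a::euclidean_space \<Rightarrow> 'a set \<Rightarrow> 'a set" where
  "limiting_normal_cone zbar S =
     {zs. \<exists>z w. z \<longlonglongrightarrow> zbar \<and> w \<longlonglongrightarrow> zs \<and> (\<forall>k::nat. w k \<in> regular_normal_cone (z k) S)}"

definition regular_coderivative ::
  "('a::euclidean_space \<Rightarrow> 'b::euclidean_space set) \<Rightarrow> 'a \<Rightarrow> 'b \<Rightarrow> 'b \<Rightarrow> 'a set" where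
  "regular_coderivative G x y ys = {xs. (xs, - ys) \<in> regular_normal_cone (x, y) (gph G)}"

definition limiting_coderivative ::
  "('a::euclidean_space \<Rightarrow> 'b::euclidean_space set) \<Rightarrow> 'a \<Rightarrow> 'b \<Rightarrow> 'b \<Rightarrow> 'a set" where
  "limiting_coderivative G x y ys = {xs. (xs, - ys) \<in> limiting_normal_cone (x, y) (gph G)}"

definition coderivative_regular ::
  "('a::euclidean_space \<Rightarrow> 'b::euclidean_space set) \<Rightarrow> 'a \<Rightarrow> 'b \<Rightarrow> 'b \<Rightarrow> bool" where
  "coderivative_regular G x y ys \<longleftrightarrow>
     limiting_coderivative G x y ys = regular_coderivative G x y ys"

end

theory Submission
  imports Defs
begin

text \<open>
  Near \<open>xbar\<close> each \<open>\<Phi> t\<close> is Lipschitzian with a singleton value at \<open>xbar\<close>, so selections of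
  \<open>\<Phi> t x\<close> converge to \<open>ybar t\<close> at a rate dominated by an integrable function. Dominated convergence
  then gives that integrals of regular coderivatives are regular coderivatives of the expectation.

  For the converse, let \<open>p\<close> be a limit of regular coderivatives of the expectation at nearby points
  \<open>(x\<^sub>k, y\<^sub>k)\<close> with \<open>y\<^sub>k\<close> the integral of a selection \<open>u\<^sub>k\<close>. Varying \<open>u\<^sub>k\<close> measurably shows that
  almost every \<open>u\<^sub>k t\<close> is a local minimiser up to \<open>\<epsilon>\<^sub>k\<close>, and bounds \<open>inner p h\<close> by the integral of
  difference quotients of \<open>\<Phi> t\<close> in direction \<open>h\<close>. A mean value inequality and reverse Fatou bound the latter by
  the integral of the support functions of the coderivatives at \<open>xbar\<close>. Coderivative regularity
  makes these sets convex and compact, so that their Aumann integral is convex and closed, and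
  separation puts \<open>p\<close> inside it. Measurable selections come from the measurable projection theorem.
\<close>

section \<open>Measurable projections\<close>

text \<open>In the converse inclusion nothing is uniform in \<open>t\<close>: the selections
  \<open>u\<^sub>k\<close> are known only almost everywhere. The singleton value at
  \<open>xbar\<close> repairs this, since the Lipschitz bound puts \<open>u\<^sub>k t\<close> within
  \<open>l t * norm (x\<^sub>k - xbar)\<close> of \<open>ybar t\<close>. So, whatever selections
  represent \<open>y\<^sub>k\<close>, the points at which the mean value inequality finds normals of
  \<open>\<Phi> t\<close> tend to \<open>(xbar, ybar t)\<close>, and these normals accumulate in the
  coderivative at the reference point. How large \<open>k\<close> must be depends on
  \<open>t\<close>, and how short the step along \<open>h\<close> must be depends on
  \<open>t\<close> and \<open>k\<close>. The pointwise estimate is thus an iterated limit, in the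
  step and then in \<open>k\<close>, and reverse Fatou is applied once for each, with a multiple of
  \<open>l\<close> as majorant. A normal to the expectation makes \<open>u\<^sub>k t\<close> minimal
  only up to a penalty \<open>\<epsilon>\<^sub>k * norm (v - u\<^sub>k t)\<close>. The difference
  quotients therefore carry twice that penalty: the surplus keeps the perturbed minimisers of the
  mean value argument near \<open>u\<^sub>k t\<close>.\<close>

definition rectangles :: "'t measure \<Rightarrow> ('t \<times> 'b::topological_space) set set" where
  "rectangles M = {S \<times> C | S C. S \<in> sets M \<and> closed C}"

text \<open>Suslin schemes are indexed by whole branches \<open>\<sigma>\<close>, with \<open>R n\<close> depending on finitely many coordinates,
  instead of by finite sequences: countable unions and intersections become mere reindexings of \<open>\<sigma>\<close>.\<close>

definition finitely_determined :: "((nat \<Rightarrow> nat) \<Rightarrow> 'c) \<Rightarrow> bool" where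
  "finitely_determined f \<longleftrightarrow> (\<exists>N. \<forall>\<sigma> \<tau>. (\<forall>i<N. \<sigma> i = \<tau> i) \<longrightarrow> f \<sigma> = f \<tau>)"

definition suslin_scheme ::
  "'t measure \<Rightarrow> (nat \<Rightarrow> (nat \<Rightarrow> nat) \<Rightarrow> ('t \<times> 'b::topological_space) set) \<Rightarrow> bool" where
  "suslin_scheme M R \<longleftrightarrow> (\<forall>n. finitely_determined (R n)) \<and> (\<forall>n \<sigma>. R n \<sigma> \<in> rectangles M)"

text \<open>The Souslin operation applied to measurable-by-closed rectangles. Closed second factors
  are what survives the limits of the compactness argument.\<close>

definition suslin_sets :: "'t measure \<Rightarrow> ('t \<times> 'b::topological_space) set set" where
  "suslin_sets M = {{x. \<exists>\<sigma>. \<forall>n. x \<in> R n \<sigma>} | R. suslin_scheme M R}"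

section \<open>Stability of the Souslin operation under countable unions and intersections\<close>

lemma finitely_determinedI:
  "(\<And>\<sigma> \<tau>. (\<And>i. i < N \<Longrightarrow> \<sigma> i = \<tau> i) \<Longrightarrow> f \<sigma> = f \<tau>) \<Longrightarrow> finitely_determined f"
  unfolding finitely_determined_def by blast

lemma rectanglesI: "S \<in> sets M \<Longrightarrow> closed C \<Longrightarrow> S \<times> C \<in> rectangles M"
  unfolding rectangles_def by blast

lemma suslin_setsI:
  "suslin_scheme M R \<Longrightarrow> (\<And>x. x \<in> A \<longleftrightarrow> (\<exists>\<sigma>. \<forall>n. x \<in> R n \<sigma>)) \<Longrightarrow> A \<in> suslin_sets M"
  unfolding suslin_sets_def by blast

lemma rectangle_in_suslin_sets:
  assumes "A \<in> rectangles M" shows "A \<in> suslin_sets M"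
  by (rule suslin_setsI[where R = "\<lambda>_ _. A"])
     (use assms in \<open>auto simp: suslin_scheme_def finitely_determined_def\<close>)

text \<open>A single branch has to encode both an index and a branch for that member:
  \<open>\<sigma> 0\<close> is the index and \<open>\<sigma> \<circ> Suc\<close> the branch. The
  conditions of all members are enumerated through \<open>prod_decode\<close>, and those of members
  other than \<open>\<sigma> 0\<close> are made vacuous by the full rectangle.\<close>

lemma suslin_sets_Union:
  fixes A :: "nat \<Rightarrow> ('t \<times> 'b::topological_space) set"
  assumes "\<And>i. A i \<in> suslin_sets M"
  shows "(\<Union>i. A i) \<in> suslin_sets M"
proof -
  have "\<forall>i. \<exists>R. suslin_scheme M R \<and> A i = {x. \<exists>\<sigma>. \<forall>n. x \<in> R n \<sigma>}"
    using assms unfolding suslin_sets_def by blast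
  from choice[OF this]
  obtain R where R: "\<And>i. suslin_scheme M (R i)"
    and A: "\<And>i. A i = {x. \<exists>\<sigma>. \<forall>n. x \<in> R i n \<sigma>}" by blast
  define R' where "R' m \<sigma> = (if \<sigma> 0 = fst (prod_decode m)
      then R (fst (prod_decode m)) (snd (prod_decode m)) (\<sigma> \<circ> Suc) else space M \<times> UNIV)"
    for m and \<sigma> :: "nat \<Rightarrow> nat"
  have rect: "R i n \<sigma> \<in> rectangles M" for i n \<sigma> using R unfolding suslin_scheme_def by blast
  show ?thesis
  proof (rule suslin_setsI)
    show "suslin_scheme M R'"
      unfolding suslin_scheme_def
    proof (intro conjI allI)
      fix m
      obtain N where N: "\<And>\<sigma> \<tau>. (\<forall>i<N. \<sigma> i = \<tau> i) \<Longrightarrow>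
          R (fst (prod_decode m)) (snd (prod_decode m)) \<sigma> = R (fst (prod_decode m)) (snd (prod_decode m)) \<tau>"
        using R unfolding suslin_scheme_def finitely_determined_def by metis
      show "finitely_determined (R' m)"
      proof (rule finitely_determinedI[of "Suc N"])
        fix \<sigma> \<tau> :: "nat \<Rightarrow> nat" assume eq: "\<And>i. i < Suc N \<Longrightarrow> \<sigma> i = \<tau> i"
        have "R (fst (prod_decode m)) (snd (prod_decode m)) (\<sigma> \<circ> Suc)
            = R (fst (prod_decode m)) (snd (prod_decode m)) (\<tau> \<circ> Suc)"
          by (rule N) (use eq in auto)
        then show "R' m \<sigma> = R' m \<tau>" unfolding R'_def using eq[of 0] by simp
      qed
    next
      fix m \<sigma> show "R' m \<sigma> \<in> rectangles M"
        unfolding R'_def using rect by (auto intro!: rectanglesI)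
    qed
  next
    fix x
    have sp: "x \<in> R i n \<sigma> \<Longrightarrow> x \<in> space M \<times> UNIV" for i n \<sigma>
      using rect[of i n \<sigma>] sets.sets_into_space unfolding rectangles_def by fastforce
    show "x \<in> (\<Union>i. A i) \<longleftrightarrow> (\<exists>\<sigma>. \<forall>m. x \<in> R' m \<sigma>)"
    proof
      assume "x \<in> (\<Union>i. A i)"
      then obtain i \<sigma> where *: "\<And>n. x \<in> R i n \<sigma>" unfolding A by auto
      have "\<forall>m. x \<in> R' m (case_nat i \<sigma>)"
        using * sp[OF *] by (auto simp: R'_def comp_def)
      then show "\<exists>\<sigma>. \<forall>m. x \<in> R' m \<sigma>" by blast
    next
      assume "\<exists>\<sigma>. \<forall>m. x \<in> R' m \<sigma>"
      then obtain \<sigma> where *: "\<And>m. x \<in> R' m \<sigma>" by blast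
      have "x \<in> R (\<sigma> 0) n (\<sigma> \<circ> Suc)" for n
        using *[of "prod_encode (\<sigma> 0, n)"] by (simp add: R'_def)
      then show "x \<in> (\<Union>i. A i)" unfolding A by blast
    qed
  qed
qed

text \<open>One branch carries a branch for every member at once, the \<open>i\<close>-th strand
  sitting at the positions \<open>prod_encode (i, k)\<close>.\<close>

lemma suslin_sets_Inter:
  fixes A :: "nat \<Rightarrow> ('t \<times> 'b::topological_space) set"
  assumes "\<And>i. A i \<in> suslin_sets M"
  shows "(\<Inter>i. A i) \<in> suslin_sets M"
proof -
  have "\<forall>i. \<exists>R. suslin_scheme M R \<and> A i = {x. \<exists>\<sigma>. \<forall>n. x \<in> R n \<sigma>}"
    using assms unfolding suslin_sets_def by blast
  from choice[OF this]
  obtain R where R: "\<And>i. suslin_scheme M (R i)"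
    and A: "\<And>i. A i = {x. \<exists>\<sigma>. \<forall>n. x \<in> R i n \<sigma>}" by blast
  define R' where "R' m \<sigma> = R (fst (prod_decode m)) (snd (prod_decode m))
      (\<lambda>k. \<sigma> (prod_encode (fst (prod_decode m), k)))" for m and \<sigma> :: "nat \<Rightarrow> nat"
  show ?thesis
  proof (rule suslin_setsI)
    show "suslin_scheme M R'"
      unfolding suslin_scheme_def
    proof (intro conjI allI)
      fix m
      let ?i = "fst (prod_decode m)"
      obtain N where N: "\<And>\<sigma> \<tau>. (\<forall>i<N. \<sigma> i = \<tau> i) \<Longrightarrow>
          R ?i (snd (prod_decode m)) \<sigma> = R ?i (snd (prod_decode m)) \<tau>"
        using R unfolding suslin_scheme_def finitely_determined_def by metis
      \<comment> \<open>The relevant coordinates of the strand are scattered, so the bound is the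
        largest of their codes. The range \<open>{..N}\<close> instead of \<open>{..<N}\<close>
        keeps the set under \<open>Max\<close> nonempty.\<close>
      show "finitely_determined (R' m)"
      proof (rule finitely_determinedI[of "Suc (Max ((\<lambda>k. prod_encode (?i, k)) ` {..N}))"])
        fix \<sigma> \<tau> :: "nat \<Rightarrow> nat"
        assume eq: "\<And>i. i < Suc (Max ((\<lambda>k. prod_encode (?i, k)) ` {..N})) \<Longrightarrow> \<sigma> i = \<tau> i"
        have "\<sigma> (prod_encode (?i, k)) = \<tau> (prod_encode (?i, k))" if "k < N" for k
          by (rule eq, rule le_imp_less_Suc, rule Max_ge) (use that in auto)
        then show "R' m \<sigma> = R' m \<tau>" unfolding R'_def by (intro N) auto
      qed
    next
      fix m \<sigma> show "R' m \<sigma> \<in> rectangles M"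
        unfolding R'_def using R unfolding suslin_scheme_def by blast
    qed
  next
    fix x
    show "x \<in> (\<Inter>i. A i) \<longleftrightarrow> (\<exists>\<sigma>. \<forall>m. x \<in> R' m \<sigma>)"
    proof
      assume "x \<in> (\<Inter>i. A i)"
      then have "\<forall>i. \<exists>\<sigma>. \<forall>n. x \<in> R i n \<sigma>" unfolding A by blast
      then obtain s where s: "\<And>i n. x \<in> R i n (s i)" by metis
      define \<sigma> where "\<sigma> m = s (fst (prod_decode m)) (snd (prod_decode m))" for m
      have "x \<in> R' m \<sigma>" for m
        using s[of "fst (prod_decode m)" "snd (prod_decode m)"]
        by (simp add: R'_def \<sigma>_def)
      then show "\<exists>\<sigma>. \<forall>m. x \<in> R' m \<sigma>" by blast
    next
      assume "\<exists>\<sigma>. \<forall>m. x \<in> R' m \<sigma>"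
      then obtain \<sigma> where *: "\<And>m. x \<in> R' m \<sigma>" by blast
      have "x \<in> R i n (\<lambda>k. \<sigma> (prod_encode (i, k)))" for i n
        using *[of "prod_encode (i, n)"] by (simp add: R'_def)
      then show "x \<in> (\<Inter>i. A i)" unfolding A by blast
    qed
  qed
qed

text \<open>Suslin sets need not be closed under complements, so the induction over the generated
  \<sigma>-algebra carries each set together with its complement. Only a rectangle needs its
  complement computed; there it helps that an open set in a metric space is a countable union of
  closed sets.\<close>

lemma sets_pair_measure_suslin:
  fixes A :: "('t \<times> 'b::{second_countable_topology, metric_space}) set"
  assumes "A \<in> sets (M \<Otimes>\<^sub>M borel)"
  shows "A \<in> suslin_sets M"
proof -
  let ?X = "space M \<times> (UNIV :: 'b set)"
  let ?G = "rectangles M :: ('t \<times> 'b) set set"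
  have gen: "sets (M \<Otimes>\<^sub>M (borel :: 'b measure)) = sigma_sets ?X ?G"
  proof -
    have "sets (M \<Otimes>\<^sub>M (borel :: 'b measure))
      = sets (sigma (space M \<times> space (borel :: 'b measure)) {a \<times> b | a b. a \<in> sets M \<and> b \<in> {C :: 'b set. closed C}})"
    proof (rule sets_pair_eq[where Ca = "{space M}" and Cb = "{UNIV}"])
      show "sets (borel :: 'b measure) = sigma_sets (space borel) {C. closed C}"
        by (subst borel_eq_closed) (simp add: sets_measure_of)
      show "sets M = sigma_sets (space M) (sets M)" by (simp add: sets.sigma_sets_eq)
    qed (auto simp: sets.space_closed sets.top)
    also have "\<dots> = sigma_sets ?X {a \<times> b | a b. a \<in> sets M \<and> b \<in> {C :: 'b set. closed C}}"
      unfolding space_borel by (rule sets_measure_of) (use sets.sets_into_space in auto)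
    finally show ?thesis unfolding rectangles_def by simp
  qed
  have "A \<in> suslin_sets M \<and> ?X - A \<in> suslin_sets M"
    using assms unfolding gen
  proof (induction rule: sigma_sets.induct)
    case (Basic a)
    then obtain S C where a: "a = S \<times> C" and S: "S \<in> sets M" and C: "closed C"
      unfolding rectangles_def by blast
    \<comment> \<open>The distance to the empty set is 0 by convention, hence the separate
      case.\<close>
    define F where "F n = (if C = {} then UNIV else {y. inverse (real (Suc n)) \<le> infdist y C})" for n
    have Fc: "closed (F n)" for n
      unfolding F_def by (auto intro!: closed_Collect_le continuous_intros)
    have Fu: "- C = (\<Union>n. F n)"
    proof (cases "C = {}")
      case False
      have "y \<in> - C \<longleftrightarrow> (\<exists>n. inverse (real (Suc n)) \<le> infdist y C)" for y
      proof
        assume "y \<in> - C"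
        then have "infdist y C > 0"
          using C False infdist_pos_not_in_closed by blast
        then show "\<exists>n. inverse (real (Suc n)) \<le> infdist y C"
          using reals_Archimedean less_imp_le by blast
      next
        assume "\<exists>n. inverse (real (Suc n)) \<le> infdist y C"
        then have "infdist y C > 0"
          by (metis inverse_positive_iff_positive of_nat_0_less_iff order_less_le_trans zero_less_Suc)
        then show "y \<in> - C" by (auto simp: infdist_zero)
      qed
      then show ?thesis using False by (auto simp: F_def)
    qed (simp add: F_def)
    note F = Fc Fu
    have "?X - a = (\<Union>n. case n of 0 \<Rightarrow> (space M - S) \<times> UNIV | Suc k \<Rightarrow> space M \<times> F k)" (is "_ = ?R")
    proof
      show "?X - a \<subseteq> ?R"
      proof
        fix x assume x: "x \<in> ?X - a"
        obtain t y where xy: "x = (t, y)" by force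
        consider "t \<notin> S" | "y \<in> - C" using x xy a by blast
        then show "x \<in> ?R"
        proof cases
          case 1 then show ?thesis using x xy by (intro UN_I[of 0]) auto
        next
          case 2 then obtain k where "y \<in> F k" using F by blast
          then show ?thesis using x xy by (intro UN_I[of "Suc k"]) auto
        qed
      qed
      show "?R \<subseteq> ?X - a"
        using F(2) unfolding a by (auto split: nat.splits)
    qed
    moreover have "?R \<in> suslin_sets M"
      by (rule suslin_sets_Union, rule rectangle_in_suslin_sets)
         (use S F in \<open>auto split: nat.split intro!: rectanglesI\<close>)
    ultimately show ?case using rectangle_in_suslin_sets[OF Basic] by simp
  next
    case Empty
    show ?case
      using rectangle_in_suslin_sets[OF rectanglesI[of "{}" M UNIV]]
        rectangle_in_suslin_sets[OF rectanglesI[of "space M" M UNIV]] by auto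
  next
    case (Compl a)
    have "a \<subseteq> ?X" using Compl(1) gen sets.sets_into_space[of a "M \<Otimes>\<^sub>M (borel :: 'b measure)"]
      by (simp add: space_pair_measure)
    then show ?case using Compl by (simp add: double_diff)
  next
    case (Union a)
    have "?X - (\<Union>i. a i) = (\<Inter>i. ?X - a i)" by blast
    then show ?case using Union suslin_sets_Union[of a M] suslin_sets_Inter[of "\<lambda>i. ?X - a i" M] by auto
  qed
  then show ?thesis by blast
qed

section \<open>Compactness of bounded branches and capacitability of projections\<close>

lemma compact_bounded_sequences: "compact {\<sigma> :: nat \<Rightarrow> nat. \<forall>i. \<sigma> i \<le> b i}"
proof -
  have "{\<sigma> :: nat \<Rightarrow> nat. \<forall>i. \<sigma> i \<le> b i} = PiE UNIV (\<lambda>i. {..b i})" by auto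
  moreover have "compactin (product_topology (\<lambda>i. euclidean) UNIV) (PiE UNIV (\<lambda>i::nat. {..b i}))"
    unfolding compactin_PiE by (auto simp: finite_imp_compact)
  ultimately show ?thesis unfolding euclidean_product_topology by simp
qed

text \<open>Coordinates are discrete, so convergence of the branches makes the finitely many
  coordinates read by \<open>R n\<close> eventually constant. From then on the rectangle is fixed,
  and its second factor is closed.\<close>

lemma suslin_scheme_limit:
  assumes R: "suslin_scheme M R" and lim: "s \<longlonglongrightarrow> \<sigma>" "y \<longlonglongrightarrow> z"
    and mem: "eventually (\<lambda>k. (t, y k) \<in> R n (s k)) sequentially"
  shows "(t, z) \<in> R n \<sigma>"
proof -
  obtain N where N: "\<And>\<sigma> \<tau>. (\<forall>i<N. \<sigma> i = \<tau> i) \<Longrightarrow> R n \<sigma> = R n \<tau>"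
    using R unfolding suslin_scheme_def finitely_determined_def by metis
  have "eventually (\<lambda>k. s k i = \<sigma> i) sequentially" for i
  proof -
    have "(\<lambda>k. s k i) \<longlonglongrightarrow> \<sigma> i"
      by (rule continuous_on_tendsto_compose[OF continuous_on_product_coordinates lim(1)]) auto
    then show ?thesis by (simp add: tendsto_discrete)
  qed
  then have "eventually (\<lambda>k. \<forall>i\<in>{..<N}. s k i = \<sigma> i) sequentially"
    by (intro eventually_ball_finite) auto
  then have ev: "eventually (\<lambda>k. (t, y k) \<in> R n \<sigma>) sequentially"
    using mem by eventually_elim (metis N lessThan_iff)
  have "R n \<sigma> \<in> rectangles M" using R unfolding suslin_scheme_def by blast
  then obtain S C where RS: "R n \<sigma> = S \<times> C" and C: "closed C" unfolding rectangles_def by blast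
  have "z \<in> C"
    by (rule Lim_in_closed_set[OF C _ _ lim(2)]) (use ev in \<open>auto simp: RS elim: eventually_mono\<close>)
  moreover have "t \<in> S" using ev unfolding RS by (auto dest: eventually_happens)
  ultimately show ?thesis unfolding RS by simp
qed


text \<open>The conditions up to \<open>k\<close> read only the first \<open>m\<close> coordinates,
  which take finitely many values below the bound \<open>b\<close>; so the set is a finite union
  over branches. For one branch it is either empty or a finite intersection of first factors,
  according to whether the second factors have a common point in \<open>K\<close>.\<close>

lemma measurable_bounded_sections:
  assumes R: "suslin_scheme M R" and K: "compact K"
  shows "{t. \<exists>y\<in>K. \<exists>\<sigma>. (\<forall>i. \<sigma> i \<le> b i) \<and> (\<forall>n\<le>k. (t, y) \<in> R n \<sigma>)} \<in> sets M"
    (is "?T \<in> _")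
proof -
  have "\<forall>n. \<exists>N. \<forall>\<sigma> \<tau>. (\<forall>i<N. \<sigma> i = \<tau> i) \<longrightarrow> R n \<sigma> = R n \<tau>"
    using R unfolding suslin_scheme_def finitely_determined_def by blast
  from choice[OF this] obtain N where N: "\<And>n \<sigma> \<tau>. (\<And>i. i < N n \<Longrightarrow> \<sigma> i = \<tau> i) \<Longrightarrow> R n \<sigma> = R n \<tau>"
    by blast
  define m where "m = Max (N ` {..k})"
  have m: "N n \<le> m" if "n \<le> k" for n unfolding m_def by (rule Max_ge) (use that in auto)
  have "\<forall>n \<sigma>. \<exists>S C. S \<in> sets M \<and> closed C \<and> R n \<sigma> = S \<times> C"
    using R unfolding suslin_scheme_def rectangles_def by blast
  then obtain S C where S: "\<And>n \<sigma>. S n \<sigma> \<in> sets M" and RS: "\<And>n \<sigma>. R n \<sigma> = S n \<sigma> \<times> C n \<sigma>"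
    by metis
  \<comment> \<open>Zero lies below every bound, so branches filled up with zeros stay
    admissible.\<close>
  define Z where "Z = (\<lambda>\<sigma> i. if i < m then \<sigma> i else 0) ` (PiE {..<m} (\<lambda>i. {..b i}))"
  have "finite Z" unfolding Z_def by (intro finite_imageI finite_PiE) auto
  have "?T = (\<Union>\<sigma>\<in>Z. {t. \<exists>y\<in>K. \<forall>n\<le>k. (t, y) \<in> R n \<sigma>})"
  proof (intro equalityI subsetI)
    fix t assume "t \<in> ?T"
    then obtain y \<sigma> where y: "y \<in> K" "\<And>i. \<sigma> i \<le> b i" "\<And>n. n \<le> k \<Longrightarrow> (t, y) \<in> R n \<sigma>" by blast
    let ?s = "\<lambda>i. if i < m then \<sigma> i else 0"
    have "?s \<in> Z" unfolding Z_def
      by (rule image_eqI[of _ _ "restrict \<sigma> {..<m}"]) (use y in auto)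
    moreover have "R n ?s = R n \<sigma>" if "n \<le> k" for n
      by (rule N) (use m[OF that] in auto)
    ultimately show "t \<in> (\<Union>\<sigma>\<in>Z. {t. \<exists>y\<in>K. \<forall>n\<le>k. (t, y) \<in> R n \<sigma>})" using y by blast
  next
    fix t assume "t \<in> (\<Union>\<sigma>\<in>Z. {t. \<exists>y\<in>K. \<forall>n\<le>k. (t, y) \<in> R n \<sigma>})"
    then obtain \<sigma> y where "\<sigma> \<in> Z" "y \<in> K" "\<forall>n\<le>k. (t, y) \<in> R n \<sigma>" by blast
    moreover have "\<sigma> i \<le> b i" for i using \<open>\<sigma> \<in> Z\<close> unfolding Z_def PiE_def Pi_def by auto
    ultimately show "t \<in> ?T" by blast
  qed
  moreover have "{t. \<exists>y\<in>K. \<forall>n\<le>k. (t, y) \<in> R n \<sigma>} \<in> sets M" for \<sigma>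
  proof (cases "\<exists>y\<in>K. \<forall>n\<le>k. y \<in> C n \<sigma>")
    case True
    then have "{t. \<exists>y\<in>K. \<forall>n\<le>k. (t, y) \<in> R n \<sigma>} = (\<Inter>n\<in>{..k}. S n \<sigma>)" unfolding RS by auto
    then show ?thesis using S by (auto intro: sets.finite_INT)
  next
    case False
    then have "{t. \<exists>y\<in>K. \<forall>n\<le>k. (t, y) \<in> R n \<sigma>} = {}" unfolding RS by auto
    then show ?thesis by (metis sets.empty_sets)
  qed
  ultimately show ?thesis using \<open>finite Z\<close> by auto
qed

text \<open>The \<open>k\<close>-th witness satisfies the conditions up to \<open>k\<close>; along a
  convergent subsequence every single condition holds from some index on and passes to the
  limit.\<close>

lemma compact_sections_limit:
  fixes R :: "nat \<Rightarrow> (nat \<Rightarrow> nat) \<Rightarrow> ('t \<times> 'b::metric_space) set"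
  assumes R: "suslin_scheme M R" and K: "compact K"
    and ne: "\<And>k. \<exists>y\<in>K. \<exists>\<sigma>. (\<forall>i. \<sigma> i \<le> b i) \<and> (\<forall>n\<le>k. (t, y) \<in> R n \<sigma>)"
  shows "\<exists>y\<in>K. \<exists>\<sigma>. \<forall>n. (t, y) \<in> R n \<sigma>"
proof -
  obtain y s where ys: "\<And>k. y k \<in> K" "\<And>k i. s k i \<le> b i" "\<And>k n. n \<le> k \<Longrightarrow> (t, y k) \<in> R n (s k)"
    using ne by metis
  have "compact (K \<times> {\<sigma> :: nat \<Rightarrow> nat. \<forall>i. \<sigma> i \<le> b i})"
    by (intro compact_Times K compact_bounded_sequences)
  then have "seq_compact (K \<times> {\<sigma> :: nat \<Rightarrow> nat. \<forall>i. \<sigma> i \<le> b i})"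
    by (rule compact_imp_seq_compact)
  moreover have "\<forall>k. (y k, s k) \<in> K \<times> {\<sigma>. \<forall>i. \<sigma> i \<le> b i}" using ys by auto
  ultimately obtain l r where l: "l \<in> K \<times> {\<sigma>. \<forall>i. \<sigma> i \<le> b i}" and r: "strict_mono (r :: nat \<Rightarrow> nat)"
    and lim: "((\<lambda>k. (y k, s k)) \<circ> r) \<longlonglongrightarrow> l"
    by (rule seq_compactE)
  have lim1: "(\<lambda>k. y (r k)) \<longlonglongrightarrow> fst l" and lim2: "(\<lambda>k. s (r k)) \<longlonglongrightarrow> snd l"
    using tendsto_fst[OF lim] tendsto_snd[OF lim] by (simp_all add: comp_def)
  have "(t, fst l) \<in> R n (snd l)" for n
  proof (rule suslin_scheme_limit[OF R lim2 lim1])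
    show "eventually (\<lambda>k. (t, y (r k)) \<in> R n (s (r k))) sequentially"
      using eventually_ge_at_top[of n]
      by eventually_elim (meson r seq_suble le_trans ys(3))
  qed
  then show ?thesis using l by (intro bexI[of _ "fst l"] exI[of _ "snd l"]) auto
qed

text \<open>Choquet's capacity argument: fixing successive bounds on the coordinates of the branch loses
  arbitrarily little outer measure, and the branches below a fixed bound form a compact set.\<close>

lemma suslin_projection_inner:
  fixes R :: "nat \<Rightarrow> (nat \<Rightarrow> nat) \<Rightarrow> ('t \<times> 'b::metric_space) set"
  assumes fin: "finite_measure M" and R: "suslin_scheme M R" and K: "compact K"
    and P: "P = {t. \<exists>y\<in>K. \<exists>\<sigma>. \<forall>n. (t, y) \<in> R n \<sigma>}"
    and c: "c < outer_measure_of M P"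
  shows "\<exists>T\<in>sets M. T \<subseteq> P \<and> c \<le> emeasure M T"
proof -
  interpret finite_measure M by (rule fin)
  have rect: "R n \<sigma> \<in> rectangles M" for n \<sigma> using R unfolding suslin_scheme_def by blast
  have sp: "t \<in> space M" if "(t, y) \<in> R n \<sigma>" for t y n \<sigma>
    using rect[of n \<sigma>] sets.sets_into_space that unfolding rectangles_def by fastforce
  define A where "A b k = {t. \<exists>y\<in>K. \<exists>\<sigma>. (\<forall>i<k. \<sigma> i \<le> b i) \<and> (\<forall>n. (t, y) \<in> R n \<sigma>)}"
    for b :: "nat \<Rightarrow> nat" and k
  \<comment> \<open>Bounds are fixed one coordinate at a time. As \<open>m\<close> grows,
    \<open>A (f(k := m)) (Suc k)\<close> increases to \<open>A f k\<close>, and outer measure is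
    continuous along increasing sequences even of nonmeasurable sets; so some \<open>m\<close> keeps
    it above \<open>c\<close>.\<close>
  have "\<exists>f. \<forall>k. c < outer_measure_of M (A (f k) k) \<and> (\<exists>m. f (Suc k) = (f k)(k := m))"
  proof (rule dependent_nat_choice)
    show "\<exists>f. c < outer_measure_of M (A f 0)"
      using c unfolding P A_def by simp
  next
    fix f k assume f: "c < outer_measure_of M (A f k)"
    have "A f k = (\<Union>m. A (f(k := m)) (Suc k))"
    proof (intro equalityI subsetI)
      fix t assume "t \<in> A f k"
      then obtain y \<sigma> where "y \<in> K" "\<forall>i<k. \<sigma> i \<le> f i" "\<forall>n. (t, y) \<in> R n \<sigma>"
        unfolding A_def by blast
      then have "t \<in> A (f(k := \<sigma> k)) (Suc k)"
        unfolding A_def by (auto simp: less_Suc_eq intro!: bexI[of _ y] exI[of _ \<sigma>])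
      then show "t \<in> (\<Union>m. A (f(k := m)) (Suc k))" by blast
    next
      fix t assume "t \<in> (\<Union>m. A (f(k := m)) (Suc k))"
      then obtain m y \<sigma> where y: "y \<in> K" "\<forall>n. (t, y) \<in> R n \<sigma>"
        and *: "\<forall>i<Suc k. \<sigma> i \<le> (f(k := m)) i"
        unfolding A_def by blast
      have "\<sigma> i \<le> f i" if "i < k" for i using *[rule_format, of i] that by simp
      then show "t \<in> A f k" unfolding A_def using y by blast
    qed
    moreover have "incseq (\<lambda>m. A (f(k := m)) (Suc k))"
    proof (intro incseq_SucI subsetI)
      fix m t assume "t \<in> A (f(k := m)) (Suc k)"
      then obtain y \<sigma> where y: "y \<in> K" "\<forall>n. (t, y) \<in> R n \<sigma>"
        and *: "\<forall>i<Suc k. \<sigma> i \<le> (f(k := m)) i"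
        unfolding A_def by blast
      have "\<sigma> i \<le> (f(k := Suc m)) i" if "i < Suc k" for i
        using *[rule_format, of i] that by (cases "i = k") auto
      then show "t \<in> A (f(k := Suc m)) (Suc k)" unfolding A_def using y by blast
    qed
    moreover have "A g j \<subseteq> space M" for g j
      unfolding A_def using sp by blast
    ultimately have "(SUP m. outer_measure_of M (A (f(k := m)) (Suc k))) = outer_measure_of M (A f k)"
      using SUP_outer_measure_of_incseq[of "\<lambda>m. A (f(k := m)) (Suc k)" M] by simp
    with f have "c < (SUP m. outer_measure_of M (A (f(k := m)) (Suc k)))" by simp
    then obtain m where "c < outer_measure_of M (A (f(k := m)) (Suc k))"
      unfolding less_SUP_iff by blast
    then show "\<exists>g. c < outer_measure_of M (A g (Suc k)) \<and> (\<exists>m. g = f(k := m))" by blast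
  qed
  then obtain f where f: "\<And>k. c < outer_measure_of M (A (f k) k)"
    and fS: "\<And>k. \<exists>m. f (Suc k) = (f k)(k := m)" by blast
  \<comment> \<open>Stage \<open>k\<close> alters \<open>f\<close> at coordinate \<open>k\<close>
    alone, so the diagonal records the final value of every coordinate.\<close>
  define b where "b i = f (Suc i) i" for i
  have fb: "f k i = b i" if "i < k" for i k
    using that
  proof (induction k)
    case (Suc k)
    then show ?case using fS[of k] unfolding b_def
      by (cases "i = k") (auto simp: b_def less_Suc_eq)
  qed simp
  define T where "T k = {t. \<exists>y\<in>K. \<exists>\<sigma>. (\<forall>i. \<sigma> i \<le> b i) \<and> (\<forall>n\<le>k. (t, y) \<in> R n \<sigma>)}" for k
  have Tm: "T k \<in> sets M" for k unfolding T_def by (rule measurable_bounded_sections[OF R K])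
  have cT: "c \<le> emeasure M (T k)" for k
  proof -
    have "\<forall>n. \<exists>N. \<forall>\<sigma> \<tau>. (\<forall>i<N. \<sigma> i = \<tau> i) \<longrightarrow> R n \<sigma> = R n \<tau>"
      using R unfolding suslin_scheme_def finitely_determined_def by blast
    from choice[OF this] obtain N where N: "\<And>n \<sigma> \<tau>. (\<And>i. i < N n \<Longrightarrow> \<sigma> i = \<tau> i) \<Longrightarrow> R n \<sigma> = R n \<tau>"
      by blast
    define m where "m = Max (N ` {..k})"
    have m: "N n \<le> m" if "n \<le> k" for n unfolding m_def by (rule Max_ge) (use that in auto)
    have "A (f m) m \<subseteq> T k"
    proof
      fix t assume "t \<in> A (f m) m"
      then obtain y \<sigma> where y: "y \<in> K" "\<And>i. i < m \<Longrightarrow> \<sigma> i \<le> b i" "\<And>n. (t, y) \<in> R n \<sigma>"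
        unfolding A_def using fb by auto
      \<comment> \<open>Only the first \<open>m\<close> coordinates are known to obey
        \<open>b\<close>. Cutting down the later ones does not change the rectangles up to
        \<open>k\<close>, which do not read them.\<close>
      have "R n (\<lambda>i. min (\<sigma> i) (b i)) = R n \<sigma>" if "n \<le> k" for n
        by (rule N) (use y(2) m[OF that] in \<open>auto simp: min_absorb1\<close>)
      then show "t \<in> T k" unfolding T_def using y
        by (auto intro!: bexI[of _ y] exI[of _ "\<lambda>i. min (\<sigma> i) (b i)"])
    qed
    then have "outer_measure_of M (A (f m) m) \<le> emeasure M (T k)"
      using Tm outer_measure_of_mono outer_measure_of_eq by metis
    then show ?thesis using f[of m] by order
  qed
  have "decseq T" unfolding decseq_def T_def by (blast intro: le_trans)
  then have "(\<lambda>k. emeasure M (T k)) \<longlonglongrightarrow> emeasure M (\<Inter>k. T k)"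
    using Tm by (intro Lim_emeasure_decseq) auto
  then have "c \<le> emeasure M (\<Inter>k. T k)"
    using cT by (intro LIMSEQ_le_const) auto
  moreover have "(\<Inter>k. T k) \<subseteq> P"
  proof
    fix t assume "t \<in> (\<Inter>k. T k)"
    then have "\<And>k. \<exists>y\<in>K. \<exists>\<sigma>. (\<forall>i. \<sigma> i \<le> b i) \<and> (\<forall>n\<le>k. (t, y) \<in> R n \<sigma>)"
      unfolding T_def by blast
    from compact_sections_limit[OF R K this] show "t \<in> P" unfolding P by blast
  qed
  ultimately show ?thesis using Tm by (intro bexI[of _ "\<Inter>k. T k"]) auto
qed

text \<open>The projection is squeezed between a measurable hull \<open>E\<close> and a countable
  union of measurable subsets whose measures approach that of \<open>E\<close>. The gap is a null
  set, and completeness of \<open>M\<close> absorbs it.\<close>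

lemma measurable_projection_compact:
  fixes A :: "('t \<times> 'b::{second_countable_topology, metric_space}) set"
  assumes fin: "finite_measure M" and com: "complete_measure M"
    and A: "A \<in> sets (M \<Otimes>\<^sub>M borel)" and K: "compact K"
  shows "{t. \<exists>y\<in>K. (t, y) \<in> A} \<in> sets M" (is "?P \<in> _")
proof -
  interpret finite_measure M by (rule fin)
  interpret complete_measure M by (rule com)
  obtain R where R: "suslin_scheme M R" and A': "A = {x. \<exists>\<sigma>. \<forall>n. x \<in> R n \<sigma>}"
    using sets_pair_measure_suslin[OF A] unfolding suslin_sets_def by blast
  have P: "?P = {t. \<exists>y\<in>K. \<exists>\<sigma>. \<forall>n. (t, y) \<in> R n \<sigma>}" unfolding A' by simp
  have "?P \<subseteq> space M" using sets.sets_into_space[OF A] by (auto simp: space_pair_measure)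
  from outer_measure_of_attain[OF this]
  obtain E where E: "E \<in> sets M" "?P \<subseteq> E" "outer_measure_of M ?P = emeasure M E" by blast
  define \<T> where "\<T> = {T \<in> sets M. T \<subseteq> ?P}"
  have ne: "\<T> \<noteq> {}" unfolding \<T>_def by blast
  have sup: "(SUP T\<in>\<T>. emeasure M T) = emeasure M E"
  proof (rule antisym)
    show "(SUP T\<in>\<T>. emeasure M T) \<le> emeasure M E"
      unfolding \<T>_def using E by (intro SUP_least emeasure_mono) auto
    show "emeasure M E \<le> (SUP T\<in>\<T>. emeasure M T)"
    proof (rule dense_le)
      fix c assume "c < emeasure M E"
      then have "c < outer_measure_of M ?P" using E by simp
      from suslin_projection_inner[OF fin R K P this]
      show "c \<le> (SUP T\<in>\<T>. emeasure M T)"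
        unfolding \<T>_def by (auto intro: SUP_upper2)
    qed
  qed
  obtain g :: "nat \<Rightarrow> ennreal"
    where g: "range g \<subseteq> emeasure M ` \<T>" "(SUP T\<in>\<T>. emeasure M T) = (SUP i. g i)"
    using ennreal_Sup_countable_SUP[of "emeasure M ` \<T>"] ne by auto
  have "\<forall>i. \<exists>T. T \<in> \<T> \<and> g i = emeasure M T" using g(1) by blast
  from choice[OF this] obtain U where U: "\<And>i. U i \<in> \<T>" "\<And>i. g i = emeasure M (U i)" by blast
  let ?T = "\<Union>i. U i"
  have T: "?T \<in> sets M" "?T \<subseteq> ?P" using U(1) unfolding \<T>_def by auto
  have "emeasure M E = emeasure M ?T"
  proof (rule antisym)
    show "emeasure M E \<le> emeasure M ?T"
      unfolding sup[symmetric] g(2) U(2) using T by (intro SUP_least emeasure_mono) auto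
    show "emeasure M ?T \<le> emeasure M E" using T E by (intro emeasure_mono) auto
  qed
  then show ?thesis
    using complete_sets_sandwich[OF T(1) E(1) T(2) E(2)]
    by (metis emeasure_finite top.not_eq_extremum infinity_ennreal_def)
qed

theorem measurable_projection:
  fixes A :: "('t \<times> 'b::{second_countable_topology, heine_borel}) set"
  assumes "finite_measure M" "complete_measure M" and A: "A \<in> sets (M \<Otimes>\<^sub>M borel)"
  shows "{t. \<exists>y. (t, y) \<in> A} \<in> sets M"
proof -
  have "y \<in> (\<Union>n::nat. cball undefined (real n))" for y :: 'b
    using real_arch_simple[of "dist undefined y"] by auto
  then have "{t. \<exists>y. (t, y) \<in> A} = (\<Union>n::nat. {t. \<exists>y\<in>cball undefined (real n). (t, y) \<in> A})"
    by blast
  also have "\<dots> \<in> sets M"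
    using measurable_projection_compact[OF assms] by auto
  finally show ?thesis .
qed

section \<open>Measurable selections\<close>

locale finite_complete_measure = finite_measure M + complete_measure M for M :: "'t measure"
begin

lemma projection_measurable:
  fixes A :: "('t \<times> 'b::euclidean_space) set"
  assumes "A \<in> sets (M \<Otimes>\<^sub>M borel)"
  shows "{t. \<exists>y. (t, y) \<in> A} \<in> sets M"
  by (rule measurable_projection[OF _ _ assms]) unfold_locales

text \<open>A value \<open>y\<close> fails to be minimal exactly if a rational \<open>q\<close> fits
  between \<open>f t z\<close> and \<open>f t y\<close> for some competitor \<open>z\<close>. The
  parameters \<open>t\<close> that admit such a \<open>z\<close> form the projection of a measurable
  set.\<close>

lemma argmin_set_measurable:
  fixes F :: "'t \<Rightarrow> 'b::euclidean_space set" and f :: "'t \<Rightarrow> 'b \<Rightarrow> real"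
  assumes F: "Sigma (space M) F \<in> sets (M \<Otimes>\<^sub>M borel)"
    and f: "(\<lambda>p. f (fst p) (snd p)) \<in> borel_measurable (M \<Otimes>\<^sub>M borel)"
  shows "Sigma (space M) (\<lambda>t. {y \<in> F t. \<forall>z\<in>F t. f t y \<le> f t z}) \<in> sets (M \<Otimes>\<^sub>M borel)"
proof -
  let ?G = "Sigma (space M) F"
  let ?X = "M \<Otimes>\<^sub>M (borel :: 'b measure)"
  have X: "space ?X = space M \<times> UNIV" by (simp add: space_pair_measure)
  have lt: "?G \<inter> {p \<in> space ?X. f (fst p) (snd p) < q} \<in> sets ?X"
    and gt: "?G \<inter> {p \<in> space ?X. q < f (fst p) (snd p)} \<in> sets ?X" for q
    using f by (intro sets.Int F; measurable)+
  define P where "P q = {t. \<exists>z. (t, z) \<in> ?G \<inter> {p \<in> space ?X. f (fst p) (snd p) < q}}" for q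
  have P: "P q \<in> sets M" for q unfolding P_def by (rule projection_measurable[OF lt])
  have "Sigma (space M) (\<lambda>t. {y \<in> F t. \<forall>z\<in>F t. f t y \<le> f t z})
    = ?G - (\<Union>q\<in>\<rat>. ?G \<inter> {p \<in> space ?X. q < f (fst p) (snd p)} \<inter> (P q \<times> UNIV))"
    (is "?L = ?R")
  proof (intro equalityI subsetI)
    fix p assume p: "p \<in> ?L"
    then obtain t y where ty: "p = (t, y)" "t \<in> space M" "y \<in> F t" "\<And>z. z \<in> F t \<Longrightarrow> f t y \<le> f t z" by blast
    have "\<not> (q < f t y \<and> t \<in> P q)" for q
      using ty(4) by (fastforce simp: P_def)
    then show "p \<in> ?R" using ty by auto
  next
    fix p assume p: "p \<in> ?R"
    then obtain t y where ty: "p = (t, y)" "t \<in> space M" "y \<in> F t" by blast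
    have "f t y \<le> f t z" if "z \<in> F t" for z
    proof (rule ccontr)
      assume "\<not> f t y \<le> f t z"
      then obtain q where "q \<in> \<rat>" "f t z < q" "q < f t y"
        by (meson Rats_dense_in_real not_le)
      moreover have "t \<in> P q" using ty that \<open>f t z < q\<close> by (auto simp: P_def X)
      ultimately show False using p ty by (auto simp: X)
    qed
    then show "p \<in> ?L" using ty by blast
  qed
  moreover have "?R \<in> sets ?X"
    using countable_rat P gt by (intro sets.Diff F sets.countable_UN' sets.Int) auto
  ultimately show ?thesis by simp
qed

text \<open>Minimising one linear functional after another keeps the values compact and nonempty
  while fixing one more coordinate each time. With \<open>B\<close> the standard basis, the
  lexicographically least point of \<open>F t\<close> remains.\<close>

lemma lexicographic_refinement:
  fixes F :: "'t \<Rightarrow> 'b::euclidean_space set"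
  assumes F: "Sigma (space M) F \<in> sets (M \<Otimes>\<^sub>M borel)" and c: "\<forall>t\<in>space M. compact (F t)"
    and B: "finite B"
  shows "\<exists>G. Sigma (space M) G \<in> sets (M \<Otimes>\<^sub>M borel) \<and>
    (\<forall>t\<in>space M. compact (G t) \<and> G t \<subseteq> F t \<and> (F t \<noteq> {} \<longrightarrow> G t \<noteq> {}) \<and>
      (\<forall>b\<in>B. \<forall>y\<in>G t. \<forall>z\<in>G t. inner y b = inner z b))"
  using B
proof (induction B rule: finite_induct)
  case empty
  then show ?case using F c by blast
next
  case (insert b B)
  then obtain G where G: "Sigma (space M) G \<in> sets (M \<Otimes>\<^sub>M borel)"
    and GP: "\<And>t. t \<in> space M \<Longrightarrow> compact (G t) \<and> G t \<subseteq> F t \<and> (F t \<noteq> {} \<longrightarrow> G t \<noteq> {}) \<and>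
      (\<forall>b\<in>B. \<forall>y\<in>G t. \<forall>z\<in>G t. inner y b = inner z b)" by blast
  define H where "H t = {y \<in> G t. \<forall>z\<in>G t. inner y b \<le> inner z b}" for t
  have "Sigma (space M) H \<in> sets (M \<Otimes>\<^sub>M borel)"
    unfolding H_def by (rule argmin_set_measurable[OF G]) measurable
  moreover have "compact (H t) \<and> H t \<subseteq> F t \<and> (F t \<noteq> {} \<longrightarrow> H t \<noteq> {}) \<and>
      (\<forall>b\<in>insert b B. \<forall>y\<in>H t. \<forall>z\<in>H t. inner y b = inner z b)" if t: "t \<in> space M" for t
  proof (intro conjI impI)
    have "H t = G t \<inter> (\<Inter>z\<in>G t. {y. inner y b \<le> inner z b})" unfolding H_def by blast
    moreover have "closed (\<Inter>z\<in>G t. {y. inner y b \<le> inner z b})"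
      by (intro closed_INT ballI closed_Collect_le continuous_intros)
    ultimately show "compact (H t)" using GP[OF t] by (simp add: compact_Int_closed)
    show "H t \<subseteq> F t" using GP[OF t] unfolding H_def by blast
    show "H t \<noteq> {}" if "F t \<noteq> {}"
    proof -
      have "continuous_on (G t) (\<lambda>y. inner y b)" by (intro continuous_intros)
      with continuous_attains_inf[of "G t"] GP[OF t] that
      have "\<exists>y\<in>G t. \<forall>z\<in>G t. inner y b \<le> inner z b" by blast
      then show ?thesis unfolding H_def by blast
    qed
    show "\<forall>b\<in>insert b B. \<forall>y\<in>H t. \<forall>z\<in>H t. inner y b = inner z b"
      using GP[OF t] unfolding H_def by (auto intro!: antisym)
  qed
  ultimately show ?case by blast
qed

text \<open>After the refinement each nonempty value is a single point, so the graph determines the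
  selection, and preimages of Borel sets are projections of the graph cut down to these
  sets.\<close>

lemma compact_selection:
  fixes F :: "'t \<Rightarrow> 'b::euclidean_space set"
  assumes F: "Sigma (space M) F \<in> sets (M \<Otimes>\<^sub>M borel)" and c: "\<forall>t\<in>space M. compact (F t)"
  obtains g where "g \<in> borel_measurable M" "\<And>t. t \<in> space M \<Longrightarrow> F t \<noteq> {} \<Longrightarrow> g t \<in> F t"
proof -
  from lexicographic_refinement[OF F c finite_Basis]
  obtain G where G: "Sigma (space M) G \<in> sets (M \<Otimes>\<^sub>M borel)"
    and GB: "\<forall>t\<in>space M. compact (G t) \<and> G t \<subseteq> F t \<and> (F t \<noteq> {} \<longrightarrow> G t \<noteq> {}) \<and>
      (\<forall>b\<in>Basis. \<forall>y\<in>G t. \<forall>z\<in>G t. inner y b = inner z b)"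
    by blast
  have uniq: "y = z" if "t \<in> space M" "y \<in> G t" "z \<in> G t" for t y z
  proof (rule euclidean_eqI)
    fix b :: 'b assume b: "b \<in> Basis"
    have "\<forall>b\<in>Basis. \<forall>y\<in>G t. \<forall>z\<in>G t. inner y b = inner z b"
      using bspec[OF GB that(1)] by (elim conjE)
    from bspec[OF bspec[OF bspec[OF this b] that(2)] that(3)] show "inner y b = inner z b" .
  qed
  define g where "g t = (if G t = {} then 0 else SOME y. y \<in> G t)" for t
  have gG: "g t \<in> G t" if "G t \<noteq> {}" for t unfolding g_def using that by (auto intro: someI)
  have "g \<in> borel_measurable M"
  proof (rule measurableI)
    fix A :: "'b set" assume A: "A \<in> sets borel"
    let ?p = "\<lambda>A. {t. \<exists>y. (t, y) \<in> Sigma (space M) G \<inter> (space M \<times> A)}"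
    have p: "?p A \<in> sets M" if "A \<in> sets borel" for A
      by (rule projection_measurable, rule sets.Int[OF G]) (use that in auto)
    \<comment> \<open>Where \<open>G t\<close> is empty the selection takes the default value 0,
      which accounts for the extra set.\<close>
    have "g -` A \<inter> space M = ?p A \<union> (if 0 \<in> A then space M - ?p UNIV else {})"
    proof (intro equalityI subsetI)
      fix t assume t: "t \<in> g -` A \<inter> space M"
      show "t \<in> ?p A \<union> (if 0 \<in> A then space M - ?p UNIV else {})"
      proof (cases "G t = {}")
        case True then show ?thesis using t by (auto simp: g_def)
      next
        case False then show ?thesis using t gG[OF False] by auto
      qed
    next
      fix t assume "t \<in> ?p A \<union> (if 0 \<in> A then space M - ?p UNIV else {})"
      then consider y where "t \<in> space M" "y \<in> G t" "y \<in> A" | "t \<in> space M" "G t = {}" "0 \<in> A"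
        by (auto split: if_splits)
      then show "t \<in> g -` A \<inter> space M"
      proof cases
        case 1
        then have "g t = y" using uniq[OF 1(1) _ 1(2)] gG by blast
        then show ?thesis using 1 by simp
      qed (simp add: g_def)
    qed
    then show "g -` A \<inter> space M \<in> sets M" using p[OF A] p[of UNIV] by auto
  qed simp
  moreover have "g t \<in> F t" if "t \<in> space M" "F t \<noteq> {}" for t
    using GB that gG by (meson subsetD)
  ultimately show ?thesis using that by blast
qed

lemma argmin_selection:
  fixes F :: "'t \<Rightarrow> 'b::euclidean_space set" and f :: "'t \<Rightarrow> 'b \<Rightarrow> real"
  assumes F: "Sigma (space M) F \<in> sets (M \<Otimes>\<^sub>M borel)" and c: "\<forall>t\<in>space M. compact (F t)"
    and f: "(\<lambda>p. f (fst p) (snd p)) \<in> borel_measurable (M \<Otimes>\<^sub>M borel)"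
    and cont: "\<And>t. t \<in> space M \<Longrightarrow> continuous_on UNIV (f t)"
  obtains g where "g \<in> borel_measurable M"
    "\<And>t. t \<in> space M \<Longrightarrow> F t \<noteq> {} \<Longrightarrow> g t \<in> F t"
    "\<And>t z. t \<in> space M \<Longrightarrow> z \<in> F t \<Longrightarrow> f t (g t) \<le> f t z"
proof -
  define H where "H t = {y \<in> F t. \<forall>z\<in>F t. f t y \<le> f t z}" for t
  have H: "Sigma (space M) H \<in> sets (M \<Otimes>\<^sub>M borel)"
    unfolding H_def by (rule argmin_set_measurable[OF F f])
  have "\<forall>t\<in>space M. compact (H t)"
  proof
    fix t assume t: "t \<in> space M"
    have "H t = F t \<inter> (\<Inter>z\<in>F t. {y. f t y \<le> f t z})" unfolding H_def by blast
    moreover have "closed (\<Inter>z\<in>F t. {y. f t y \<le> f t z})"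
      by (intro closed_INT ballI closed_Collect_le continuous_intros cont[OF t])
    ultimately show "compact (H t)" using c t by (simp add: compact_Int_closed)
  qed
  from compact_selection[OF H this]
  obtain g where g: "g \<in> borel_measurable M" "\<And>t. t \<in> space M \<Longrightarrow> H t \<noteq> {} \<Longrightarrow> g t \<in> H t" by blast
  have "H t \<noteq> {}" if t: "t \<in> space M" and "F t \<noteq> {}" for t
    using continuous_attains_inf[of "F t" "f t"] c continuous_on_subset[OF cont[OF t]] that
    unfolding H_def by auto
  then have "g t \<in> H t" if "t \<in> space M" "F t \<noteq> {}" for t using g(2) that by blast
  then show ?thesis using g(1) that[of g] unfolding H_def by blast
qed

lemma borel_measurable_AE_eq:
  fixes f g :: "'t \<Rightarrow> 'b::topological_space"
  assumes f: "f \<in> borel_measurable M" and eq: "AE t in M. f t = g t"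
  shows "g \<in> borel_measurable M"
proof (rule measurableI)
  fix A :: "'b set" assume A: "A \<in> sets borel"
  show "g -` A \<inter> space M \<in> sets M"
  proof (rule in_sets_AE)
    show "f -` A \<inter> space M \<in> sets M" using f A by (rule measurable_sets)
    show "AE t in M. t \<in> f -` A \<inter> space M \<longleftrightarrow> t \<in> g -` A \<inter> space M"
      using eq by eventually_elim auto
  qed simp
qed simp

end

section \<open>Coderivatives of Lipschitzian set-valued maps\<close>

lemma regular_normal_cone_iff:
  "zs \<in> regular_normal_cone z S \<longleftrightarrow>
    z \<in> S \<and> (\<forall>e>0. \<exists>d>0. \<forall>w\<in>S. dist w z < d \<longrightarrow> inner zs (w - z) \<le> e * norm (w - z))"
proof (cases "z \<in> S")
  case True
  have "(Limsup (at z within S) (\<lambda>w. ereal (inner zs (w - z) / norm (w - z))) \<le> 0) \<longleftrightarrow>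
    (\<forall>e>0. \<exists>d>0. \<forall>w\<in>S. dist w z < d \<longrightarrow> inner zs (w - z) \<le> e * norm (w - z))"
    (is "?L \<longleftrightarrow> ?R")
  proof
    assume ?L
    show ?R
    proof (intro allI impI)
      fix e :: real assume "e > 0"
      then have "eventually (\<lambda>w. ereal (inner zs (w - z) / norm (w - z)) < ereal e) (at z within S)"
        using \<open>?L\<close>[unfolded Limsup_le_iff, rule_format, of "ereal e"] by simp
      then obtain d where "d > 0"
        and d: "\<And>w. w \<in> S \<Longrightarrow> w \<noteq> z \<Longrightarrow> dist w z < d \<Longrightarrow> inner zs (w - z) / norm (w - z) < e"
        unfolding eventually_at by auto
      have "inner zs (w - z) \<le> e * norm (w - z)" if "w \<in> S" "dist w z < d" for w
      proof (cases "w = z")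
        case False
        then show ?thesis using d[OF that(1) False that(2)] by (simp add: pos_divide_less_eq)
      qed simp
      then show "\<exists>d>0. \<forall>w\<in>S. dist w z < d \<longrightarrow> inner zs (w - z) \<le> e * norm (w - z)"
        using \<open>d > 0\<close> by blast
    qed
  next
    assume R: ?R
    show ?L
      unfolding Limsup_le_iff
    proof (intro allI impI)
      fix y :: ereal assume "0 < y"
      then obtain e where e: "0 < ereal e" "ereal e < y" using ereal_dense2 by blast
      then obtain d where d: "d > 0" "\<And>w. w \<in> S \<Longrightarrow> dist w z < d \<Longrightarrow> inner zs (w - z) \<le> e * norm (w - z)"
        using R by auto
      have "ereal (inner zs (w - z) / norm (w - z)) < y" if "w \<in> S" "w \<noteq> z" "dist w z < d" for w
      proof -
        have "inner zs (w - z) / norm (w - z) \<le> e"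
          using d(2)[OF that(1,3)] that(2) by (simp add: pos_divide_le_eq)
        then show ?thesis using e(2) by (metis ereal_less_eq(3) order_le_less_trans)
      qed
      then show "eventually (\<lambda>w. ereal (inner zs (w - z) / norm (w - z)) < y) (at z within S)"
        unfolding eventually_at using d(1) by blast
    qed
  qed
  then show ?thesis using True unfolding regular_normal_cone_def by simp
qed (simp add: regular_normal_cone_def)

lemma regular_coderivative_iff:
  "xs \<in> regular_coderivative G x y ys \<longleftrightarrow> y \<in> G x \<and>
    (\<forall>e>0. \<exists>d>0. \<forall>x' y'. y' \<in> G x' \<and> dist (x', y') (x, y) < d \<longrightarrow>
      inner xs (x' - x) - inner ys (y' - y) \<le> e * norm (x' - x, y' - y))"
  unfolding regular_coderivative_def regular_normal_cone_iff gph_def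
  by (simp add: Ball_def split_paired_All inner_Pair imp_conjL)

lemma regular_coderivative_mem: "xs \<in> regular_coderivative G x y ys \<Longrightarrow> y \<in> G x"
  unfolding regular_coderivative_iff by (rule conjunct1)

lemma regular_coderivativeE:
  assumes "xs \<in> regular_coderivative G x y ys" "e > 0"
  obtains d where "d > 0" "\<And>x' y'. y' \<in> G x' \<Longrightarrow> dist (x', y') (x, y) < d \<Longrightarrow>
    inner xs (x' - x) - inner ys (y' - y) \<le> e * norm (x' - x, y' - y)"
proof -
  have "\<forall>e>0. \<exists>d>0. \<forall>x' y'. y' \<in> G x' \<and> dist (x', y') (x, y) < d \<longrightarrow>
      inner xs (x' - x) - inner ys (y' - y) \<le> e * norm (x' - x, y' - y)"
    using assms(1) unfolding regular_coderivative_iff by (rule conjunct2)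
  from this[rule_format, OF assms(2)] show ?thesis using that by blast
qed

lemma regular_subset_limiting_coderivative:
  "regular_coderivative G x y ys \<subseteq> limiting_coderivative G x y ys"
  unfolding regular_coderivative_def limiting_coderivative_def limiting_normal_cone_def
  by (blast intro: tendsto_const)

definition lipschitz_map :: "('a::real_normed_vector \<Rightarrow> 'b::real_normed_vector set) \<Rightarrow> real \<Rightarrow> 'a set \<Rightarrow> bool" where
  "lipschitz_map G l U \<longleftrightarrow>
    (\<forall>x\<in>U. \<forall>x'\<in>U. \<forall>y\<in>G x. \<exists>y'\<in>G x'. norm (y - y') \<le> l * norm (x - x'))"

lemma lipschitz_mapE:
  assumes "lipschitz_map G l U" "x \<in> U" "x' \<in> U" "y \<in> G x"
  obtains y' where "y' \<in> G x'" "norm (y - y') \<le> l * norm (x - x')"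
  using assms unfolding lipschitz_map_def by blast

lemma norm_Pair_le_sum: "norm (a, b) \<le> norm a + norm b"
  unfolding norm_Pair by (rule sqrt_sum_squares_le_sum) auto

lemma norm_le_norm_Pair: "norm a \<le> norm (a, b)" "norm b \<le> norm (a, b)"
  unfolding norm_Pair by (simp_all add: real_le_rsqrt)

text \<open>Move from \<open>x\<close> in the direction \<open>xs\<close> itself. The gain is
  \<open>norm xs\<close> per unit of length, while the Lipschitz property supplies a value whose
  change costs at most \<open>l * norm ys\<close> per unit.\<close>

lemma regular_coderivative_bound:
  fixes G :: "'a::euclidean_space \<Rightarrow> 'b::euclidean_space set"
  assumes lip: "lipschitz_map G l U" and U: "open V" "V \<subseteq> U" "x \<in> V" and l: "l \<ge> 0"
    and xs: "xs \<in> regular_coderivative G x y ys"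
  shows "norm xs \<le> l * norm ys"
proof (cases "xs = 0")
  case False
  note y = regular_coderivative_mem[OF xs]
  have main: "norm xs \<le> l * norm ys + e * (1 + l)" if "e > 0" for e
  proof -
    obtain d where d: "d > 0" "\<And>x' y'. y' \<in> G x' \<Longrightarrow> dist (x', y') (x, y) < d \<Longrightarrow>
      inner xs (x' - x) - inner ys (y' - y) \<le> e * norm (x' - x, y' - y)"
      using regular_coderivativeE[OF xs \<open>e > 0\<close>] by blast
    obtain r where r: "r > 0" "ball x r \<subseteq> V" using U openE by blast
    \<comment> \<open>The step has length \<open>m / 2\<close>: short enough to stay in
      \<open>V\<close>, and, since the pair moves by at most \<open>1 + l\<close> times as much,
      within the radius \<open>d\<close> of the normal inequality.\<close>
    define m where "m = min r (d / (1 + l))"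
    have m: "m > 0" "m \<le> r" "m \<le> d / (1 + l)" unfolding m_def using r d l by auto
    define s where "s = m / (2 * norm xs)"
    have s: "s > 0" using m False unfolding s_def by simp
    have sn: "s * norm xs = m / 2" using False unfolding s_def by simp
    define x' where "x' = x + s *\<^sub>R xs"
    have nx: "norm (x' - x) = s * norm xs" unfolding x'_def using s by simp
    have "norm (x' - x) < r" unfolding nx sn using m by linarith
    moreover have "norm (x' - x) < d / (1 + l)" unfolding nx sn using m by linarith
    ultimately have "x' \<in> V" and small: "norm (x' - x) * (1 + l) < d"
      using r l by (auto simp: dist_norm norm_minus_commute pos_less_divide_eq subset_eq)
    then obtain y' where y': "y' \<in> G x'" "norm (y - y') \<le> l * norm (x - x')"
      using lipschitz_mapE[OF lip _ _ y, of x'] U by blast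
    have ny: "norm (y' - y) \<le> l * (s * norm xs)" using y'(2) nx by (simp add: norm_minus_commute)
    have np: "norm (x' - x, y' - y) \<le> (1 + l) * (s * norm xs)"
      using norm_Pair_le_sum[of "x' - x" "y' - y"] ny nx by (simp add: algebra_simps)
    then have "dist (x', y') (x, y) < d" using small nx by (simp add: dist_norm mult.commute)
    from d(2)[OF y'(1) this]
    have "inner xs (x' - x) - inner ys (y' - y) \<le> e * ((1 + l) * (s * norm xs))"
      using np that by (meson mult_left_mono order_trans less_imp_le)
    moreover have "inner xs (x' - x) = (s * norm xs) * norm xs"
      unfolding x'_def by (simp add: dot_square_norm power2_eq_square)
    moreover have "inner ys (y' - y) \<le> norm ys * (l * (s * norm xs))"
      using norm_cauchy_schwarz[of ys "y' - y"] ny by (meson mult_left_mono norm_ge_zero order_trans)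
    ultimately have "(s * norm xs) * norm xs \<le> (s * norm xs) * (l * norm ys + e * (1 + l))"
      by (simp add: algebra_simps)
    then show ?thesis using s False by (simp add: mult_le_cancel_left)
  qed
  show ?thesis
  proof (rule field_le_epsilon)
    fix e :: real assume "e > 0"
    then have "e / (1 + l) > 0" using l by simp
    from main[OF this] show "norm xs \<le> l * norm ys + e" using l by simp
  qed
qed (use l in simp)

section \<open>The mean value inequality and its form near the reference point\<close>

lemma local_min_coderivative:
  fixes G :: "'a::euclidean_space \<Rightarrow> 'b::euclidean_space set" and Q :: "'a \<times> 'b \<Rightarrow> real"
  assumes der: "(Q has_derivative (\<lambda>w. inner p (fst w) + inner q (snd w))) (at (x0, y0))"
    and y0: "y0 \<in> G x0" and r: "r > 0"
    and min: "\<And>x y. y \<in> G x \<Longrightarrow> dist (x, y) (x0, y0) < r \<Longrightarrow> Q (x0, y0) \<le> Q (x, y)"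
  shows "- p \<in> regular_coderivative G x0 y0 q"
  unfolding regular_coderivative_iff
proof (intro conjI allI impI y0)
  fix e :: real assume "e > 0"
  then obtain d where d: "d > 0" "\<And>w. norm (w - (x0, y0)) < d \<Longrightarrow>
      norm (Q w - Q (x0, y0) - (inner p (fst (w - (x0, y0))) + inner q (snd (w - (x0, y0)))))
        \<le> e * norm (w - (x0, y0))"
    using der unfolding has_derivative_at_alt by blast
  \<comment> \<open>Minimality makes the increment of \<open>Q\<close> nonnegative, so its linear
    part is at least \<open>- e\<close> times the displacement; this is the normal inequality for
    the negative gradient \<open>(- p, - q)\<close>.\<close>
  have "inner (- p) (x' - x0) - inner q (y' - y0) \<le> e * norm (x' - x0, y' - y0)"
    if "y' \<in> G x'" "dist (x', y') (x0, y0) < min d r" for x' y'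
    using d(2)[of "(x', y')"] min[OF that(1)] that(2) by (auto simp: dist_norm)
  then show "\<exists>d>0. \<forall>x' y'. y' \<in> G x' \<and> dist (x', y') (x0, y0) < d \<longrightarrow>
      inner (- p) (x' - x0) - inner q (y' - y0) \<le> e * norm (x' - x0, y' - y0)"
    using d(1) r by (intro exI[of _ "min d r"]) auto
qed

text \<open>If \<open>inner z\<close> grows with slope more than \<open>c\<close> along \<open>h\<close>, then penalising the distance
  to the segment from \<open>x0\<close> to \<open>x0 + s *\<^sub>R h\<close> by a large multiple \<open>N\<close> forces a minimiser whose
  segment parameter \<open>\<sigma>\<close> is not the right end point.\<close>

lemma mean_value_coderivative:
  fixes G :: "'a::euclidean_space \<Rightarrow> 'b::euclidean_space set" and z :: 'b
  assumes cl: "closed (gph G)" and lip: "lipschitz_map G l (cball x0 r0)" and r0: "r0 > 0" and l: "l \<ge> 0"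
    and u0: "u0 \<in> G x0" and eps: "eps > 0" and delta: "delta > 0"
    and locmin: "\<And>v. v \<in> G x0 \<Longrightarrow> norm (v - u0) \<le> delta \<Longrightarrow> - eps * norm (v - u0) \<le> inner z (v - u0)"
    and bad: "\<And>s0. s0 > 0 \<Longrightarrow> \<exists>s. 0 < s \<and> s < s0 \<and> (\<forall>v\<in>G (x0 + s *\<^sub>R h). norm (v - u0) \<le> delta / 2 \<longrightarrow>
      c * s < inner z (v - u0) + 2 * eps * norm (v - u0))"
    and gam: "gam > 0"
  shows "\<exists>x' u' z' xs. u' \<in> G x' \<and> norm (x' - x0) < gam \<and> norm (u' - u0) < gam \<and>
    norm (z' - z) \<le> 2 * eps \<and> xs \<in> regular_coderivative G x' u' z' \<and> c - 3 * eps \<le> inner xs h"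
proof -
  \<comment> \<open>The loss of \<open>3 * eps\<close> is spent as follows:
    \<open>2 * eps * s\<close> is the value of the smoothed penalty at the starting point, and
    \<open>eps * s\<close> pays for moving a minimiser near the right end point onto a value of
    \<open>G (x0 + s *\<^sub>R h)\<close>.\<close>
  define c2 where "c2 = c - 3 * eps"
  define k where "k = norm h + 1"
  have k: "k \<ge> 1" unfolding k_def by simp
  \<comment> \<open>\<open>s * K\<close> is the bound that \<open>uloc\<close> gives for
    \<open>eps * norm (u - u0)\<close>. The five bounds in \<open>s0\<close> keep the segment in the
    Lipschitz ball, the minimiser \<open>x\<close> within \<open>gam\<close>, the Lipschitz
    displacement \<open>l * r\<close> below \<open>delta / 4\<close>, and \<open>u\<close> within
    \<open>delta / 4\<close> and \<open>gam\<close> of \<open>u0\<close>.\<close>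
  define K where "K = 2 * eps + \<bar>c2\<bar> + (eps + norm z) * (l * k)"
  have K: "K > 0" unfolding K_def using eps l k by (intro add_pos_nonneg) auto
  define s0 where "s0 = Min {r0 / k, gam / k, delta / (4 * (l * k + 1)), eps * delta / (4 * K), eps * gam / K}"
  have "s0 > 0" unfolding s0_def using r0 gam delta eps K k l
    by (simp add: add_nonneg_pos)
  then obtain s where s: "0 < s" "s < s0"
    and sbad: "\<And>v. v \<in> G (x0 + s *\<^sub>R h) \<Longrightarrow> norm (v - u0) \<le> delta / 2 \<Longrightarrow>
      c * s < inner z (v - u0) + 2 * eps * norm (v - u0)"
    using bad by blast
  have ss: "s < r0 / k" "s < gam / k" "s < delta / (4 * (l * k + 1))" "s < eps * delta / (4 * K)" "s < eps * gam / K"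
    using s(2) unfolding s0_def by auto
  define r where "r = s * k"
  have r: "r > 0" "r < r0" "r < gam" "s \<le> r"
    unfolding r_def using ss(1,2) k s(1) by (simp_all add: pos_less_divide_eq)
  have lr: "l * r \<le> delta / 4"
  proof -
    have "s * (4 * (l * k + 1)) < delta" using ss(3) l k
      by (subst (asm) pos_less_divide_eq) (auto intro: add_nonneg_pos)
    then show ?thesis unfolding r_def using s(1) by (simp add: algebra_simps)
  qed
  have sK: "s * K < eps * delta / 4" "s * K < eps * gam"
    using ss(4,5) K by (simp_all add: pos_less_divide_eq algebra_simps)
  \<comment> \<open>\<open>B\<close> bounds the term \<open>N * (norm w)\<^sup>2\<close> at a
    minimiser. \<open>\<theta>\<close> is a distance from the segment whose correction costs at most
    \<open>eps * s\<close>, and \<open>N\<close> is large enough that the bound \<open>B\<close>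
    forces \<open>norm w < \<theta>\<close>.\<close>
  define B where "B = 2 * eps * s + norm z * (delta / 2) + \<bar>c2\<bar> * s"
  have B: "B \<ge> 0" unfolding B_def using eps s delta by simp
  define \<theta> where "\<theta> = min s (eps * s / ((norm z + 2 * eps) * l + 1))"
  have den: "(norm z + 2 * eps) * l + 1 > 0" using eps l by (intro add_nonneg_pos mult_nonneg_nonneg) auto
  have \<theta>: "\<theta> > 0" "\<theta> \<le> s" unfolding \<theta>_def using s eps den by auto
  have \<theta>l: "(norm z + 2 * eps) * (l * \<theta>) \<le> eps * s"
  proof -
    have "\<theta> \<le> eps * s / ((norm z + 2 * eps) * l + 1)" unfolding \<theta>_def by simp
    then have "\<theta> * ((norm z + 2 * eps) * l + 1) \<le> eps * s" using den by (simp add: pos_le_divide_eq)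
    then show ?thesis using \<theta>(1) by (simp add: algebra_simps)
  qed
  define N where "N = (B + 1) / \<theta>\<^sup>2"
  have N: "N > 0" unfolding N_def using B \<theta> by simp
  \<comment> \<open>The square root replaces \<open>norm (u - u0)\<close> by a function that is
    differentiable also at \<open>u0\<close> and exceeds the norm by at most
    \<open>s\<close>.\<close>
  define F where "F w = inner z (snd (fst w) - u0) + 2 * eps * sqrt ((norm (snd (fst w) - u0))\<^sup>2 + s\<^sup>2)
      + N * (norm (fst (fst w) - x0 - snd w *\<^sub>R h))\<^sup>2 - c2 * snd w" for w :: "('a \<times> 'b) \<times> real"
  define S where "S = (gph G \<inter> (cball x0 r \<times> cball u0 (delta / 2))) \<times> {0..s}"
  have S: "((x, u), \<sigma>) \<in> S \<longleftrightarrow> u \<in> G x \<and> norm (x - x0) \<le> r \<and> norm (u - u0) \<le> delta / 2 \<and> 0 \<le> \<sigma> \<and> \<sigma> \<le> s" for x u \<sigma>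
    unfolding S_def gph_def by (auto simp: dist_norm norm_minus_commute)
  have "compact S" unfolding S_def
    by (intro compact_Times closed_Int_compact cl compact_cball compact_Icc)
  moreover have init: "((x0, u0), 0) \<in> S" unfolding S using u0 r s delta by simp
  moreover have "continuous_on S F" unfolding F_def by (intro continuous_intros)
  ultimately have "\<exists>w\<in>S. \<forall>w'\<in>S. F w \<le> F w'" by (intro continuous_attains_inf) auto
  then obtain x u \<sigma> where xS: "((x, u), \<sigma>) \<in> S" and Fmin: "\<And>w. w \<in> S \<Longrightarrow> F ((x, u), \<sigma>) \<le> F w"
    by (metis surj_pair)
  have x: "u \<in> G x" "norm (x - x0) \<le> r" "norm (u - u0) \<le> delta / 2" "0 \<le> \<sigma>" "\<sigma> \<le> s"
    using xS unfolding S by auto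
  define w where "w = x - x0 - \<sigma> *\<^sub>R h"
  have "\<bar>s\<bar> = s" using s(1) by simp
  then have "F ((x0, u0), 0) = 2 * eps * s" unfolding F_def by simp
  with Fmin[OF init] have "F ((x, u), \<sigma>) \<le> 2 * eps * s" by simp
  then have F0: "inner z (u - u0) + 2 * eps * sqrt ((norm (u - u0))\<^sup>2 + s\<^sup>2) + N * (norm w)\<^sup>2 - c2 * \<sigma>
      \<le> 2 * eps * s" unfolding F_def w_def by simp
  have sq: "norm (u - u0) \<le> sqrt ((norm (u - u0))\<^sup>2 + s\<^sup>2)" by (simp add: real_le_rsqrt)
  have F1: "inner z (u - u0) + 2 * eps * norm (u - u0) + N * (norm w)\<^sup>2 \<le> 2 * eps * s + c2 * \<sigma>"
  proof -
    have "2 * eps * norm (u - u0) \<le> 2 * eps * sqrt ((norm (u - u0))\<^sup>2 + s\<^sup>2)"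
      using sq eps by (intro mult_left_mono) auto
    then show ?thesis using F0 by linarith
  qed
  have c2s: "c2 * \<sigma> \<le> \<bar>c2\<bar> * s"
    using x(4,5) by (smt (verit) abs_ge_self abs_ge_zero mult_left_mono mult_right_mono)
  have zu: "- (norm z * norm (u - u0)) \<le> inner z (u - u0)"
    using Cauchy_Schwarz_ineq2[of z "u - u0"] by linarith
  have "norm w < \<theta>"
  proof -
    have "norm z * norm (u - u0) \<le> norm z * (delta / 2)" using x(3) by (intro mult_left_mono) auto
    then have "N * (norm w)\<^sup>2 \<le> B" using F1 zu c2s eps unfolding B_def
      by (smt (verit) mult_nonneg_nonneg norm_ge_zero)
    then have "(B + 1) * (norm w)\<^sup>2 \<le> B * \<theta>\<^sup>2" unfolding N_def using \<theta> by (simp add: field_simps)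
    also have "\<dots> < (B + 1) * \<theta>\<^sup>2" using \<theta> by simp
    finally have "(norm w)\<^sup>2 < \<theta>\<^sup>2" using B by (simp add: mult_less_cancel_left)
    then show ?thesis using \<theta> by (simp add: power_less_imp_less_base)
  qed
  then have ws: "norm w < s" using \<theta> by simp
  have xr: "norm (x - x0) < r"
  proof -
    have "x - x0 = \<sigma> *\<^sub>R h + w" unfolding w_def by simp
    then have "norm (x - x0) \<le> \<sigma> * norm h + norm w"
      using norm_triangle_ineq[of "\<sigma> *\<^sub>R h" w] x(4) by simp
    also have "\<dots> \<le> s * norm h + norm w" using x(5) by (simp add: mult_right_mono)
    also have "\<dots> < r" using ws unfolding r_def k_def by (simp add: algebra_simps)
    finally show ?thesis .
  qed
  \<comment> \<open>Transporting \<open>u\<close> to a value of \<open>G x0\<close> allows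
    \<open>locmin\<close> to be applied. It costs \<open>eps * norm (u - u0)\<close> up to small
    terms, whereas \<open>F\<close> charges twice that; the surplus confines
    \<open>u\<close>.\<close>
  have uloc: "eps * norm (u - u0) \<le> s * K"
  proof -
    obtain v where v: "v \<in> G x0" "norm (u - v) \<le> l * norm (x - x0)"
      using lipschitz_mapE[OF lip _ _ x(1), of x0] xr r r0 by (auto simp: dist_norm norm_minus_commute)
    have vu: "norm (u - v) \<le> l * r" using v(2) mult_left_mono[OF x(2) l] by linarith
    have tri: "norm (v - u0) \<le> norm (u - v) + norm (u - u0)"
      using norm_triangle_ineq[of "v - u" "u - u0"] by (simp add: norm_minus_commute)
    have "norm (v - u0) \<le> delta" using tri vu lr x(3) delta by linarith
    then have a: "- eps * norm (v - u0) \<le> inner z (v - u0)" by (rule locmin[OF v(1)])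
    have b: "inner z (v - u0) \<le> inner z (u - u0) + norm z * (l * r)"
    proof -
      have "inner z (v - u) \<le> norm z * norm (v - u)" by (rule norm_cauchy_schwarz)
      also have "\<dots> \<le> norm z * (l * r)" using vu by (intro mult_left_mono) (auto simp: norm_minus_commute)
      finally show ?thesis by (simp add: inner_diff_right)
    qed
    have c: "eps * norm (v - u0) \<le> eps * (l * r) + eps * norm (u - u0)"
      using mult_left_mono[OF order_trans[OF tri add_right_mono[OF vu]], of eps] eps
      by (simp add: algebra_simps)
    have "N * (norm w)\<^sup>2 \<ge> 0" using N by simp
    then have "eps * norm (u - u0) \<le> 2 * eps * s + \<bar>c2\<bar> * s + (eps + norm z) * (l * r)"
      using F1 c2s a b c by (simp add: algebra_simps)
    also have "\<dots> = s * K" unfolding K_def r_def by (simp add: algebra_simps)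
    finally show ?thesis .
  qed
  have ud: "norm (u - u0) < delta / 4" and ug: "norm (u - u0) < gam"
    using uloc sK eps by (smt (verit) mult_less_cancel_left_pos times_divide_eq_right)+
  \<comment> \<open>At the right end point \<open>u\<close> would be within
    \<open>l * \<theta>\<close> of a value for which \<open>sbad\<close> holds, and the growth
    \<open>c * s\<close> exceeds what minimality of \<open>F\<close> allows.\<close>
  have "\<sigma> \<noteq> s"
  proof
    assume \<sigma>: "\<sigma> = s"
    have "x0 + s *\<^sub>R h \<in> cball x0 r0"
      using r s(1) unfolding r_def k_def by (simp add: dist_norm algebra_simps)
    moreover have "x \<in> cball x0 r0" using xr r by (simp add: dist_norm norm_minus_commute)
    ultimately obtain v where v: "v \<in> G (x0 + s *\<^sub>R h)" "norm (u - v) \<le> l * norm (x - (x0 + s *\<^sub>R h))"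
      using lipschitz_mapE[OF lip _ _ x(1)] by blast
    have "x - (x0 + s *\<^sub>R h) = w" unfolding w_def \<sigma> by simp
    then have vu: "norm (u - v) \<le> l * \<theta>" using v(2) \<open>norm w < \<theta>\<close> l
      by (smt (verit) mult_left_mono)
    have tri: "norm (v - u0) \<le> norm (u - v) + norm (u - u0)"
      using norm_triangle_ineq[of "v - u" "u - u0"] by (simp add: norm_minus_commute)
    have "l * \<theta> \<le> l * r" using \<theta>(2) r(4) l by (intro mult_left_mono) auto
    then have "norm (v - u0) \<le> delta / 2" using tri vu lr ud by linarith
    then have "c * s < inner z (v - u0) + 2 * eps * norm (v - u0)" by (rule sbad[OF v(1)])
    moreover have "inner z (v - u0) \<le> inner z (u - u0) + norm z * (l * \<theta>)"
    proof -
      have "inner z (v - u) \<le> norm z * norm (v - u)" by (rule norm_cauchy_schwarz)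
      also have "\<dots> \<le> norm z * (l * \<theta>)" using vu by (intro mult_left_mono) (auto simp: norm_minus_commute)
      finally show ?thesis by (simp add: inner_diff_right)
    qed
    moreover have "2 * eps * norm (v - u0) \<le> 2 * eps * (l * \<theta>) + 2 * eps * norm (u - u0)"
      using mult_left_mono[OF order_trans[OF tri add_right_mono[OF vu]], of "2 * eps"] eps
      by (simp add: algebra_simps)
    moreover have "N * (norm w)\<^sup>2 \<ge> 0" using N by simp
    ultimately show False
      using F1 \<theta>l unfolding \<sigma> c2_def by (simp add: algebra_simps)
  qed
  then have \<sigma>: "\<sigma> < s" using x by simp
  \<comment> \<open>Because \<open>\<sigma> < s\<close>, the parameter can still be increased with
    \<open>(x, u)\<close> held fixed. Minimality makes the right derivative of \<open>F\<close> in
    \<open>\<sigma>\<close>, which is \<open>- 2 * N * inner w h - c2\<close>, nonnegative.\<close>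
  have slope: "c2 \<le> - 2 * N * inner w h"
  proof (rule ccontr)
    assume neg: "\<not> ?thesis"
    define g where "g = c2 + 2 * N * inner w h"
    have g: "g > 0" using neg unfolding g_def by simp
    define \<tau> where "\<tau> = min (s - \<sigma>) (g / (N * (norm h)\<^sup>2 + 1))"
    have den': "N * (norm h)\<^sup>2 + 1 > 0" using N by (intro add_nonneg_pos) auto
    have \<tau>: "\<tau> > 0" "\<sigma> + \<tau> \<le> s" unfolding \<tau>_def using \<sigma> g den' by auto
    have "\<tau> * (N * (norm h)\<^sup>2 + 1) \<le> g"
      using den' unfolding \<tau>_def by (simp add: pos_le_divide_eq[symmetric])
    then have gt: "\<tau> * (N * (norm h)\<^sup>2) < g" using \<tau>(1) by (simp add: algebra_simps)
    have "((x, u), \<sigma> + \<tau>) \<in> S" unfolding S using x \<tau> by simp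
    from Fmin[OF this]
    have Fle: "N * (norm w)\<^sup>2 - c2 * \<sigma> \<le> N * (norm (w - \<tau> *\<^sub>R h))\<^sup>2 - c2 * (\<sigma> + \<tau>)"
      unfolding F_def w_def by (simp add: algebra_simps)
    have sqe: "(norm (w - \<tau> *\<^sub>R h))\<^sup>2 = (norm w)\<^sup>2 - 2 * \<tau> * inner w h + \<tau>\<^sup>2 * (norm h)\<^sup>2"
      unfolding power2_norm_eq_inner by (simp add: inner_diff inner_commute power2_eq_square algebra_simps)
    have "0 \<le> \<tau> * (\<tau> * (N * (norm h)\<^sup>2) - g)"
      using Fle unfolding sqe g_def by (simp add: algebra_simps power2_eq_square)
    then show False using gt \<tau>(1) by (simp add: zero_le_mult_iff)
  qed
  define p where "p = x0 + \<sigma> *\<^sub>R h"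
  define R where "R = sqrt (inner (u - u0) (u - u0) + s\<^sup>2)"
  have R: "R > 0" "norm (u - u0) \<le> R"
    using s sq unfolding R_def power2_norm_eq_inner by (auto intro: add_nonneg_pos)
  define Q where "Q q = inner z (snd q - u0) + 2 * eps * sqrt (inner (snd q - u0) (snd q - u0) + s\<^sup>2)
      + N * inner (fst q - p) (fst q - p)" for q :: "'a \<times> 'b"
  define z' where "z' = z + (2 * eps / R) *\<^sub>R (u - u0)"
  have der: "(Q has_derivative (\<lambda>q. inner ((2 * N) *\<^sub>R w) (fst q) + inner z' (snd q))) (at (x, u))"
  proof -
    have pos: "inner (u - u0) (u - u0) + s\<^sup>2 > 0" using s by (intro add_nonneg_pos) auto
    have xp: "x - p = w" unfolding p_def w_def by simp
    have d1: "((\<lambda>q. inner (snd q - u0) (snd q - u0) + s\<^sup>2) has_derivative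
        (\<lambda>q. 2 * inner (u - u0) (snd q))) (at (x, u))"
      by (auto intro!: derivative_eq_intros simp: inner_commute)
    have "(sqrt has_derivative (*) (inverse R / 2)) (at (inner (snd (x, u) - u0) (snd (x, u) - u0) + s\<^sup>2))"
      using DERIV_real_sqrt[OF pos] unfolding has_field_derivative_def R_def by simp
    from has_derivative_compose[OF d1 this]
    have d2: "((\<lambda>q. sqrt (inner (snd q - u0) (snd q - u0) + s\<^sup>2)) has_derivative
        (\<lambda>q. inverse R / 2 * (2 * inner (u - u0) (snd q)))) (at (x, u))" .
    have d3: "((\<lambda>q. inner z (snd q - u0)) has_derivative (\<lambda>q. inner z (snd q))) (at (x, u))"
      by (auto intro!: derivative_eq_intros)
    have d4: "((\<lambda>q. inner (fst q - p) (fst q - p)) has_derivative (\<lambda>q. 2 * inner w (fst q))) (at (x, u))"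
    proof -
      have "((\<lambda>q. fst q - p) has_derivative fst) (at (x, u))"
        by (auto intro!: derivative_eq_intros)
      from has_derivative_inner[OF this this] show ?thesis
        by (rule has_derivative_eq_rhs) (simp add: xp inner_commute[of _ w])
    qed
    have "(\<lambda>q. inner z (snd q) + 2 * eps * (inverse R / 2 * (2 * inner (u - u0) (snd q))) + N * (2 * inner w (fst q)))
      = (\<lambda>q :: 'a \<times> 'b. inner ((2 * N) *\<^sub>R w) (fst q) + inner z' (snd q))"
      unfolding z'_def inner_add_left inner_scaleR_left divide_inverse by (rule ext) simp
    from has_derivative_eq_rhs[OF has_derivative_add[OF has_derivative_add[OF d3
            has_derivative_mult_right[OF d2]] has_derivative_mult_right[OF d4]] this]
    show ?thesis unfolding Q_def .
  qed
  \<comment> \<open>Both ball constraints in \<open>S\<close> are inactive at \<open>(x, u)\<close>,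
    so with \<open>\<sigma>\<close> frozen it is a local minimiser of \<open>Q\<close> on the whole
    graph.\<close>
  have "- ((2 * N) *\<^sub>R w) \<in> regular_coderivative G x u z'"
  proof (rule local_min_coderivative[where G = G and r = "min (r - norm (x - x0)) (delta / 2 - norm (u - u0))", OF der x(1)])
    show "min (r - norm (x - x0)) (delta / 2 - norm (u - u0)) > 0" using xr ud delta by simp
    fix x' u' assume u': "u' \<in> G x'"
      and d: "dist (x', u') (x, u) < min (r - norm (x - x0)) (delta / 2 - norm (u - u0))"
    have "norm (x' - x) \<le> dist (x', u') (x, u)" "norm (u' - u) \<le> dist (x', u') (x, u)"
      unfolding dist_norm by (simp_all add: norm_le_norm_Pair)
    moreover have "norm (x' - x0) \<le> norm (x' - x) + norm (x - x0)" "norm (u' - u0) \<le> norm (u' - u) + norm (u - u0)"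
      using norm_triangle_ineq[of "x' - x" "x - x0"] norm_triangle_ineq[of "u' - u" "u - u0"] by simp_all
    ultimately have "((x', u'), \<sigma>) \<in> S" unfolding S using u' d x by auto
    from Fmin[OF this] show "Q (x, u) \<le> Q (x', u')"
      unfolding F_def Q_def p_def by (simp add: power2_norm_eq_inner diff_diff_eq)
  qed
  moreover have "norm (z' - z) \<le> 2 * eps"
    unfolding z'_def using R eps by (simp add: divide_le_eq)
  moreover have "c - 3 * eps \<le> inner (- ((2 * N) *\<^sub>R w)) h" using slope unfolding c2_def by simp
  ultimately show ?thesis using x(1) xr r ug by (intro exI conjI) (auto intro: less_trans)
qed


text \<open>If no \<open>\<gamma>\<close> worked, the mean value inequality for parameters shrinking
  to the reference point would give regular coderivatives with
  \<open>inner xs h \<ge> c - 3 * g k\<close>. They are bounded by the Lipschitz constant, and a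
  cluster point would be a limiting coderivative violating the hypothesis. The point of the form is
  that \<open>\<gamma>\<close> is common to all nearby \<open>x\<close>, \<open>u\<close>,
  \<open>z\<close>; only the step bound \<open>s0\<close> depends on them.\<close>

lemma descent_direction:
  fixes G :: "'a::euclidean_space \<Rightarrow> 'b::euclidean_space set" and ys :: 'b
  assumes cl: "closed (gph G)" and lip: "lipschitz_map G l (cball xb \<eta>)" and \<eta>: "\<eta> > 0" and l: "l \<ge> 0"
    and sing: "G xb = {yb}"
    and c: "\<And>d. d \<in> limiting_coderivative G xb yb ys \<Longrightarrow> inner d h < c"
  shows "\<exists>\<gamma>>0. \<forall>x u z eps delta. u \<in> G x \<and> norm (x - xb) < \<gamma> \<and> norm (z - ys) < \<gamma> \<and> 0 < eps \<and> eps < \<gamma> \<and>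
      0 < delta \<and> (\<forall>v\<in>G x. norm (v - u) \<le> delta \<longrightarrow> - eps * norm (v - u) \<le> inner z (v - u)) \<longrightarrow>
    (\<exists>s0>0. \<forall>s. 0 < s \<and> s < s0 \<longrightarrow> (\<exists>v\<in>G (x + s *\<^sub>R h). norm (v - u) \<le> delta / 2 \<and>
      inner z (v - u) + 2 * eps * norm (v - u) \<le> c * s))"
proof (rule ccontr)
  assume neg: "\<not> ?thesis"
  define A where "A \<gamma> x u z eps delta \<longleftrightarrow> u \<in> G x \<and> norm (x - xb) < \<gamma> \<and> norm (z - ys) < \<gamma> \<and> 0 < eps \<and> eps < \<gamma> \<and>
      0 < delta \<and> (\<forall>v\<in>G x. norm (v - u) \<le> delta \<longrightarrow> - eps * norm (v - u) \<le> inner z (v - u))"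
    for \<gamma> x u z eps delta
  define B where "B x u z eps delta \<longleftrightarrow> (\<exists>s0>0. \<forall>s. 0 < s \<and> s < s0 \<longrightarrow>
      (\<exists>v\<in>G (x + s *\<^sub>R h). norm (v - u) \<le> delta / 2 \<and>
        inner z (v - u) + 2 * eps * norm (v - u) \<le> c * s))" for x u z eps delta
  have neg': "\<exists>x u z eps delta. A \<gamma> x u z eps delta \<and> \<not> B x u z eps delta" if "\<gamma> > 0" for \<gamma>
    using neg that unfolding A_def[symmetric] B_def[symmetric] by blast
  \<comment> \<open>The cap \<open>\<eta> / 4\<close> keeps the ball of radius
    \<open>\<eta> / 2\<close> around \<open>x\<close> inside the Lipschitz ball, and also the points
    \<open>x'\<close>, which lie within \<open>2 * g k\<close> of \<open>xb\<close>.\<close>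
  define g where "g k = min (inverse (real (Suc k))) (\<eta> / 4)" for k
  have g: "g k > 0" "g k \<le> inverse (real (Suc k))" "g k \<le> \<eta> / 4" for k
  proof -
    show "g k > 0" unfolding g_def using \<eta> by simp
    show "g k \<le> inverse (real (Suc k))" unfolding g_def by (rule min.cobounded1)
    show "g k \<le> \<eta> / 4" unfolding g_def by (rule min.cobounded2)
  qed
  have "\<exists>x' u' z' xs. u' \<in> G x' \<and> norm (x' - xb) \<le> 2 * g k \<and> norm (u' - yb) \<le> (1 + l) * g k \<and>
      norm (z' - ys) \<le> 3 * g k \<and> xs \<in> regular_coderivative G x' u' z' \<and> c - 3 * g k \<le> inner xs h" for k
  proof -
    obtain x u z eps delta where "A (g k) x u z eps delta" and b: "\<not> B x u z eps delta"
      using neg'[OF g(1)[of k]] by blast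
    then have a: "u \<in> G x" "norm (x - xb) < g k" "norm (z - ys) < g k" "0 < eps" "eps < g k"
        "0 < delta" "\<forall>v\<in>G x. norm (v - u) \<le> delta \<longrightarrow> - eps * norm (v - u) \<le> inner z (v - u)"
      unfolding A_def by simp_all
    have "cball x (\<eta> / 2) \<subseteq> cball xb \<eta>"
    proof
      fix y assume "y \<in> cball x (\<eta> / 2)"
      then show "y \<in> cball xb \<eta>"
        using a(2) g(3)[of k] \<eta> norm_triangle_ineq[of "y - x" "x - xb"]
        by (simp add: dist_norm norm_minus_commute)
    qed
    then have lip': "lipschitz_map G l (cball x (\<eta> / 2))" using lip unfolding lipschitz_map_def by blast
    have "\<exists>x' u' z' xs. u' \<in> G x' \<and> norm (x' - x) < g k \<and> norm (u' - u) < g k \<and>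
      norm (z' - z) \<le> 2 * eps \<and> xs \<in> regular_coderivative G x' u' z' \<and> c - 3 * eps \<le> inner xs h"
    proof (rule mean_value_coderivative[OF cl lip' _ l a(1,4,6) _ _ g(1)])
      show "\<eta> / 2 > 0" using \<eta> by simp
      show "- eps * norm (v - u) \<le> inner z (v - u)" if "v \<in> G x" "norm (v - u) \<le> delta" for v
        using a(7) that by blast
      show "\<exists>s. 0 < s \<and> s < s0 \<and> (\<forall>v\<in>G (x + s *\<^sub>R h). norm (v - u) \<le> delta / 2 \<longrightarrow>
          c * s < inner z (v - u) + 2 * eps * norm (v - u))" if "s0 > 0" for s0
        using b that unfolding B_def by (meson not_le)
    qed
    then obtain x' u' z' xs where m: "u' \<in> G x'" "norm (x' - x) < g k" "norm (u' - u) < g k"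
      "norm (z' - z) \<le> 2 * eps" "xs \<in> regular_coderivative G x' u' z'" "c - 3 * eps \<le> inner xs h" by blast
    have "norm (u - yb) \<le> l * g k"
    proof -
      have "x \<in> cball xb \<eta>" "xb \<in> cball xb \<eta>"
        using a(2) g(3)[of k] \<eta> by (simp_all add: dist_norm norm_minus_commute)
      from lipschitz_mapE[OF lip this a(1)]
      obtain v where "v \<in> G xb" "norm (u - v) \<le> l * norm (x - xb)" by blast
      then have "norm (u - yb) \<le> l * norm (x - xb)" using sing by simp
      also have "\<dots> \<le> l * g k" using a(2) l by (intro mult_left_mono) auto
      finally show ?thesis .
    qed
    then have "norm (u' - yb) \<le> (1 + l) * g k"
      using m(3) norm_triangle_ineq[of "u' - u" "u - yb"] by (simp add: algebra_simps)
    moreover have "norm (x' - xb) \<le> 2 * g k"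
      using m(2) a(2) norm_triangle_ineq[of "x' - x" "x - xb"] by simp
    moreover have "norm (z' - ys) \<le> 3 * g k"
      using m(4) a(3,5) norm_triangle_ineq[of "z' - z" "z - ys"] by simp
    moreover have "c - 3 * g k \<le> inner xs h" using m(6) a(5) by simp
    ultimately show ?thesis using m(1,5) by blast
  qed
  then obtain X U Z D where X: "\<And>k. norm (X k - xb) \<le> 2 * g k" and U: "\<And>k. norm (U k - yb) \<le> (1 + l) * g k"
    and Z: "\<And>k. norm (Z k - ys) \<le> 3 * g k" and D: "\<And>k. D k \<in> regular_coderivative G (X k) (U k) (Z k)"
    and Dh: "\<And>k. c - 3 * g k \<le> inner (D k) h"
    by metis
  have gl: "g \<longlonglongrightarrow> 0"
    by (rule tendsto_sandwich[OF _ _ tendsto_const LIMSEQ_inverse_real_of_nat])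
       (use g in \<open>auto intro!: always_eventually less_imp_le\<close>)
  have lim: "V \<longlonglongrightarrow> v" if "\<And>k. norm (V k - v) \<le> C * g k" for V :: "nat \<Rightarrow> 'c::real_normed_vector" and v C
  proof -
    have "(\<lambda>k. C * g k) \<longlonglongrightarrow> 0" using tendsto_mult_left[OF gl, of C] by simp
    then have "(\<lambda>k. V k - v) \<longlonglongrightarrow> 0"
      by (rule Lim_null_comparison[rotated]) (use that in simp)
    then show ?thesis by (simp add: LIM_zero_iff)
  qed
  have Xl: "X \<longlonglongrightarrow> xb" and Ul: "U \<longlonglongrightarrow> yb" and Zl: "Z \<longlonglongrightarrow> ys"
    using lim X U Z by blast+
  have bd: "D k \<in> cball 0 (l * (norm ys + \<eta>))" for k
  proof -
    have "X k \<in> ball xb \<eta>" using X[of k] g(3)[of k] \<eta> by (simp add: dist_norm norm_minus_commute)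
    then have "norm (D k) \<le> l * norm (Z k)"
      using regular_coderivative_bound[OF lip open_ball ball_subset_cball _ l D] by blast
    also have "\<dots> \<le> l * (norm ys + \<eta>)"
      using Z[of k] g(3)[of k] \<eta> l norm_triangle_ineq[of "Z k - ys" ys] by (intro mult_left_mono) auto
    finally show ?thesis by simp
  qed
  have "seq_compact (cball (0::'a) (l * (norm ys + \<eta>)))"
    by (intro compact_imp_seq_compact compact_cball)
  moreover have "\<forall>k. D k \<in> cball 0 (l * (norm ys + \<eta>))" using bd by blast
  ultimately obtain d r where r: "strict_mono (r :: nat \<Rightarrow> nat)" and d: "(D \<circ> r) \<longlonglongrightarrow> d"
    by (rule seq_compactE)
  have sub: "(V \<circ> r) \<longlonglongrightarrow> v" if "V \<longlonglongrightarrow> v" for V :: "nat \<Rightarrow> 'c::topological_space" and v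
    using that r by (rule LIMSEQ_subseq_LIMSEQ)
  have "d \<in> limiting_coderivative G xb yb ys"
    unfolding limiting_coderivative_def limiting_normal_cone_def mem_Collect_eq
  proof (intro exI conjI allI)
    show "(\<lambda>k. ((X \<circ> r) k, (U \<circ> r) k)) \<longlonglongrightarrow> (xb, yb)"
      by (intro tendsto_Pair sub Xl Ul)
    show "(\<lambda>k. ((D \<circ> r) k, - (Z \<circ> r) k)) \<longlonglongrightarrow> (d, - ys)"
      by (intro tendsto_Pair tendsto_minus sub Zl d)
    show "((D \<circ> r) k, - (Z \<circ> r) k) \<in> regular_normal_cone ((X \<circ> r) k, (U \<circ> r) k) (gph G)" for k
      using D[of "r k"] unfolding regular_coderivative_def by simp
  qed
  then have "inner d h < c" by (rule c)
  moreover have "c \<le> inner d h"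
  proof (rule LIMSEQ_le)
    show "(\<lambda>k. c - 3 * (g \<circ> r) k) \<longlonglongrightarrow> c"
      using tendsto_diff[OF tendsto_const tendsto_mult_left[OF sub[OF gl], of 3], of c] by simp
    show "(\<lambda>k. inner ((D \<circ> r) k) h) \<longlonglongrightarrow> inner d h" by (intro tendsto_inner d tendsto_const)
    show "\<exists>N. \<forall>n\<ge>N. c - 3 * (g \<circ> r) n \<le> inner ((D \<circ> r) n) h" using Dh by simp
  qed
  ultimately show False by simp
qed

text \<open>Were the set empty, \<open>descent_direction\<close> would hold vacuously for
  \<open>h = 0\<close> and \<open>c = - 1\<close>. At the point \<open>xb\<close>, whose only value
  is \<open>yb\<close>, it would then assert \<open>0 \<le> - s\<close> for small positive
  \<open>s\<close>.\<close>

lemma limiting_coderivative_nonempty: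
  fixes G :: "'a::euclidean_space \<Rightarrow> 'b::euclidean_space set"
  assumes cl: "closed (gph G)" and lip: "lipschitz_map G l (cball xb \<eta>)" and \<eta>: "\<eta> > 0" and l: "l \<ge> 0"
    and sing: "G xb = {yb}"
  shows "limiting_coderivative G xb yb ys \<noteq> {}"
proof
  assume "limiting_coderivative G xb yb ys = {}"
  then have "inner d 0 < - 1" if "d \<in> limiting_coderivative G xb yb ys" for d using that by simp
  from descent_direction[OF assms this]
  obtain \<gamma> where "\<gamma> > 0" and *: "\<forall>x u z eps delta. u \<in> G x \<and> norm (x - xb) < \<gamma> \<and> norm (z - ys) < \<gamma> \<and> 0 < eps \<and> eps < \<gamma> \<and>
      0 < delta \<and> (\<forall>v\<in>G x. norm (v - u) \<le> delta \<longrightarrow> - eps * norm (v - u) \<le> inner z (v - u)) \<longrightarrow>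
    (\<exists>s0>0. \<forall>s. 0 < s \<and> s < s0 \<longrightarrow> (\<exists>v\<in>G (x + s *\<^sub>R 0). norm (v - u) \<le> delta / 2 \<and>
      inner z (v - u) + 2 * eps * norm (v - u) \<le> - 1 * s))" by blast
  have "\<exists>s0>0. \<forall>s. 0 < s \<and> s < s0 \<longrightarrow> (\<exists>v\<in>G (xb + s *\<^sub>R 0). norm (v - yb) \<le> 1 / 2 \<and>
      inner ys (v - yb) + 2 * (\<gamma> / 2) * norm (v - yb) \<le> - 1 * s)"
    using \<open>\<gamma> > 0\<close> by (intro *[rule_format]) (simp add: sing)
  then have "\<exists>s0>0. \<forall>s>0. \<not> s < (s0 :: real)" by (simp add: sing)
  then obtain s0 :: real where "s0 > 0" "\<forall>s>0. \<not> s < s0" by blast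
  from this(2)[rule_format, of "s0 / 2"] this(1) show False by simp
qed

section \<open>Aumann integrals\<close>

lemma aumann_integral_cong_AE:
  assumes "AE t in M. F t = G t"
  shows "aumann_integral M F = aumann_integral M G"
proof -
  have "aumann_integral M F \<subseteq> aumann_integral M G" if FG: "AE t in M. F t = G t" for F G :: "_ \<Rightarrow> 'b::euclidean_space set"
  proof
    fix z assume "z \<in> aumann_integral M F"
    then obtain v where v: "integrable M v" "AE t in M. v t \<in> F t" "z = integral\<^sup>L M v"
      unfolding aumann_integral_def by blast
    have "AE t in M. v t \<in> G t" using v(2) FG by eventually_elim simp
    then show "z \<in> aumann_integral M G" unfolding aumann_integral_def using v(1,3) by blast
  qed
  from this[OF assms] this[of G F] show ?thesis using assms by (auto simp: eq_commute)
qed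

lemma mem_expected_mapE:
  assumes "z \<in> expected_map M F x"
  obtains v where "integrable M v" "AE t in M. v t \<in> F t x" "z = integral\<^sup>L M v"
  using assms unfolding expected_map_def aumann_integral_def by blast

lemma mem_expected_mapI:
  "integrable M v \<Longrightarrow> AE t in M. v t \<in> F t x \<Longrightarrow> integral\<^sup>L M v \<in> expected_map M F x"
  unfolding expected_map_def aumann_integral_def by blast

lemma convex_aumann_integral:
  fixes D :: "'t \<Rightarrow> 'b::euclidean_space set"
  assumes "AE t in M. convex (D t)"
  shows "convex (aumann_integral M D)"
proof (rule convexI)
  fix x y and a b :: real
  assume "x \<in> aumann_integral M D" "y \<in> aumann_integral M D" and ab: "a \<ge> 0" "b \<ge> 0" "a + b = 1"
  then obtain v w where v: "integrable M v" "AE t in M. v t \<in> D t" "x = integral\<^sup>L M v"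
    and w: "integrable M w" "AE t in M. w t \<in> D t" "y = integral\<^sup>L M w"
    unfolding aumann_integral_def by blast
  have "AE t in M. a *\<^sub>R v t + b *\<^sub>R w t \<in> D t"
    using assms v(2) w(2) by eventually_elim (use ab in \<open>auto intro: convexD\<close>)
  moreover have "a *\<^sub>R x + b *\<^sub>R y = (\<integral>t. a *\<^sub>R v t + b *\<^sub>R w t \<partial>M)" using v w by simp
  ultimately show "a *\<^sub>R x + b *\<^sub>R y \<in> aumann_integral M D"
    using v(1) w(1) unfolding aumann_integral_def by (auto intro!: exI[of _ "\<lambda>t. a *\<^sub>R v t + b *\<^sub>R w t"])
qed

text \<open>Selections of nearly minimal weighted \<open>L\<^sup>2\<close> norm among those with integral close to the limit are
  Cauchy by the parallelogram law; the weight makes the norm finite on all selections.\<close>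

lemma closed_aumann_integral:
  fixes D :: "'t \<Rightarrow> 'b::euclidean_space set" and g :: "'t \<Rightarrow> real"
  assumes fin: "finite_measure M"
    and D: "AE t in M. closed (D t) \<and> convex (D t)"
    and g: "integrable M g" and bd: "AE t in M. \<forall>d\<in>D t. norm d \<le> g t"
  shows "closed (aumann_integral M D)"
  unfolding closed_sequential_limits
proof (intro allI impI)
  interpret finite_measure M by (rule fin)
  fix Z z assume Z: "(\<forall>n. Z n \<in> aumann_integral M D) \<and> Z \<longlonglongrightarrow> z"
  define sel where "sel v \<longleftrightarrow> integrable M v \<and> (AE t in M. v t \<in> D t)" for v
  define w where "w t = 1 + \<bar>g t\<bar>" for t
  have w: "w t > 0" "w t \<ge> 1" for t unfolding w_def by auto
  have wi: "integrable M w" unfolding w_def using g by simp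
  have wm: "w \<in> borel_measurable M" using wi by (rule borel_measurable_integrable)
  define q where "q v = (\<integral>t. (norm (v t))\<^sup>2 / w t \<partial>M)" for v :: "'t \<Rightarrow> 'b"
  have qi: "integrable M (\<lambda>t. (norm (v t))\<^sup>2 / w t)"
    if "v \<in> borel_measurable M" "AE t in M. norm (v t) \<le> C * g t" for v :: "'t \<Rightarrow> 'b" and C
  proof (rule Bochner_Integration.integrable_bound)
    show "integrable M (\<lambda>t. C\<^sup>2 * \<bar>g t\<bar>)" using g by simp
    show "(\<lambda>t. (norm (v t))\<^sup>2 / w t) \<in> borel_measurable M" using that(1) wm by measurable
    show "AE t in M. norm ((norm (v t))\<^sup>2 / w t) \<le> norm (C\<^sup>2 * \<bar>g t\<bar>)"
      using that(2)
    proof eventually_elim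
      case (elim t)
      have "(norm (v t))\<^sup>2 \<le> (C * g t)\<^sup>2" using elim by (intro power_mono) auto
      also have "\<dots> = C\<^sup>2 * (\<bar>g t\<bar> * \<bar>g t\<bar>)" by (simp add: power2_eq_square)
      also have "\<dots> \<le> C\<^sup>2 * (\<bar>g t\<bar> * w t)" unfolding w_def by (intro mult_left_mono) auto
      finally have "(norm (v t))\<^sup>2 / w t \<le> C\<^sup>2 * \<bar>g t\<bar>"
        using w(1)[of t] by (simp add: pos_divide_le_eq mult.assoc)
      then show ?case using w(1)[of t] by simp
    qed
  qed
  have sbd: "AE t in M. norm (v t) \<le> g t" if "sel v" for v
    using that[unfolded sel_def] bd by (auto elim: AE_mp)
  have sqi: "integrable M (\<lambda>t. (norm (v t))\<^sup>2 / w t)" if "sel v" for v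
    by (rule qi[of _ 1]) (use that sbd[OF that] in \<open>auto simp: sel_def\<close>)
  define K where "K j = {v. sel v \<and> norm (integral\<^sup>L M v - z) \<le> inverse (real (Suc j))}" for j
  have Kne: "\<exists>v. v \<in> K j" for j
  proof -
    have "eventually (\<lambda>n. dist (Z n) z < inverse (real (Suc j))) sequentially"
      using Z by (auto intro: tendstoD)
    then obtain n where "dist (Z n) z < inverse (real (Suc j))" by (auto dest: eventually_happens)
    moreover obtain v where "sel v" "Z n = integral\<^sup>L M v"
      using Z unfolding aumann_integral_def sel_def by blast
    ultimately show ?thesis unfolding K_def by (auto simp: dist_norm intro!: exI[of _ v])
  qed
  have Kmono: "K i \<subseteq> K j" if "j \<le> i" for i j
  proof -
    have "inverse (real (Suc i)) \<le> inverse (real (Suc j))" using that by (simp add: le_imp_inverse_le)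
    then show ?thesis unfolding K_def by (auto intro: order_trans)
  qed
  have Ksel: "sel v" if "v \<in> K j" for v j using that unfolding K_def by simp
  have q0: "0 \<le> q v" for v unfolding q_def using w(1) by (intro integral_nonneg_AE) (simp add: less_imp_le)
  have qle: "q v \<le> integral\<^sup>L M w" if "sel v" for v
    unfolding q_def
  proof (rule integral_mono_AE[OF sqi[OF that] wi])
    show "AE t in M. (norm (v t))\<^sup>2 / w t \<le> w t"
      using sbd[OF that]
    proof eventually_elim
      case (elim t)
      have "norm (v t) \<le> w t" using elim unfolding w_def by linarith
      then have "(norm (v t))\<^sup>2 \<le> w t * w t" unfolding power2_eq_square using w(1)[of t] by (intro mult_mono) auto
      then show ?case using w(1)[of t] by (simp add: pos_divide_le_eq)
    qed
  qed
  \<comment> \<open>Tightening the constraint raises the infimum, which stays below the integral of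
    \<open>w\<close>; hence \<open>\<rho>\<close> converges and its differences become
    small.\<close>
  define \<rho> where "\<rho> j = Inf (q ` K j)" for j
  have bdd: "bdd_below (q ` K j)" for j using q0 by (intro bdd_belowI[of _ 0]) auto
  have \<rho>le: "\<rho> j \<le> q v" if "v \<in> K j" for v j unfolding \<rho>_def using that bdd by (intro cInf_lower) auto
  have \<rho>mono: "\<rho> j \<le> \<rho> i" if "j \<le> i" for i j
    unfolding \<rho>_def using Kne[of i] bdd Kmono[OF that] by (intro cInf_superset_mono) auto
  have \<rho>bd: "\<rho> j \<le> integral\<^sup>L M w" for j
    using Kne[of j] \<rho>le qle Ksel by (meson order_trans)
  have "\<exists>v. v \<in> K j \<and> q v < \<rho> j + inverse (real (Suc j))" for j
  proof -
    have "Inf (q ` K j) < \<rho> j + inverse (real (Suc j))" unfolding \<rho>_def by simp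
    then show ?thesis using cInf_lessD[of "q ` K j"] Kne[of j] by blast
  qed
  then obtain v where v: "\<And>j. v j \<in> K j" "\<And>j. q (v j) < \<rho> j + inverse (real (Suc j))" by metis
  have vsel: "sel (v j)" for j using v(1) Ksel by blast
  have vm: "v j \<in> borel_measurable M" for j using vsel[of j] unfolding sel_def by auto
  have dqi: "integrable M (\<lambda>t. (norm (v i t - v j t))\<^sup>2 / w t)" for i j
  proof (rule qi[of _ 2])
    show "AE t in M. norm (v i t - v j t) \<le> 2 * g t"
      using sbd[OF vsel[of i]] sbd[OF vsel[of j]]
      by eventually_elim (rule order_trans[OF norm_triangle_ineq4], simp)
  qed (use vm in measurable)
  \<comment> \<open>The midpoint of \<open>v i\<close> and \<open>v j\<close> lies in
    \<open>K j\<close> again, so its \<open>q\<close> is at least \<open>\<rho> j\<close>. The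
    tolerances \<open>inverse (real (Suc i))\<close> and \<open>inverse (real (Suc j))\<close> enter
    twice each, and the first is at most the second.\<close>
  have qd: "q (\<lambda>t. v i t - v j t) \<le> 2 * (\<rho> i - \<rho> j) + 4 * inverse (real (Suc j))" if "j \<le> i" for i j
  proof -
    let ?m = "\<lambda>t. (1/2) *\<^sub>R v i t + (1/2) *\<^sub>R v j t"
    have vi: "v i \<in> K j" using v(1) Kmono[OF that] by blast
    have ms: "sel ?m"
    proof -
      have "AE t in M. ?m t \<in> D t"
        using D vsel[of i, unfolded sel_def, THEN conjunct2] vsel[of j, unfolded sel_def, THEN conjunct2]
        by eventually_elim (rule convexD, auto)
      then show ?thesis using vsel unfolding sel_def by auto
    qed
    have "?m \<in> K j"
    proof -
      have "integral\<^sup>L M ?m - z = (1/2) *\<^sub>R (integral\<^sup>L M (v i) - z) + (1/2) *\<^sub>R (integral\<^sup>L M (v j) - z)"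
      proof -
        have "integral\<^sup>L M ?m = (1/2) *\<^sub>R integral\<^sup>L M (v i) + (1/2) *\<^sub>R integral\<^sup>L M (v j)"
          using vsel[of i] vsel[of j] unfolding sel_def by simp
        moreover have "z = (1/2) *\<^sub>R z + (1/2) *\<^sub>R z" by (simp add: scaleR_left_distrib[symmetric])
        ultimately show ?thesis by (simp add: algebra_simps)
      qed
      also have "norm \<dots> \<le> inverse (real (Suc j))"
        using vi v(1)[of j] norm_triangle_ineq[of "(1/2) *\<^sub>R (integral\<^sup>L M (v i) - z)" "(1/2) *\<^sub>R (integral\<^sup>L M (v j) - z)"]
        unfolding K_def by simp
      finally show ?thesis using ms unfolding K_def by simp
    qed
    then have "\<rho> j \<le> q ?m" by (rule \<rho>le)
    moreover have "q (\<lambda>t. v i t - v j t) = 2 * q (v i) + 2 * q (v j) - 4 * q ?m"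
    proof -
      have "(norm (a - b))\<^sup>2 = 2 * (norm a)\<^sup>2 + 2 * (norm b)\<^sup>2 - 4 * (norm ((1/2) *\<^sub>R a + (1/2) *\<^sub>R b))\<^sup>2" for a b :: 'b
        unfolding power2_norm_eq_inner by (simp add: inner_add inner_diff inner_commute)
      then have "(norm (v i t - v j t))\<^sup>2 / w t
          = 2 * ((norm (v i t))\<^sup>2 / w t) + 2 * ((norm (v j t))\<^sup>2 / w t) - 4 * ((norm (?m t))\<^sup>2 / w t)" for t
        by (simp add: add_divide_distrib diff_divide_distrib)
      note pointwise = this
      have lin: "(\<integral>t. 2 * a t + 2 * b t - 4 * c t \<partial>M) = 2 * integral\<^sup>L M a + 2 * integral\<^sup>L M b - 4 * integral\<^sup>L M c"
        if "integrable M a" "integrable M b" "integrable M c" for a b c :: "'t \<Rightarrow> real"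
        using that by simp
      show ?thesis
        unfolding q_def pointwise by (rule lin[OF sqi[OF vsel[of i]] sqi[OF vsel[of j]] sqi[OF ms]])
    qed
    moreover have "inverse (real (Suc i)) \<le> inverse (real (Suc j))"
      using that by (simp add: le_imp_inverse_le)
    moreover have "d \<le> 2 * (ri - rj) + 4 * y"
      if "rj \<le> m" "d = 2 * a + 2 * b - 4 * m" "x \<le> y" "a < ri + x" "b < rj + y" for d ri rj x y a b m :: real
      using that by simp
    ultimately show ?thesis using v(2)[of i] v(2)[of j] by blast
  qed
  have "incseq \<rho>" using \<rho>mono by (simp add: incseq_def)
  then obtain L where "\<rho> \<longlonglongrightarrow> L" using incseq_convergent[of \<rho>] \<rho>bd by blast
  then have \<rho>C: "Cauchy \<rho>" by (rule LIMSEQ_imp_Cauchy)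
  \<comment> \<open>Young's inequality, for the return from the weighted square norm to the plain
    \<open>L\<^sup>1\<close> norm: \<open>\<tau>\<close> makes the weight term small, and then
    \<open>q\<close> is made small against \<open>\<tau>\<close>.\<close>
  have amgm: "a \<le> \<tau> * b / 2 + a\<^sup>2 / b / (2 * \<tau>)" if "b > 0" "\<tau> > 0" for a b \<tau> :: real
  proof -
    have "0 \<le> (\<tau> * b - a)\<^sup>2 / (2 * \<tau> * b)" using that by simp
    also have "\<dots> = \<tau> * b / 2 + a\<^sup>2 / b / (2 * \<tau>) - a" using that by (simp add: field_simps power2_eq_square)
    finally show ?thesis by simp
  qed
  have L1: "\<exists>N. \<forall>i\<ge>N. \<forall>j\<ge>N. (\<integral>t. norm (v i t - v j t) \<partial>M) < e" if "e > 0" for e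
  proof -
    define I where "I = integral\<^sup>L M w"
    have I: "I \<ge> 0" unfolding I_def using w(1) by (intro integral_nonneg_AE) (simp add: less_imp_le)
    define \<tau> where "\<tau> = e / (I + 1)"
    have \<tau>: "\<tau> > 0" "\<tau> * I / 2 < e / 2"
      unfolding \<tau>_def using that I by (simp_all add: field_simps)
    have \<tau>e: "\<tau> * e / 4 > 0" "\<tau> * e / 8 > 0" using \<tau>(1) that by simp_all
    obtain N1 where N1: "\<And>i j. i \<ge> N1 \<Longrightarrow> j \<ge> N1 \<Longrightarrow> dist (\<rho> i) (\<rho> j) < \<tau> * e / 4"
      using \<rho>C[unfolded Cauchy_def, rule_format, OF \<tau>e(1)] by blast
    obtain N2 where N2: "inverse (real (Suc N2)) < \<tau> * e / 8"
      using reals_Archimedean[OF \<tau>e(2)] by blast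
    have *: "(\<integral>t. norm (v i t - v j t) \<partial>M) < e" if ij: "j \<ge> max N1 N2" "i \<ge> j" for i j
    proof -
      have "inverse (real (Suc j)) \<le> inverse (real (Suc N2))" using ij by (simp add: le_imp_inverse_le)
      moreover have "\<rho> i - \<rho> j < \<tau> * e / 4" 
      proof -
        have "dist (\<rho> i) (\<rho> j) < \<tau> * e / 4" by (rule N1) (use ij in auto)
        then show ?thesis by (rule order_le_less_trans[rotated]) (simp add: dist_real_def)
      qed
      moreover have "a < \<tau> * e"
        if "a \<le> 2 * d + 4 * y" "y \<le> x" "x < \<tau> * e / 8" "d < \<tau> * e / 4" for a d x y
        using that by simp
      ultimately have qs: "q (\<lambda>t. v i t - v j t) < \<tau> * e" using qd[OF ij(2)] N2 by blast
      have "(\<integral>t. norm (v i t - v j t) \<partial>M) \<le>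
          (\<integral>t. \<tau> * w t / 2 + (norm (v i t - v j t))\<^sup>2 / w t / (2 * \<tau>) \<partial>M)"
      proof (rule integral_mono)
        show "integrable M (\<lambda>t. norm (v i t - v j t))"
          using vsel[of i] vsel[of j] unfolding sel_def by auto
        show "integrable M (\<lambda>t. \<tau> * w t / 2 + (norm (v i t - v j t))\<^sup>2 / w t / (2 * \<tau>))"
          by (intro Bochner_Integration.integrable_add integrable_divide integrable_mult_right wi dqi)
      qed (use w(1) \<tau>(1) in \<open>rule amgm\<close>)
      also have "\<dots> = \<tau> * I / 2 + q (\<lambda>t. v i t - v j t) / (2 * \<tau>)"
      proof -
        have lin: "(\<integral>t. \<tau> * a t / 2 + b t / (2 * \<tau>) \<partial>M) = \<tau> * integral\<^sup>L M a / 2 + integral\<^sup>L M b / (2 * \<tau>)"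
          if "integrable M a" "integrable M b" for a b :: "'t \<Rightarrow> real"
          using that by simp
        show ?thesis unfolding I_def q_def by (rule lin[OF wi dqi])
      qed
      also have "\<dots> < e"
      proof -
        have "q (\<lambda>t. v i t - v j t) / (2 * \<tau>) < e / 2" using qs \<tau>(1) by (simp add: pos_divide_less_eq mult.commute)
        then show ?thesis using \<tau>(2) by linarith
      qed
      finally show ?thesis .
    qed
    show ?thesis
    proof (intro exI allI impI)
      fix i j assume "i \<ge> max N1 N2" "j \<ge> max N1 N2"
      then show "(\<integral>t. norm (v i t - v j t) \<partial>M) < e"
        using *[of j i] *[of i j] by (cases "j \<le> i") (auto simp: norm_minus_commute)
    qed
  qed
  have vint: "integrable M (v n)" for n using vsel unfolding sel_def by blast
  obtain r where r: "strict_mono r" and rC: "AE t in M. Cauchy (\<lambda>i. v (r i) t)"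
    using cauchy_L1_AE_cauchy_subseq[of M v, OF vint L1] by blast
  define V where "V t = lim (\<lambda>i. v (r i) t)" for t
  have Vm: "V \<in> borel_measurable M" unfolding V_def
    by (rule borel_measurable_lim_metric) (rule vm)
  have lim: "AE t in M. (\<lambda>i. v (r i) t) \<longlonglongrightarrow> V t"
    using rC by eventually_elim (simp add: V_def Cauchy_convergent_iff convergent_LIMSEQ_iff)
  have dom: "AE t in M. norm (v (r i) t) \<le> g t" for i by (rule sbd[OF vsel])
  have VI: "integrable M V" "(\<lambda>i. integral\<^sup>L M (v (r i))) \<longlonglongrightarrow> integral\<^sup>L M V"
    by (rule integrable_dominated_convergence[OF Vm vm g lim dom],
        rule integral_dominated_convergence[OF Vm vm g lim dom])
  have "(\<lambda>i. integral\<^sup>L M (v (r i))) \<longlonglongrightarrow> z"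
  proof -
    have "(\<lambda>j. integral\<^sup>L M (v j) - z) \<longlonglongrightarrow> 0"
      by (rule Lim_null_comparison[OF _ LIMSEQ_inverse_real_of_nat])
         (use v(1) in \<open>auto simp: K_def\<close>)
    then have "(\<lambda>j. integral\<^sup>L M (v j)) \<longlonglongrightarrow> z" by (simp add: LIM_zero_iff)
    then show ?thesis using r by (auto dest: LIMSEQ_subseq_LIMSEQ simp: comp_def)
  qed
  then have "z = integral\<^sup>L M V" using VI(2) by (rule LIMSEQ_unique)
  moreover have "AE t in M. V t \<in> D t"
  proof -
    have "AE t in M. \<forall>i. v (r i) t \<in> D t"
      unfolding AE_all_countable using vsel unfolding sel_def by blast
    then show ?thesis using D lim by eventually_elim (auto intro: closed_sequentially)
  qed
  ultimately show "z \<in> aumann_integral M D" unfolding aumann_integral_def using VI(1) by blast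
qed

text \<open>Reverse Fatou, applied in \<open>j\<close> and then in \<open>k\<close>. The map
  \<open>ennreal\<close> sends negative numbers to 0, so \<open>f\<close> is the positive part of
  \<open>g k j - \<sigma>\<close>; this lets the one-sided bound \<open>W\<close> serve as majorant,
  and the iterated upper limit of \<open>f\<close> vanishes almost everywhere.\<close>

lemma iterated_fatou_bound:
  fixes g :: "nat \<Rightarrow> nat \<Rightarrow> 't \<Rightarrow> real" and W \<sigma> :: "'t \<Rightarrow> real"
  assumes g: "\<And>k j. integrable M (g k j)" and \<sigma>: "integrable M \<sigma>" and W: "integrable M W"
    and bd: "\<And>k j. AE t in M. g k j t \<le> W t"
    and lim: "AE t in M. \<forall>c>\<sigma> t. eventually (\<lambda>k. eventually (\<lambda>j. g k j t \<le> c) sequentially) sequentially"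
    and a: "\<And>k j. a k \<le> integral\<^sup>L M (g k j)" and al: "a \<longlonglongrightarrow> L"
  shows "L \<le> integral\<^sup>L M \<sigma>"
proof -
  define f where "f k j t = ennreal (g k j t - \<sigma> t)" for k j t
  define V where "V t = ennreal (\<bar>W t\<bar> + \<bar>\<sigma> t\<bar>)" for t
  have gm: "g k j \<in> borel_measurable M" for k j using g by (rule borel_measurable_integrable)
  have \<sigma>m: "\<sigma> \<in> borel_measurable M" and Wm: "W \<in> borel_measurable M"
    using \<sigma> W by (auto intro: borel_measurable_integrable)
  have fm [measurable]: "f k j \<in> borel_measurable M" for k j
    unfolding f_def using gm \<sigma>m by measurable
  have Vm [measurable]: "V \<in> borel_measurable M" unfolding V_def using Wm \<sigma>m by measurable
  have fV: "AE t in M. f k j t \<le> V t" for k j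
    using bd[of k j]
  proof eventually_elim
    case (elim t)
    then have "g k j t - \<sigma> t \<le> \<bar>W t\<bar> + \<bar>\<sigma> t\<bar>" by simp
    then show ?case unfolding f_def V_def by (rule ennreal_leI)
  qed
  have Vfin: "(\<integral>\<^sup>+t. V t \<partial>M) < \<infinity>"
  proof -
    have "integrable M (\<lambda>t. \<bar>W t\<bar> + \<bar>\<sigma> t\<bar>)" using W \<sigma> by simp
    then have "(\<integral>\<^sup>+t. V t \<partial>M) = ennreal (\<integral>t. \<bar>W t\<bar> + \<bar>\<sigma> t\<bar> \<partial>M)"
      unfolding V_def by (rule nn_integral_eq_integral) simp
    then show ?thesis by simp
  qed
  define w where "w k t = limsup (\<lambda>j. f k j t)" for k t
  have wm [measurable]: "w k \<in> borel_measurable M" for k unfolding w_def by measurable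
  have wV: "AE t in M. w k t \<le> V t" for k
  proof -
    have "AE t in M. \<forall>j. f k j t \<le> V t" using fV by (simp add: AE_all_countable)
    then show ?thesis unfolding w_def
      by eventually_elim (auto intro: Limsup_bounded always_eventually)
  qed
  have low: "ennreal (a k - integral\<^sup>L M \<sigma>) \<le> (\<integral>\<^sup>+t. f k j t \<partial>M)" for k j
  proof -
    have i: "integrable M (\<lambda>t. g k j t - \<sigma> t)" using g \<sigma> by simp
    have "a k - integral\<^sup>L M \<sigma> \<le> (\<integral>t. g k j t - \<sigma> t \<partial>M)" using a[of k j] g \<sigma> by simp
    also have "\<dots> \<le> (\<integral>t. max 0 (g k j t - \<sigma> t) \<partial>M)"
      using i by (intro integral_mono integrable_max) auto
    finally have "ennreal (a k - integral\<^sup>L M \<sigma>) \<le> ennreal (\<integral>t. max 0 (g k j t - \<sigma> t) \<partial>M)"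
      by (rule ennreal_leI)
    also have "\<dots> = (\<integral>\<^sup>+t. ennreal (max 0 (g k j t - \<sigma> t)) \<partial>M)"
      using i by (intro nn_integral_eq_integral[symmetric] integrable_max) auto
    also have "\<dots> = (\<integral>\<^sup>+t. f k j t \<partial>M)" 
    proof -
      have "ennreal (max 0 x) = ennreal x" for x :: real
        by (cases "0 \<le> x") (simp_all add: ennreal_neg)
      then show ?thesis unfolding f_def by simp
    qed
    finally show ?thesis .
  qed
  have step1: "ennreal (a k - integral\<^sup>L M \<sigma>) \<le> (\<integral>\<^sup>+t. w k t \<partial>M)" for k
  proof -
    have "ennreal (a k - integral\<^sup>L M \<sigma>) \<le> limsup (\<lambda>j. \<integral>\<^sup>+t. f k j t \<partial>M)"
      using low by (intro le_Limsup) auto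
    also have "\<dots> \<le> (\<integral>\<^sup>+t. w k t \<partial>M)"
      unfolding w_def by (rule nn_integral_limsup[OF fm Vm fV Vfin])
    finally show ?thesis .
  qed
  have "AE t in M. limsup (\<lambda>k. w k t) = 0"
    using lim
  proof eventually_elim
    case (elim t)
    have "limsup (\<lambda>k. w k t) \<le> ennreal e" if "e > 0" for e
    proof (rule Limsup_bounded)
      have "eventually (\<lambda>k. eventually (\<lambda>j. g k j t \<le> \<sigma> t + e) sequentially) sequentially"
        using elim that by simp
      then show "eventually (\<lambda>k. w k t \<le> ennreal e) sequentially"
      proof eventually_elim
        case (elim k)
        show ?case unfolding w_def
          by (rule Limsup_bounded, rule eventually_mono[OF elim]) (auto simp: f_def intro!: ennreal_leI)
      qed
    qed
    then show ?case
      using ennreal_le_epsilon[of 0 "limsup (\<lambda>k. w k t)"] by simp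
  qed
  then have zero: "(\<integral>\<^sup>+t. limsup (\<lambda>k. w k t) \<partial>M) = 0"
    by (subst nn_integral_0_iff_AE) auto
  have "(\<lambda>k. ennreal (a k - integral\<^sup>L M \<sigma>)) \<longlonglongrightarrow> ennreal (L - integral\<^sup>L M \<sigma>)"
    by (intro tendsto_ennrealI tendsto_diff al tendsto_const)
  then have "ennreal (L - integral\<^sup>L M \<sigma>) = limsup (\<lambda>k. ennreal (a k - integral\<^sup>L M \<sigma>))"
    by (simp add: lim_imp_Limsup)
  also have "\<dots> \<le> limsup (\<lambda>k. \<integral>\<^sup>+t. w k t \<partial>M)"
    by (intro Limsup_mono always_eventually allI step1)
  also have "\<dots> \<le> 0"
    using nn_integral_limsup[of w M V, OF wm Vm wV Vfin] zero by simp
  finally show ?thesis by (simp add: ennreal_eq_0_iff)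
qed

section \<open>Lipschitzian integrands\<close>

text \<open>All pointwise conditions are required at every \<open>t\<close>, so that compactness and
  measurability of the values hold without exceptional sets.\<close>

locale lipschitz_integrand = finite_complete_measure M for M :: "'t measure" +
  fixes \<Phi> :: "'t \<Rightarrow> 'a::euclidean_space \<Rightarrow> 'b::euclidean_space set"
    and xb :: 'a and yb :: "'t \<Rightarrow> 'b" and l :: "'t \<Rightarrow> real" and \<eta> :: real
  assumes eta_pos: "\<eta> > 0"
    and closed_gph: "\<And>t. t \<in> space M \<Longrightarrow> closed (gph (\<Phi> t))"
    and gph_measurable:
      "{(t, z). t \<in> space M \<and> z \<in> gph (\<Phi> t)} \<in> sets (M \<Otimes>\<^sub>M (borel :: ('a \<times> 'b) measure))"
    and single: "\<And>t. t \<in> space M \<Longrightarrow> \<Phi> t xb = {yb t}"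
    and integrable_yb: "integrable M yb"
    and integrable_l: "integrable M l" and l_nonneg: "\<And>t. t \<in> space M \<Longrightarrow> l t \<ge> 0"
    and lip: "\<And>t. t \<in> space M \<Longrightarrow> lipschitz_map (\<Phi> t) (l t) (cball xb \<eta>)"
begin

section \<open>Values near the reference point and their measurable minimisers\<close>

lemma yb_measurable [measurable]: "yb \<in> borel_measurable M"
  using integrable_yb by (rule borel_measurable_integrable)

lemma l_measurable [measurable]: "l \<in> borel_measurable M"
  using integrable_l by (rule borel_measurable_integrable)

lemma xb_in_cball: "xb \<in> cball xb \<eta>" using eta_pos by simp

lemma section_measurable: "Sigma (space M) (\<lambda>t. \<Phi> t x) \<in> sets (M \<Otimes>\<^sub>M borel)"
proof -
  have "(\<lambda>p. (fst p, (x, snd p))) \<in> (M \<Otimes>\<^sub>M borel) \<rightarrow>\<^sub>M (M \<Otimes>\<^sub>M (borel :: ('a \<times> 'b) measure))"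
    unfolding borel_prod[symmetric] by measurable
  from measurable_sets[OF this gph_measurable]
  have "(\<lambda>p. (fst p, (x, snd p))) -` {(t, z). t \<in> space M \<and> z \<in> gph (\<Phi> t)} \<inter> space (M \<Otimes>\<^sub>M borel)
    \<in> sets (M \<Otimes>\<^sub>M borel)" .
  also have "(\<lambda>p. (fst p, (x, snd p))) -` {(t, z). t \<in> space M \<and> z \<in> gph (\<Phi> t)} \<inter> space (M \<Otimes>\<^sub>M borel)
    = Sigma (space M) (\<lambda>t. \<Phi> t x)"
    by (auto simp: space_pair_measure gph_def)
  finally show ?thesis .
qed

lemma section_closed:
  assumes "t \<in> space M" shows "closed (\<Phi> t x)"
proof -
  have "closed ((\<lambda>y. (x, y)) -` gph (\<Phi> t))"
    by (intro closed_vimage closed_gph assms continuous_intros)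
  also have "(\<lambda>y. (x, y)) -` gph (\<Phi> t) = \<Phi> t x" by (auto simp: gph_def)
  finally show ?thesis .
qed

lemma section_bound:
  assumes t: "t \<in> space M" and "x \<in> cball xb \<eta>" "y \<in> \<Phi> t x"
  shows "norm (y - yb t) \<le> l t * norm (x - xb)"
  using lipschitz_mapE[OF lip[OF t] assms(2) xb_in_cball assms(3)] single[OF t] by (metis singletonD)

lemma section_nonempty:
  assumes t: "t \<in> space M" and "x \<in> cball xb \<eta>"
  shows "\<Phi> t x \<noteq> {}"
  using lipschitz_mapE[OF lip[OF t] xb_in_cball assms(2), of "yb t"] single[OF t] by blast

lemma section_compact:
  assumes t: "t \<in> space M" and x: "x \<in> cball xb \<eta>"
  shows "compact (\<Phi> t x)"
proof -
  have "\<Phi> t x \<subseteq> cball (yb t) (l t * norm (x - xb))"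
    using section_bound[OF t x] by (auto simp: dist_norm norm_minus_commute)
  then have "bounded (\<Phi> t x)" by (rule bounded_subset[OF bounded_cball])
  then show ?thesis using section_closed[OF t] by (simp add: compact_eq_bounded_closed)
qed

lemma ball_section_measurable:
  assumes "u \<in> borel_measurable M" "r \<in> borel_measurable M"
  shows "Sigma (space M) (\<lambda>t. {v \<in> \<Phi> t x. norm (v - u t) \<le> r t}) \<in> sets (M \<Otimes>\<^sub>M borel)"
proof -
  have "{p \<in> space (M \<Otimes>\<^sub>M borel). norm (snd p - u (fst p)) \<le> r (fst p)} \<in> sets (M \<Otimes>\<^sub>M borel)"
    using assms by measurable
  then have "Sigma (space M) (\<lambda>t. \<Phi> t x) \<inter> {p \<in> space (M \<Otimes>\<^sub>M borel). norm (snd p - u (fst p)) \<le> r (fst p)}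
      \<in> sets (M \<Otimes>\<^sub>M borel)"
    by (intro sets.Int section_measurable)
  also have "Sigma (space M) (\<lambda>t. \<Phi> t x) \<inter> {p \<in> space (M \<Otimes>\<^sub>M borel). norm (snd p - u (fst p)) \<le> r (fst p)}
    = Sigma (space M) (\<lambda>t. {v \<in> \<Phi> t x. norm (v - u t) \<le> r t})"
    by (auto simp: space_pair_measure)
  finally show ?thesis .
qed

text \<open>Source of all competing selections for the expectation, and with \<open>e = 0\<close> of
  the minimal values of \<open>inner z\<close>. The radius may vary with \<open>t\<close>, and where
  the ball misses \<open>\<Phi> t x\<close> nothing is claimed.\<close>

lemma penalized_argmin:
  assumes u: "u \<in> borel_measurable M" and r: "r \<in> borel_measurable M" and x: "x \<in> cball xb \<eta>"
  obtains v where "v \<in> borel_measurable M"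
    "\<And>t y. t \<in> space M \<Longrightarrow> y \<in> \<Phi> t x \<Longrightarrow> norm (y - u t) \<le> r t \<Longrightarrow>
      v t \<in> \<Phi> t x \<and> norm (v t - u t) \<le> r t \<and>
      inner z (v t - u t) + e * norm (v t - u t) \<le> inner z (y - u t) + e * norm (y - u t)"
proof -
  let ?F = "\<lambda>t. {v \<in> \<Phi> t x. norm (v - u t) \<le> r t}"
  have "\<forall>t\<in>space M. compact (?F t)"
  proof
    fix t assume t: "t \<in> space M"
    have "?F t = \<Phi> t x \<inter> {v. norm (v - u t) \<le> r t}" by blast
    moreover have "closed {v. norm (v - u t) \<le> r t}"
      by (intro closed_Collect_le continuous_intros)
    ultimately show "compact (?F t)" using section_compact[OF t x] by (simp add: compact_Int_closed)
  qed
  moreover have "(\<lambda>p. inner z (snd p - u (fst p)) + e * norm (snd p - u (fst p))) \<in> borel_measurable (M \<Otimes>\<^sub>M borel)"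
    using u by measurable
  moreover have "continuous_on UNIV (\<lambda>v. inner z (v - u t) + e * norm (v - u t))" for t
    by (intro continuous_intros)
  ultimately obtain v where v: "v \<in> borel_measurable M"
      "\<And>t. t \<in> space M \<Longrightarrow> ?F t \<noteq> {} \<Longrightarrow> v t \<in> ?F t"
      "\<And>t y. t \<in> space M \<Longrightarrow> y \<in> ?F t \<Longrightarrow>
        inner z (v t - u t) + e * norm (v t - u t) \<le> inner z (y - u t) + e * norm (y - u t)"
    using argmin_selection[OF ball_section_measurable[OF u r, of x],
      of "\<lambda>t v. inner z (v - u t) + e * norm (v - u t)"] by blast
  show ?thesis
  proof (rule that[OF v(1)])
    fix t y assume t: "t \<in> space M" and "y \<in> \<Phi> t x" "norm (y - u t) \<le> r t"
    then have y: "y \<in> ?F t" by simp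
    then have "v t \<in> ?F t" using v(2)[OF t] by blast
    then show "v t \<in> \<Phi> t x \<and> norm (v t - u t) \<le> r t \<and>
      inner z (v t - u t) + e * norm (v t - u t) \<le> inner z (y - u t) + e * norm (y - u t)"
      using v(3)[OF t y] by simp
  qed
qed

section \<open>Regular coderivatives of the individual maps and their measurability in the
  parameter\<close>

lemma regular_coderivative_section_iff:
  assumes t: "t \<in> space M"
  shows "d \<in> regular_coderivative (\<Phi> t) xb (yb t) ys \<longleftrightarrow>
    (\<forall>e>0. \<exists>\<delta>>0. \<forall>x y. norm (x - xb) < \<delta> \<longrightarrow> y \<in> \<Phi> t x \<longrightarrow>
      inner d (x - xb) - inner ys (y - yb t) \<le> e * norm (x - xb))" (is "_ \<longleftrightarrow> ?R")
proof
  assume d: "d \<in> regular_coderivative (\<Phi> t) xb (yb t) ys"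
  show ?R
  proof (intro allI impI)
    fix e :: real assume e: "e > 0"
    \<comment> \<open>By \<open>section_bound\<close> the whole displacement in the graph is at most
      \<open>1 + l t\<close> times the displacement in \<open>x\<close>. This is why neither the
      neighbourhood nor the error has to mention \<open>y\<close>.\<close>
    have l1: "1 + l t > 0" using l_nonneg[OF t] by simp
    then have "e / (1 + l t) > 0" using e by simp
    from regular_coderivativeE[OF d this]
    obtain r where r: "r > 0" "\<And>x' y'. y' \<in> \<Phi> t x' \<Longrightarrow> dist (x', y') (xb, yb t) < r \<Longrightarrow>
      inner d (x' - xb) - inner ys (y' - yb t) \<le> e / (1 + l t) * norm (x' - xb, y' - yb t)" by blast
    have "inner d (x - xb) - inner ys (y - yb t) \<le> e * norm (x - xb)"
      if x: "norm (x - xb) < min \<eta> (r / (1 + l t))" and y: "y \<in> \<Phi> t x" for x y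
    proof -
      have "x \<in> cball xb \<eta>" using x by (simp add: dist_norm norm_minus_commute)
      from section_bound[OF t this y]
      have np: "norm (x - xb, y - yb t) \<le> (1 + l t) * norm (x - xb)"
        using norm_Pair_le_sum[of "x - xb" "y - yb t"] by (simp add: algebra_simps)
      also have "\<dots> < r" using x l1 by (simp add: pos_less_divide_eq mult.commute)
      finally have "inner d (x - xb) - inner ys (y - yb t) \<le> e / (1 + l t) * norm (x - xb, y - yb t)"
        using r(2)[OF y] by (simp add: dist_norm)
      also have "\<dots> \<le> e / (1 + l t) * ((1 + l t) * norm (x - xb))"
        using np e l1 by (intro mult_left_mono) auto
      finally show ?thesis using l1 by simp
    qed
    moreover have "min \<eta> (r / (1 + l t)) > 0" using eta_pos r l1 by simp
    ultimately show "\<exists>\<delta>>0. \<forall>x y. norm (x - xb) < \<delta> \<longrightarrow> y \<in> \<Phi> t x \<longrightarrow>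
      inner d (x - xb) - inner ys (y - yb t) \<le> e * norm (x - xb)" by blast
  qed
next
  assume R: ?R
  show "d \<in> regular_coderivative (\<Phi> t) xb (yb t) ys"
    unfolding regular_coderivative_iff
  proof (intro conjI allI impI)
    show "yb t \<in> \<Phi> t xb" using single[OF t] by simp
    fix e :: real assume e: "e > 0"
    then obtain \<delta> where \<delta>: "\<delta> > 0" "\<And>x y. norm (x - xb) < \<delta> \<Longrightarrow> y \<in> \<Phi> t x \<Longrightarrow>
      inner d (x - xb) - inner ys (y - yb t) \<le> e * norm (x - xb)" using R by blast
    have "inner d (x - xb) - inner ys (y - yb t) \<le> e * norm (x - xb, y - yb t)"
      if "y \<in> \<Phi> t x" "dist (x, y) (xb, yb t) < \<delta>" for x y
    proof -
      have n: "norm (x - xb) \<le> norm (x - xb, y - yb t)" by (rule norm_le_norm_Pair)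
      then have "norm (x - xb) < \<delta>" using that(2) by (simp add: dist_norm)
      from \<delta>(2)[OF this that(1)] show ?thesis using mult_left_mono[OF n less_imp_le[OF e]] by (rule order_trans)
    qed
    then show "\<exists>\<delta>>0. \<forall>x y. y \<in> \<Phi> t x \<and> dist (x, y) (xb, yb t) < \<delta> \<longrightarrow>
      inner d (x - xb) - inner ys (y - yb t) \<le> e * norm (x - xb, y - yb t)" using \<delta>(1) by blast
  qed
qed

lemma regular_coderivative_section_bound:
  assumes t: "t \<in> space M" and "d \<in> regular_coderivative (\<Phi> t) xb (yb t) ys"
  shows "norm d \<le> l t * norm ys"
  by (rule regular_coderivative_bound[OF lip[OF t] open_ball ball_subset_cball _ l_nonneg[OF t] assms(2)])
     (use eta_pos in simp)

lemma convex_regular_coderivative_section: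
  assumes t: "t \<in> space M"
  shows "convex (regular_coderivative (\<Phi> t) xb (yb t) ys)"
proof (rule convexI)
  fix d1 d2 and a b :: real
  assume d: "d1 \<in> regular_coderivative (\<Phi> t) xb (yb t) ys" "d2 \<in> regular_coderivative (\<Phi> t) xb (yb t) ys"
    and ab: "a \<ge> 0" "b \<ge> 0" "a + b = 1"
  show "a *\<^sub>R d1 + b *\<^sub>R d2 \<in> regular_coderivative (\<Phi> t) xb (yb t) ys"
    unfolding regular_coderivative_section_iff[OF t]
  proof (intro allI impI)
    fix e :: real assume e: "e > 0"
    obtain r1 where r1: "r1 > 0" "\<And>x y. norm (x - xb) < r1 \<Longrightarrow> y \<in> \<Phi> t x \<Longrightarrow>
      inner d1 (x - xb) - inner ys (y - yb t) \<le> e * norm (x - xb)"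
      using d(1) e unfolding regular_coderivative_section_iff[OF t] by blast
    obtain r2 where r2: "r2 > 0" "\<And>x y. norm (x - xb) < r2 \<Longrightarrow> y \<in> \<Phi> t x \<Longrightarrow>
      inner d2 (x - xb) - inner ys (y - yb t) \<le> e * norm (x - xb)"
      using d(2) e unfolding regular_coderivative_section_iff[OF t] by blast
    have "inner (a *\<^sub>R d1 + b *\<^sub>R d2) (x - xb) - inner ys (y - yb t) \<le> e * norm (x - xb)"
      if x: "norm (x - xb) < min r1 r2" and y: "y \<in> \<Phi> t x" for x y
    proof -
      have "inner (a *\<^sub>R d1 + b *\<^sub>R d2) (x - xb) - inner ys (y - yb t)
        = a * inner d1 (x - xb) + b * inner d2 (x - xb) - (a + b) * inner ys (y - yb t)"
        using ab(3) by (simp add: inner_add_left)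
      also have "\<dots> = a * (inner d1 (x - xb) - inner ys (y - yb t)) + b * (inner d2 (x - xb) - inner ys (y - yb t))"
        by (simp add: algebra_simps)
      also have "\<dots> \<le> a * (e * norm (x - xb)) + b * (e * norm (x - xb))"
        using r1(2)[OF _ y] r2(2)[OF _ y] x ab by (intro add_mono mult_left_mono) auto
      also have "\<dots> = e * norm (x - xb)" using ab(3) by (simp add: distrib_right[symmetric])
      finally show ?thesis .
    qed
    then show "\<exists>\<delta>>0. \<forall>x y. norm (x - xb) < \<delta> \<longrightarrow> y \<in> \<Phi> t x \<longrightarrow>
      inner (a *\<^sub>R d1 + b *\<^sub>R d2) (x - xb) - inner ys (y - yb t) \<le> e * norm (x - xb)"
      using r1(1) r2(1) by (intro exI[of _ "min r1 r2"]) auto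
  qed
qed

lemma closed_regular_coderivative_section:
  assumes t: "t \<in> space M"
  shows "closed (regular_coderivative (\<Phi> t) xb (yb t) ys)" (is "closed ?D")
proof -
  have "closure ?D \<subseteq> ?D"
  proof
    fix d assume "d \<in> closure ?D"
    show "d \<in> ?D"
      unfolding regular_coderivative_section_iff[OF t]
    proof (intro allI impI)
      fix e :: real assume "e > 0"
      then have e: "e / 2 > 0" by simp
      then obtain d' where d': "d' \<in> ?D" "dist d' d < e / 2"
        using \<open>d \<in> closure ?D\<close> unfolding closure_approachable by blast
      obtain r where r: "r > 0" "\<And>x y. norm (x - xb) < r \<Longrightarrow> y \<in> \<Phi> t x \<Longrightarrow>
        inner d' (x - xb) - inner ys (y - yb t) \<le> e / 2 * norm (x - xb)"
        using d'(1) e unfolding regular_coderivative_section_iff[OF t] by blast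
      have "inner d (x - xb) - inner ys (y - yb t) \<le> e * norm (x - xb)"
        if x: "norm (x - xb) < r" and y: "y \<in> \<Phi> t x" for x y
      proof -
        have "inner (d - d') (x - xb) \<le> norm (d - d') * norm (x - xb)" by (rule norm_cauchy_schwarz)
        also have "\<dots> \<le> e / 2 * norm (x - xb)"
          using d'(2) by (intro mult_right_mono) (auto simp: dist_norm norm_minus_commute)
        finally show ?thesis using r(2)[OF x y] by (simp add: inner_diff_left)
      qed
      then show "\<exists>\<delta>>0. \<forall>x y. norm (x - xb) < \<delta> \<longrightarrow> y \<in> \<Phi> t x \<longrightarrow>
        inner d (x - xb) - inner ys (y - yb t) \<le> e * norm (x - xb)" using r(1) by blast
    qed
  qed
  then show ?thesis using closure_subset_eq by blast
qed

text \<open>For fixed \<open>x\<close> the worst \<open>y\<close> is a minimiser of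
  \<open>inner ys\<close>, so one function \<open>w\<close> suffices; the Lipschitz property then
  allows \<open>x\<close> to run through a countable dense set. What remains are countably many
  inequalities, fit for measurability in \<open>(t, d)\<close>.\<close>

lemma regular_coderivative_countable_iff:
  assumes t: "t \<in> space M" and Q: "\<And>U. open U \<Longrightarrow> U \<noteq> {} \<Longrightarrow> \<exists>q\<in>Q. q \<in> U"
    and w: "\<And>q. q \<in> cball xb \<eta> \<Longrightarrow> w q \<in> \<Phi> t q"
    and wmin: "\<And>q y. q \<in> cball xb \<eta> \<Longrightarrow> y \<in> \<Phi> t q \<Longrightarrow> inner ys (w q - yb t) \<le> inner ys (y - yb t)"
  shows "d \<in> regular_coderivative (\<Phi> t) xb (yb t) ys \<longleftrightarrow>
    (\<forall>i::nat. \<exists>j::nat. \<forall>q\<in>Q \<inter> ball xb (\<eta> / real (Suc j)).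
      inner d (q - xb) - inner ys (w q - yb t) \<le> inverse (real (Suc i)) * norm (q - xb))" (is "_ \<longleftrightarrow> ?R")
proof -
  have sub: "q \<in> cball xb \<eta>" if "q \<in> ball xb (\<eta> / real (Suc j))" for q j
  proof -
    have "\<eta> / real (Suc j) \<le> \<eta>" using eta_pos by (simp add: divide_le_eq)
    then show ?thesis using that by simp
  qed
  show ?thesis
  proof
    assume d: "d \<in> regular_coderivative (\<Phi> t) xb (yb t) ys"
    show ?R
    proof
      fix i :: nat
      have "inverse (real (Suc i)) > 0" by simp
      with d obtain r where r: "r > 0" "\<And>x y. norm (x - xb) < r \<Longrightarrow> y \<in> \<Phi> t x \<Longrightarrow>
        inner d (x - xb) - inner ys (y - yb t) \<le> inverse (real (Suc i)) * norm (x - xb)"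
        unfolding regular_coderivative_section_iff[OF t] by meson
      obtain j where "inverse (real (Suc j)) < r / \<eta>"
        using reals_Archimedean[of "r / \<eta>"] r eta_pos by auto
      then have j: "\<eta> / real (Suc j) < r" using eta_pos by (simp add: field_simps)
      show "\<exists>j::nat. \<forall>q\<in>Q \<inter> ball xb (\<eta> / real (Suc j)).
        inner d (q - xb) - inner ys (w q - yb t) \<le> inverse (real (Suc i)) * norm (q - xb)"
      proof (intro exI ballI)
        fix q assume q: "q \<in> Q \<inter> ball xb (\<eta> / real (Suc j))"
        then have "norm (q - xb) < r" using j by (simp add: dist_norm norm_minus_commute)
        then show "inner d (q - xb) - inner ys (w q - yb t) \<le> inverse (real (Suc i)) * norm (q - xb)"
          using q by (intro r(2) w sub) auto
      qed
    qed
  next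
    assume R: ?R
    show "d \<in> regular_coderivative (\<Phi> t) xb (yb t) ys"
      unfolding regular_coderivative_section_iff[OF t]
    proof (intro allI impI)
      fix e :: real assume "e > 0"
      then obtain i where i: "inverse (real (Suc i)) < e" using reals_Archimedean by blast
      obtain j where j: "\<And>q. q \<in> Q \<Longrightarrow> q \<in> ball xb (\<eta> / real (Suc j)) \<Longrightarrow>
        inner d (q - xb) - inner ys (w q - yb t) \<le> inverse (real (Suc i)) * norm (q - xb)"
        using R by blast
      have "inner d (x - xb) - inner ys (y - yb t) \<le> e * norm (x - xb)"
        if x: "norm (x - xb) < \<eta> / real (Suc j)" and y: "y \<in> \<Phi> t x" for x y
      proof (rule ccontr)
        assume neg: "\<not> ?thesis"
        have xB: "x \<in> ball xb (\<eta> / real (Suc j))" using x by (simp add: dist_norm norm_minus_commute)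
        \<comment> \<open>A lower bound for the violation of the inequality at \<open>q\<close>: the
          term with \<open>norm (x - q)\<close> is the price of carrying \<open>y\<close> over to
          \<open>\<Phi> t q\<close>. It is continuous and positive at \<open>x\<close>, hence
          positive at some point of \<open>Q\<close>.\<close>
        define f where "f q = inner d (q - xb) - (inner ys (y - yb t) + norm ys * (l t * norm (x - q))) - e * norm (q - xb)" for q
        define U where "U = ball xb (\<eta> / real (Suc j)) \<inter> {q. 0 < f q}"
        have "open U" unfolding U_def f_def
          by (intro open_Int open_ball open_Collect_less continuous_intros)
        moreover have "x \<in> U" using neg xB unfolding U_def f_def by simp
        ultimately obtain q where q: "q \<in> Q" "q \<in> U" using Q by blast
        then have qB: "q \<in> ball xb (\<eta> / real (Suc j))" and fq: "0 < f q" unfolding U_def by auto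
        from lipschitz_mapE[OF lip[OF t] sub[OF xB] sub[OF qB] y]
        obtain y' where y': "y' \<in> \<Phi> t q" "norm (y - y') \<le> l t * norm (x - q)" by blast
        have "inner ys (w q - yb t) \<le> inner ys (y' - yb t)" by (rule wmin[OF sub[OF qB] y'(1)])
        also have "\<dots> = inner ys (y - yb t) + inner ys (y' - y)" by (simp add: inner_diff_right)
        also have "inner ys (y' - y) \<le> norm ys * norm (y' - y)" by (rule norm_cauchy_schwarz)
        also have "\<dots> \<le> norm ys * (l t * norm (x - q))"
          using y'(2) by (intro mult_left_mono) (auto simp: norm_minus_commute)
        finally have A: "inner ys (w q - yb t) \<le> inner ys (y - yb t) + norm ys * (l t * norm (x - q))" by simp
        have B: "inverse (real (Suc i)) * norm (q - xb) \<le> e * norm (q - xb)"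
          using i by (intro mult_right_mono) auto
        show False using A B fq j[OF q(1) qB] unfolding f_def by argo
      qed
      moreover have "\<eta> / real (Suc j) > 0" using eta_pos by simp
      ultimately show "\<exists>\<delta>>0. \<forall>x y. norm (x - xb) < \<delta> \<longrightarrow> y \<in> \<Phi> t x \<longrightarrow>
        inner d (x - xb) - inner ys (y - yb t) \<le> e * norm (x - xb)" by blast
    qed
  qed
qed

lemma regular_coderivative_graph_measurable:
  "Sigma (space M) (\<lambda>t. regular_coderivative (\<Phi> t) xb (yb t) ys) \<in> sets (M \<Otimes>\<^sub>M borel)"
proof -
  have "\<forall>q. \<exists>v. q \<in> cball xb \<eta> \<longrightarrow> v \<in> borel_measurable M \<and> (\<forall>t\<in>space M. v t \<in> \<Phi> t q \<and>
      (\<forall>y\<in>\<Phi> t q. inner ys (v t - yb t) \<le> inner ys (y - yb t)))"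
  proof
    fix q
    show "\<exists>v. q \<in> cball xb \<eta> \<longrightarrow> v \<in> borel_measurable M \<and> (\<forall>t\<in>space M. v t \<in> \<Phi> t q \<and>
      (\<forall>y\<in>\<Phi> t q. inner ys (v t - yb t) \<le> inner ys (y - yb t)))"
    proof (cases "q \<in> cball xb \<eta>")
      case True
      \<comment> \<open>The ball of this radius around \<open>yb t\<close> contains all of
        \<open>\<Phi> t q\<close>, so the constrained minimiser is a global one.\<close>
      have "(\<lambda>t. l t * norm (q - xb)) \<in> borel_measurable M" by measurable
      from penalized_argmin[OF yb_measurable this True, where e = 0 and z = ys]
      obtain v where v: "v \<in> borel_measurable M"
        "\<And>t y. t \<in> space M \<Longrightarrow> y \<in> \<Phi> t q \<Longrightarrow> norm (y - yb t) \<le> l t * norm (q - xb) \<Longrightarrow>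
          v t \<in> \<Phi> t q \<and> norm (v t - yb t) \<le> l t * norm (q - xb) \<and>
          inner ys (v t - yb t) + 0 * norm (v t - yb t) \<le> inner ys (y - yb t) + 0 * norm (y - yb t)"
        by blast
      have "v t \<in> \<Phi> t q \<and> (\<forall>y\<in>\<Phi> t q. inner ys (v t - yb t) \<le> inner ys (y - yb t))"
        if t: "t \<in> space M" for t
      proof -
        have *: "v t \<in> \<Phi> t q \<and> inner ys (v t - yb t) \<le> inner ys (y - yb t)" if "y \<in> \<Phi> t q" for y
          using v(2)[OF t that section_bound[OF t True that]] by simp
        moreover obtain y0 where "y0 \<in> \<Phi> t q" using section_nonempty[OF t True] by blast
        ultimately show ?thesis by blast
      qed
      then show ?thesis using v(1) by blast
    qed blast
  qed
  from choice[OF this] obtain w where w: "\<And>q. q \<in> cball xb \<eta> \<Longrightarrow> w q \<in> borel_measurable M"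
    and wP: "\<And>q t. q \<in> cball xb \<eta> \<Longrightarrow> t \<in> space M \<Longrightarrow> w q t \<in> \<Phi> t q"
    and wmin: "\<And>q t y. q \<in> cball xb \<eta> \<Longrightarrow> t \<in> space M \<Longrightarrow> y \<in> \<Phi> t q \<Longrightarrow>
      inner ys (w q t - yb t) \<le> inner ys (y - yb t)"
    by blast
  obtain Q :: "'a set" where Q: "countable Q" "\<And>U. open U \<Longrightarrow> U \<noteq> {} \<Longrightarrow> \<exists>q\<in>Q. q \<in> U"
    using countable_dense_setE by blast
  let ?P = "\<lambda>i j p. \<forall>q\<in>Q \<inter> ball xb (\<eta> / real (Suc j)).
      inner (snd p) (q - xb) - inner ys (w q (fst p) - yb (fst p)) \<le> inverse (real (Suc i)) * norm (q - xb)"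
  have "Sigma (space M) (\<lambda>t. regular_coderivative (\<Phi> t) xb (yb t) ys)
    = {p \<in> space (M \<Otimes>\<^sub>M borel). \<forall>i::nat. \<exists>j::nat. ?P i j p}"
  proof -
    have "(t, d) \<in> Sigma (space M) (\<lambda>t. regular_coderivative (\<Phi> t) xb (yb t) ys) \<longleftrightarrow>
        (t, d) \<in> {p \<in> space (M \<Otimes>\<^sub>M borel). \<forall>i::nat. \<exists>j::nat. ?P i j p}" for t d
    proof (cases "t \<in> space M")
      case t: True
      have "d \<in> regular_coderivative (\<Phi> t) xb (yb t) ys \<longleftrightarrow> (\<forall>i::nat. \<exists>j::nat. ?P i j (t, d))"
        unfolding fst_conv snd_conv
        by (rule regular_coderivative_countable_iff[OF t Q(2), where w = "\<lambda>q. w q t"])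
           (use wP wmin t in auto)
      then show ?thesis using t by (simp add: space_pair_measure)
    qed (simp add: space_pair_measure)
    from this[of "fst p" "snd p" for p] show ?thesis unfolding prod.collapse by (rule set_eqI)
  qed
  also have "\<dots> \<in> sets (M \<Otimes>\<^sub>M borel)"
  proof (intro sets.sets_Collect_countable_All sets.sets_Collect_countable_Ex sets.sets_Collect_countable_All')
    fix i j :: nat and q assume q: "q \<in> Q \<inter> ball xb (\<eta> / real (Suc j))"
    have "\<eta> / real (Suc j) \<le> \<eta>" using eta_pos by (simp add: divide_le_eq)
    then have "q \<in> cball xb \<eta>" using q by simp
    note [measurable] = w[OF this]
    show "{p \<in> space (M \<Otimes>\<^sub>M borel). inner (snd p) (q - xb) - inner ys (w q (fst p) - yb (fst p))
        \<le> inverse (real (Suc i)) * norm (q - xb)} \<in> sets (M \<Otimes>\<^sub>M borel)"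
      by measurable
  qed (use Q(1) in auto)
  finally show ?thesis .
qed

lemma expected_map_single: "expected_map M \<Phi> xb = {integral\<^sup>L M yb}"
proof (intro equalityI subsetI)
  fix z assume "z \<in> expected_map M \<Phi> xb"
  then obtain v where v: "integrable M v" "AE t in M. v t \<in> \<Phi> t xb" "z = integral\<^sup>L M v"
    by (rule mem_expected_mapE)
  have "AE t in M. v t = yb t"
    using v(2) AE_space
  proof eventually_elim
    case (elim t)
    then show ?case using single[OF elim(2)] by simp
  qed
  then have "integral\<^sup>L M v = integral\<^sup>L M yb"
    by (intro integral_cong_AE borel_measurable_integrable v(1) integrable_yb)
  then show "z \<in> {integral\<^sup>L M yb}" unfolding v(3) by simp
next
  have "integral\<^sup>L M yb \<in> expected_map M \<Phi> xb"
    by (intro mem_expected_mapI integrable_yb AE_I2) (simp add: single)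
  then show "z \<in> expected_map M \<Phi> xb" if "z \<in> {integral\<^sup>L M yb}" for z using that by simp
qed

section \<open>Normals to the expectation at nearby points and their pointwise consequences\<close>

lemma integrable_near:
  assumes v: "v \<in> borel_measurable M" and u: "integrable M u" and r: "integrable M r"
    and "AE t in M. norm (v t - u t) \<le> r t"
  shows "integrable M (v :: 't \<Rightarrow> 'b)"
proof (rule Bochner_Integration.integrable_bound)
  show "integrable M (\<lambda>t. norm (u t) + r t)" using u r by simp
  show "AE t in M. norm (v t) \<le> norm (norm (u t) + r t)"
    using assms(4)
  proof eventually_elim
    case (elim t)
    have "norm (v t) \<le> norm (v t - u t) + norm (u t)" using norm_triangle_ineq[of "v t - u t" "u t"] by simp
    then show ?case using elim by simp
  qed
qed (rule v)

text \<open>Testing with a pointwise minimiser turns the inequality between integrals into one that holds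
  almost everywhere.\<close>

lemma selection_locally_minimal:
  assumes x: "x \<in> cball xb \<eta>" and u: "integrable M u" "AE t in M. u t \<in> \<Phi> t x" and e: "e > 0" and \<delta>: "\<delta> > 0"
    and normal: "\<And>y. y \<in> expected_map M \<Phi> x \<Longrightarrow> norm (y - integral\<^sup>L M u) < \<delta> \<Longrightarrow>
      - inner z (y - integral\<^sup>L M u) \<le> e * norm (y - integral\<^sup>L M u)"
    and d: "0 < d" "d * measure M (space M) < \<delta>"
  shows "AE t in M. \<forall>v\<in>\<Phi> t x. norm (v - u t) \<le> d \<longrightarrow> - e * norm (v - u t) \<le> inner z (v - u t)"
proof -
  have um: "u \<in> borel_measurable M" using u(1) by (rule borel_measurable_integrable)
  have dm: "(\<lambda>t. d) \<in> borel_measurable M" by simp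
  obtain v where v: "v \<in> borel_measurable M"
    "\<And>t y. t \<in> space M \<Longrightarrow> y \<in> \<Phi> t x \<Longrightarrow> norm (y - u t) \<le> d \<Longrightarrow>
      v t \<in> \<Phi> t x \<and> norm (v t - u t) \<le> d \<and>
      inner z (v t - u t) + e * norm (v t - u t) \<le> inner z (y - u t) + e * norm (y - u t)"
    using penalized_argmin[OF um dm x, of z e] by blast
  define f where "f t = inner z (v t - u t) + e * norm (v t - u t)" for t
  \<comment> \<open>The value \<open>u t\<close> itself competes, so the minimum \<open>f t\<close>
    is at most 0. The normal inequality at the integral of \<open>v\<close> will give a nonnegative
    integral of \<open>f\<close>, hence \<open>f = 0\<close> almost everywhere.\<close>
  have vu: "AE t in M. v t \<in> \<Phi> t x \<and> norm (v t - u t) \<le> d \<and> f t \<le> 0"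
    using u(2) AE_space
  proof eventually_elim
    case (elim t)
    show ?case using v(2)[OF elim(2) elim(1)] d(1) unfolding f_def by simp
  qed
  have vi: "integrable M v"
    by (rule integrable_near[OF v(1) u(1), of "\<lambda>t. d"]) (use vu in \<open>auto elim: eventually_mono\<close>)
  have di: "integrable M (\<lambda>t. v t - u t)" using vi u(1) by simp
  have fi: "integrable M f" unfolding f_def using di by auto
  have vE: "integral\<^sup>L M v \<in> expected_map M \<Phi> x"
    by (rule mem_expected_mapI[OF vi]) (use vu in \<open>auto elim: eventually_mono\<close>)
  have I: "integral\<^sup>L M v - integral\<^sup>L M u = (\<integral>t. v t - u t \<partial>M)" using vi u(1) by simp
  have nI: "norm (integral\<^sup>L M v - integral\<^sup>L M u) \<le> (\<integral>t. norm (v t - u t) \<partial>M)"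
    unfolding I by (rule integral_norm_bound)
  also have "\<dots> \<le> (\<integral>t. d \<partial>M)"
    by (rule integral_mono_AE) (use di vu in \<open>auto elim: eventually_mono\<close>)
  also have "\<dots> < \<delta>" using d(2) by (simp add: mult.commute)
  finally have "- inner z (integral\<^sup>L M v - integral\<^sup>L M u) \<le> e * norm (integral\<^sup>L M v - integral\<^sup>L M u)"
    by (rule normal[OF vE])
  also have "\<dots> \<le> e * (\<integral>t. norm (v t - u t) \<partial>M)" using nI e by (intro mult_left_mono) auto
  finally have "0 \<le> inner z (\<integral>t. v t - u t \<partial>M) + e * (\<integral>t. norm (v t - u t) \<partial>M)" unfolding I by simp
  also have "\<dots> = integral\<^sup>L M f" unfolding f_def using di by simp
  finally have "0 \<le> integral\<^sup>L M f" .
  moreover have "0 \<le> (\<integral>t. - f t \<partial>M)"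
    using vu by (intro integral_nonneg_AE) (auto elim: eventually_mono)
  ultimately have "(\<integral>t. - f t \<partial>M) = 0" by simp
  moreover have "integrable M (\<lambda>t. - f t)" using fi by simp
  ultimately have "AE t in M. - f t = 0"
    using vu by (subst (asm) integral_nonneg_eq_0_iff_AE) (auto elim: eventually_mono)
  then show ?thesis
    using AE_space
  proof eventually_elim
    case (elim t)
    show ?case
    proof (intro ballI impI)
      fix y assume "y \<in> \<Phi> t x" "norm (y - u t) \<le> d"
      from v(2)[OF elim(2) this] have "f t \<le> inner z (y - u t) + e * norm (y - u t)" unfolding f_def by simp
      then show "- e * norm (y - u t) \<le> inner z (y - u t)" using elim(1) by simp
    qed
  qed
qed

text \<open>\<open>g t\<close> is the least penalised increment over admissible values at
  \<open>x + s *\<^sub>R h\<close>, divided by \<open>s\<close>. The minimisers integrate to a point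
  of the expectation, where the normal inequality bounds the integral of \<open>g\<close> from
  below; a Lipschitz competitor bounds \<open>g\<close> from above. The penalty \<open>2 * e\<close>
  is the one in \<open>descent_direction\<close>.\<close>

lemma selection_difference_quotient:
  assumes x: "x \<in> cball xb \<eta>" and xs: "x + s *\<^sub>R h \<in> cball xb \<eta>" and s: "s > 0"
    and u: "integrable M u" "AE t in M. u t \<in> \<Phi> t x" and e: "e > 0" and d: "d \<ge> 0"
    and normal: "\<And>y. y \<in> expected_map M \<Phi> (x + s *\<^sub>R h) \<Longrightarrow>
      norm (y - integral\<^sup>L M u) \<le> d * measure M (space M) + s * norm h * integral\<^sup>L M l \<Longrightarrow>
      inner p (s *\<^sub>R h) - inner z (y - integral\<^sup>L M u) \<le> e * (norm (s *\<^sub>R h) + norm (y - integral\<^sup>L M u))"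
  shows "\<exists>g. integrable M g \<and> (AE t in M. g t \<le> (norm z + 2 * e) * (l t * norm h)) \<and>
    inner p h - e * norm h \<le> integral\<^sup>L M g \<and>
    (\<forall>t\<in>space M. \<forall>v\<in>\<Phi> t (x + s *\<^sub>R h). norm (v - u t) \<le> d \<longrightarrow>
      s * g t \<le> inner z (v - u t) + 2 * e * norm (v - u t))"
proof -
  have um: "u \<in> borel_measurable M" using u(1) by (rule borel_measurable_integrable)
  \<comment> \<open>The second summand is the Lipschitz displacement: it guarantees an admissible
    value near \<open>u t\<close>, while the first admits every value within
    \<open>d\<close>.\<close>
  define r where "r t = d + s * norm h * l t" for t
  have rm: "r \<in> borel_measurable M" unfolding r_def by measurable
  have ri: "integrable M r" unfolding r_def using integrable_l by simp
  have rI: "integral\<^sup>L M r = d * measure M (space M) + s * norm h * integral\<^sup>L M l"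
    unfolding r_def using integrable_l by (simp add: mult.commute)
  obtain v where v: "v \<in> borel_measurable M"
    "\<And>t y. t \<in> space M \<Longrightarrow> y \<in> \<Phi> t (x + s *\<^sub>R h) \<Longrightarrow> norm (y - u t) \<le> r t \<Longrightarrow>
      v t \<in> \<Phi> t (x + s *\<^sub>R h) \<and> norm (v t - u t) \<le> r t \<and>
      inner z (v t - u t) + 2 * e * norm (v t - u t) \<le> inner z (y - u t) + 2 * e * norm (y - u t)"
    using penalized_argmin[OF um rm xs, of z "2 * e"] by blast
  define f where "f t = inner z (v t - u t) + 2 * e * norm (v t - u t)" for t
  have vu: "AE t in M. v t \<in> \<Phi> t (x + s *\<^sub>R h) \<and> norm (v t - u t) \<le> r t \<and>
      f t \<le> s * ((norm z + 2 * e) * (l t * norm h))"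
    using u(2) AE_space
  proof eventually_elim
    case (elim t)
    from lipschitz_mapE[OF lip[OF elim(2)] x xs elim(1)]
    obtain y where y: "y \<in> \<Phi> t (x + s *\<^sub>R h)" "norm (u t - y) \<le> l t * norm (x - (x + s *\<^sub>R h))" by blast
    have ny: "norm (y - u t) \<le> s * norm h * l t" using y(2) s by (simp add: norm_minus_commute mult_ac)
    then have "norm (y - u t) \<le> r t" using d unfolding r_def by simp
    from v(2)[OF elim(2) y(1) this]
    have A: "v t \<in> \<Phi> t (x + s *\<^sub>R h)" "norm (v t - u t) \<le> r t"
      "f t \<le> inner z (y - u t) + 2 * e * norm (y - u t)" unfolding f_def by auto
    have "inner z (y - u t) \<le> norm z * norm (y - u t)" by (rule norm_cauchy_schwarz)
    then have "f t \<le> (norm z + 2 * e) * norm (y - u t)" using A(3) by (simp add: distrib_right)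
    also have "\<dots> \<le> (norm z + 2 * e) * (s * norm h * l t)" using ny e by (intro mult_left_mono) auto
    finally show ?case using A by (simp add: mult_ac)
  qed
  have vi: "integrable M v"
    by (rule integrable_near[OF v(1) u(1) ri]) (use vu in \<open>auto elim: eventually_mono\<close>)
  have di: "integrable M (\<lambda>t. v t - u t)" using vi u(1) by simp
  have fi: "integrable M f" unfolding f_def using di by auto
  have vE: "integral\<^sup>L M v \<in> expected_map M \<Phi> (x + s *\<^sub>R h)"
    by (rule mem_expected_mapI[OF vi]) (use vu in \<open>auto elim: eventually_mono\<close>)
  have I: "integral\<^sup>L M v - integral\<^sup>L M u = (\<integral>t. v t - u t \<partial>M)" using vi u(1) by simp
  have nI: "norm (integral\<^sup>L M v - integral\<^sup>L M u) \<le> (\<integral>t. norm (v t - u t) \<partial>M)"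
    unfolding I by (rule integral_norm_bound)
  also have "\<dots> \<le> integral\<^sup>L M r"
    by (rule integral_mono_AE) (use di ri vu in \<open>auto elim: eventually_mono\<close>)
  finally have "inner p (s *\<^sub>R h) - inner z (integral\<^sup>L M v - integral\<^sup>L M u)
      \<le> e * (norm (s *\<^sub>R h) + norm (integral\<^sup>L M v - integral\<^sup>L M u))"
    unfolding rI by (rule normal[OF vE])
  also have "\<dots> \<le> e * (norm (s *\<^sub>R h) + 2 * (\<integral>t. norm (v t - u t) \<partial>M))"
  proof -
    have "0 \<le> (\<integral>t. norm (v t - u t) \<partial>M)" by simp
    with nI have "norm (integral\<^sup>L M v - integral\<^sup>L M u) \<le> 2 * (\<integral>t. norm (v t - u t) \<partial>M)" by argo
    then show ?thesis using e by (intro mult_left_mono add_left_mono) auto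
  qed
  finally have "inner p (s *\<^sub>R h) - e * norm (s *\<^sub>R h) \<le>
      inner z (\<integral>t. v t - u t \<partial>M) + 2 * e * (\<integral>t. norm (v t - u t) \<partial>M)"
    unfolding I by (simp add: algebra_simps)
  also have "\<dots> = integral\<^sup>L M f" unfolding f_def using di by simp
  finally have main: "s * (inner p h - e * norm h) \<le> integral\<^sup>L M f" using s by (simp add: algebra_simps)
  show ?thesis
  proof (intro exI[of _ "\<lambda>t. f t / s"] conjI ballI impI)
    show "integrable M (\<lambda>t. f t / s)" using fi by simp
    show "AE t in M. f t / s \<le> (norm z + 2 * e) * (l t * norm h)"
      using vu
    proof eventually_elim
      case (elim t)
      then show ?case using s by (simp add: pos_divide_le_eq mult.commute)
    qed
    show "inner p h - e * norm h \<le> (\<integral>t. f t / s \<partial>M)"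
      using main s by (simp add: pos_le_divide_eq mult.commute)
    fix t y assume t: "t \<in> space M" and y: "y \<in> \<Phi> t (x + s *\<^sub>R h)" "norm (y - u t) \<le> d"
    have "0 \<le> s * norm h * l t" using s l_nonneg[OF t] by simp
    then have "norm (y - u t) \<le> r t" using y(2) unfolding r_def by simp
    from v(2)[OF t y(1) this] show "s * (f t / s) \<le> inner z (y - u t) + 2 * e * norm (y - u t)"
      using s unfolding f_def by simp
  qed
qed

text \<open>Collects the quotients along steps tending to 0. The premise of the last clause has the
  form of the conclusion of \<open>descent_direction\<close>: descent at rate \<open>c\<close> for
  all short steps bounds the quotients by \<open>c\<close> eventually.\<close>

lemma coderivative_difference_quotients:
  assumes x: "x \<in> ball xb \<eta>" and p: "p \<in> regular_coderivative (expected_map M \<Phi>) x y z" and e: "e > 0"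
  shows "\<exists>u d g. d > 0 \<and> (AE t in M. u t \<in> \<Phi> t x) \<and>
    (AE t in M. \<forall>v\<in>\<Phi> t x. norm (v - u t) \<le> d \<longrightarrow> - e * norm (v - u t) \<le> inner z (v - u t)) \<and>
    (\<forall>j::nat. integrable M (g j) \<and> (AE t in M. g j t \<le> (norm z + 2 * e) * (l t * norm h)) \<and>
      inner p h - e * norm h \<le> integral\<^sup>L M (g j)) \<and>
    (\<forall>t\<in>space M. \<forall>c. (\<exists>s0>0. \<forall>s. 0 < s \<and> s < s0 \<longrightarrow> (\<exists>v\<in>\<Phi> t (x + s *\<^sub>R h). norm (v - u t) \<le> d / 2 \<and>
      inner z (v - u t) + 2 * e * norm (v - u t) \<le> c * s)) \<longrightarrow> eventually (\<lambda>j. g j t \<le> c) sequentially)"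
proof -
  let ?E = "expected_map M \<Phi>" and ?m = "measure M (space M)"
  obtain u where u: "integrable M u" "AE t in M. u t \<in> \<Phi> t x" "y = integral\<^sup>L M u"
    using regular_coderivative_mem[OF p] by (rule mem_expected_mapE)
  from regular_coderivativeE[OF p e]
  obtain \<delta> where \<delta>: "\<delta> > 0" "\<And>x' y'. y' \<in> ?E x' \<Longrightarrow> dist (x', y') (x, y) < \<delta> \<Longrightarrow>
    inner p (x' - x) - inner z (y' - y) \<le> e * norm (x' - x, y' - y)" by blast
  have x': "x \<in> cball xb \<eta>" using x by simp
  \<comment> \<open>Selections within \<open>d\<close> of \<open>u\<close> have integrals within
    \<open>\<delta> / 2\<close> of \<open>y\<close>. The added 1 avoids a zero denominator when the
    total mass is 0.\<close>
  define d where "d = \<delta> / (2 * (?m + 1))"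
  have m1: "?m + 1 > 0" by (simp add: add_nonneg_pos)
  have d: "d > 0" unfolding d_def using \<delta> m1 by simp
  have dm: "d * ?m \<le> \<delta> / 2"
  proof -
    have "d * ?m \<le> d * (?m + 1)" using d by simp
    also have "\<dots> = \<delta> / 2"
    proof -
      have "\<delta> / (2 * b) * b = \<delta> / 2" if "b > 0" for b :: real using that by simp
      from this[OF m1] show ?thesis unfolding d_def .
    qed
    finally show ?thesis .
  qed
  have loc: "AE t in M. \<forall>v\<in>\<Phi> t x. norm (v - u t) \<le> d \<longrightarrow> - e * norm (v - u t) \<le> inner z (v - u t)"
  proof (rule selection_locally_minimal[OF x' u(1,2) e \<delta>(1) _ d])
    show "d * ?m < \<delta>" using dm \<delta>(1) by simp
    show "- inner z (y' - integral\<^sup>L M u) \<le> e * norm (y' - integral\<^sup>L M u)"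
      if "y' \<in> ?E x" "norm (y' - integral\<^sup>L M u) < \<delta>" for y'
      using \<delta>(2)[OF that(1)] that(2) unfolding u(3) by (simp add: dist_norm norm_Pair)
  qed
  \<comment> \<open>\<open>s * a\<close> dominates the displacement \<open>s *\<^sub>R h\<close>
    together with the induced shift of the integral; the final 1 keeps \<open>a\<close> positive
    also for \<open>h = 0\<close>.\<close>
  define a where "a = norm h * (1 + integral\<^sup>L M l) + 1"
  have lI: "integral\<^sup>L M l \<ge> 0" using l_nonneg by (intro integral_nonneg_AE) auto
  have a: "a > 0" unfolding a_def using lI by (intro add_nonneg_pos) auto
  define s1 where "s1 = min ((\<eta> - norm (x - xb)) / (norm h + 1)) (\<delta> / (4 * a))"
  have h1: "norm h + 1 > 0" by (simp add: add_nonneg_pos)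
  have xn: "norm (x - xb) < \<eta>" using x by (simp add: dist_norm norm_minus_commute)
  have s1: "s1 > 0" unfolding s1_def using xn h1 \<delta>(1) a by simp
  have "\<exists>g. integrable M g \<and> (AE t in M. g t \<le> (norm z + 2 * e) * (l t * norm h)) \<and>
    inner p h - e * norm h \<le> integral\<^sup>L M g \<and>
    (\<forall>t\<in>space M. \<forall>v\<in>\<Phi> t (x + s *\<^sub>R h). norm (v - u t) \<le> d / 2 \<longrightarrow>
      s * g t \<le> inner z (v - u t) + 2 * e * norm (v - u t))" if s: "0 < s" "s \<le> s1" for s
  proof (rule selection_difference_quotient[OF x' _ s(1) u(1,2) e])
    have "s * (norm h + 1) \<le> \<eta> - norm (x - xb)"
      using s(2) h1 unfolding s1_def by (simp add: pos_le_divide_eq)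
    then have "norm (x - xb) + s * norm h \<le> \<eta>" using s(1) by (simp add: algebra_simps)
    moreover have "norm (x - xb + s *\<^sub>R h) \<le> norm (x - xb) + s * norm h"
      using norm_triangle_ineq[of "x - xb" "s *\<^sub>R h"] s(1) by simp
    ultimately have "norm (x - xb + s *\<^sub>R h) \<le> \<eta>" by simp
    moreover have "dist xb (x + s *\<^sub>R h) = norm (x - xb + s *\<^sub>R h)"
      unfolding dist_norm by (subst norm_minus_commute) (simp add: algebra_simps)
    ultimately show "x + s *\<^sub>R h \<in> cball xb \<eta>" by simp
    show "d / 2 \<ge> 0" using d by simp
    fix y' assume y': "y' \<in> ?E (x + s *\<^sub>R h)"
      and n: "norm (y' - integral\<^sup>L M u) \<le> d / 2 * ?m + s * norm h * integral\<^sup>L M l"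
    have "s * a \<le> \<delta> / 4" using s(2) a unfolding s1_def by (simp add: pos_le_divide_eq)
    then have "s * norm h + s * norm h * integral\<^sup>L M l \<le> \<delta> / 4"
      using s(1) unfolding a_def by (simp add: algebra_simps)
    moreover have np: "norm (s *\<^sub>R h, y' - y) \<le> s * norm h + norm (y' - y)"
      using norm_Pair_le_sum[of "s *\<^sub>R h" "y' - y"] s(1) by simp
    ultimately have "norm (s *\<^sub>R h, y' - y) < \<delta>" using n dm \<delta>(1) unfolding u(3) by argo
    then have "inner p (s *\<^sub>R h) - inner z (y' - y) \<le> e * norm (s *\<^sub>R h, y' - y)"
      using \<delta>(2)[OF y'] by (simp add: dist_norm)
    also have "\<dots> \<le> e * (norm (s *\<^sub>R h) + norm (y' - y))"
      using e by (intro mult_left_mono norm_Pair_le_sum) auto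
    finally show "inner p (s *\<^sub>R h) - inner z (y' - integral\<^sup>L M u)
        \<le> e * (norm (s *\<^sub>R h) + norm (y' - integral\<^sup>L M u))" unfolding u(3) .
  qed
  note ex = this
  define s where "s j = s1 / real (Suc j)" for j
  have s: "0 < s j" "s j \<le> s1" for j
    unfolding s_def using s1 by (simp_all add: pos_divide_le_eq)
  from ex[OF s] have "\<forall>j. \<exists>g. integrable M g \<and> (AE t in M. g t \<le> (norm z + 2 * e) * (l t * norm h)) \<and>
    inner p h - e * norm h \<le> integral\<^sup>L M g \<and>
    (\<forall>t\<in>space M. \<forall>v\<in>\<Phi> t (x + s j *\<^sub>R h). norm (v - u t) \<le> d / 2 \<longrightarrow>
      s j * g t \<le> inner z (v - u t) + 2 * e * norm (v - u t))" by (rule allI)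
  from choice[OF this] obtain g where
    g: "\<And>j. integrable M (g j)" "\<And>j. AE t in M. g j t \<le> (norm z + 2 * e) * (l t * norm h)"
      "\<And>j. inner p h - e * norm h \<le> integral\<^sup>L M (g j)"
    and gm: "\<And>j t v. t \<in> space M \<Longrightarrow> v \<in> \<Phi> t (x + s j *\<^sub>R h) \<Longrightarrow> norm (v - u t) \<le> d / 2 \<Longrightarrow>
      s j * g j t \<le> inner z (v - u t) + 2 * e * norm (v - u t)" by blast
  have slim: "s \<longlonglongrightarrow> 0"
    using tendsto_mult_left[OF LIMSEQ_inverse_real_of_nat, of s1] unfolding s_def by (simp add: divide_inverse)
  have ev: "eventually (\<lambda>j. g j t \<le> c) sequentially"
    if t: "t \<in> space M" and s0: "s0 > 0" and
      ex: "\<And>s. 0 < s \<Longrightarrow> s < s0 \<Longrightarrow> \<exists>v\<in>\<Phi> t (x + s *\<^sub>R h). norm (v - u t) \<le> d / 2 \<and>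
        inner z (v - u t) + 2 * e * norm (v - u t) \<le> c * s" for t c s0
  proof -
    have "eventually (\<lambda>j. s j < s0) sequentially" using slim s0 by (rule order_tendstoD(2))
    then show ?thesis
    proof eventually_elim
      case (elim j)
      obtain v where v: "v \<in> \<Phi> t (x + s j *\<^sub>R h)" "norm (v - u t) \<le> d / 2"
          "inner z (v - u t) + 2 * e * norm (v - u t) \<le> c * s j" using ex[OF s(1) elim] by blast
      have "s j * g j t \<le> s j * c" using gm[OF t v(1,2)] v(3) by (simp add: mult.commute)
      then show ?case using s(1)[of j] by (simp add: mult_le_cancel_left)
    qed
  qed
  show ?thesis
  proof (intro exI conjI allI ballI impI)
    show "d > 0" by (rule d)
    show "AE t in M. u t \<in> \<Phi> t x" by (rule u(2))
    show "AE t in M. \<forall>v\<in>\<Phi> t x. norm (v - u t) \<le> d \<longrightarrow> - e * norm (v - u t) \<le> inner z (v - u t)" by (rule loc)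
    show "integrable M (g j)" "AE t in M. g j t \<le> (norm z + 2 * e) * (l t * norm h)"
      "inner p h - e * norm h \<le> integral\<^sup>L M (g j)" for j by (rule g)+
    show "eventually (\<lambda>j. g j t \<le> c) sequentially"
      if "t \<in> space M" "\<exists>s0>0. \<forall>s. 0 < s \<and> s < s0 \<longrightarrow> (\<exists>v\<in>\<Phi> t (x + s *\<^sub>R h). norm (v - u t) \<le> d / 2 \<and>
      inner z (v - u t) + 2 * e * norm (v - u t) \<le> c * s)" for t c
      using ev[OF that(1)] that(2) by blast
  qed
qed

lemma limiting_coderivative_expected_map_subset:
  assumes reg: "AE t in M. coderivative_regular (\<Phi> t) xb (yb t) ys"
  shows "limiting_coderivative (expected_map M \<Phi>) xb (integral\<^sup>L M yb) ys
    \<subseteq> aumann_integral M (\<lambda>t. regular_coderivative (\<Phi> t) xb (yb t) ys)"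
proof
  let ?E = "expected_map M \<Phi>"
  define D where "D t = regular_coderivative (\<Phi> t) xb (yb t) ys" for t
  fix p assume "p \<in> limiting_coderivative ?E xb (integral\<^sup>L M yb) ys"
  then obtain zz ww where zz: "zz \<longlonglongrightarrow> (xb, integral\<^sup>L M yb)" and ww: "ww \<longlonglongrightarrow> (p, - ys)"
    and nn: "\<And>k::nat. ww k \<in> regular_normal_cone (zz k) (gph ?E)"
    unfolding limiting_coderivative_def limiting_normal_cone_def by blast
  define X where "X k = fst (zz k)" for k
  define Z where "Z k = - snd (ww k)" for k
  define P where "P k = fst (ww k)" for k
  have Pk: "P k \<in> regular_coderivative ?E (X k) (snd (zz k)) (Z k)" for k
    using nn[of k] unfolding regular_coderivative_def P_def Z_def X_def by simp
  have Xl: "X \<longlonglongrightarrow> xb" using tendsto_fst[OF zz] unfolding X_def by simp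
  have Zl: "Z \<longlonglongrightarrow> ys" using tendsto_minus[OF tendsto_snd[OF ww]] unfolding Z_def by simp
  have Pl: "P \<longlonglongrightarrow> p" using tendsto_fst[OF ww] unfolding P_def by simp
  have "eventually (\<lambda>k. dist (X k) xb < \<eta> \<and> dist (Z k) ys < 1) sequentially"
    by (intro eventually_conj tendstoD[OF Xl eta_pos] tendstoD[OF Zl]) simp
  then obtain K where K: "\<And>k. k \<ge> K \<Longrightarrow> dist (X k) xb < \<eta> \<and> dist (Z k) ys < 1"
    unfolding eventually_sequentially by blast
  \<comment> \<open>Without values almost everywhere there would be no integrable selection of
    \<open>D\<close> to set against the separating hyperplane.\<close>
  have Dne: "AE t in M. D t \<noteq> {}"
    using reg AE_space
  proof eventually_elim
    case (elim t)
    then show ?case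
      using limiting_coderivative_nonempty[OF closed_gph[OF elim(2)] lip[OF elim(2)] eta_pos l_nonneg[OF elim(2)] single[OF elim(2)], of ys]
      unfolding D_def coderivative_regular_def by simp
  qed
  have Dbd: "norm d \<le> l t * norm ys" if "t \<in> space M" "d \<in> D t" for t d
    using regular_coderivative_section_bound[OF that(1)] that(2) unfolding D_def by blast
  have Dcl: "closed (D t)" if "t \<in> space M" for t
    unfolding D_def by (rule closed_regular_coderivative_section[OF that])
  have Dcv: "convex (D t)" if "t \<in> space M" for t
    unfolding D_def by (rule convex_regular_coderivative_section[OF that])
  have Dcomp: "\<forall>t\<in>space M. compact (D t)"
  proof
    fix t assume t: "t \<in> space M"
    have "D t \<subseteq> cball 0 (l t * norm ys)" using Dbd[OF t] by auto
    then have "bounded (D t)" by (rule bounded_subset[OF bounded_cball])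
    then show "compact (D t)" using Dcl[OF t] by (simp add: compact_eq_bounded_closed)
  qed
  have cvx: "convex (aumann_integral M D)"
    by (intro convex_aumann_integral AE_I2 Dcv)
  have cls: "closed (aumann_integral M D)"
  proof (rule closed_aumann_integral)
    show "finite_measure M" by unfold_locales
    show "AE t in M. closed (D t) \<and> convex (D t)" by (intro AE_I2 conjI Dcl Dcv)
    show "integrable M (\<lambda>t. l t * norm ys)" using integrable_l by simp
    show "AE t in M. \<forall>d\<in>D t. norm d \<le> l t * norm ys" by (intro AE_I2 ballI Dbd)
  qed
  have "p \<in> aumann_integral M D"
  proof (rule ccontr)
    assume "p \<notin> aumann_integral M D"
    from separating_hyperplane_closed_point[OF cvx cls this]
    obtain a b where ap: "inner a p < b" and ab: "\<And>x. x \<in> aumann_integral M D \<Longrightarrow> inner a x > b" by blast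
    \<comment> \<open>The selection \<open>d\<close> minimises \<open>inner a\<close> over
      \<open>D t\<close>, so with this sign \<open>\<sigma> t\<close> is the support function of
      \<open>D t\<close> in direction \<open>h\<close>, as the strict upper bound in
      \<open>descent_direction\<close> requires.\<close>
    define h where "h = - a"
    have Dm: "Sigma (space M) D \<in> sets (M \<Otimes>\<^sub>M borel)"
      unfolding D_def by (rule regular_coderivative_graph_measurable)
    have am: "(\<lambda>q. inner a (snd q)) \<in> borel_measurable (M \<Otimes>\<^sub>M borel)" by measurable
    have ac: "continuous_on UNIV (inner a)" by (intro continuous_intros)
    obtain d where dm: "d \<in> borel_measurable M" and dD: "\<And>t. t \<in> space M \<Longrightarrow> D t \<noteq> {} \<Longrightarrow> d t \<in> D t"
      and dmin: "\<And>t y. t \<in> space M \<Longrightarrow> y \<in> D t \<Longrightarrow> inner a (d t) \<le> inner a y"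
      using argmin_selection[OF Dm Dcomp, of "\<lambda>t. inner a", OF am ac] by blast
    have dAE: "AE t in M. d t \<in> D t"
      using Dne AE_space by eventually_elim (rule dD)
    have di: "integrable M d"
    proof (rule Bochner_Integration.integrable_bound[OF _ dm])
      show "integrable M (\<lambda>t. l t * norm ys)" using integrable_l by simp
      show "AE t in M. norm (d t) \<le> norm (l t * norm ys)"
        using dAE AE_space
      proof eventually_elim
        case (elim t)
        have "norm (d t) \<le> l t * norm ys" by (rule Dbd[OF elim(2,1)])
        then show ?case by simp
      qed
    qed
    have dC: "integral\<^sup>L M d \<in> aumann_integral M D"
      unfolding aumann_integral_def using di dAE by blast
    define \<sigma> where "\<sigma> t = inner (d t) h" for t
    have \<sigma>I: "integral\<^sup>L M \<sigma> = inner (integral\<^sup>L M d) h" unfolding \<sigma>_def using di by simp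
    define e where "e k = inverse (real (Suc k))" for k
    have e: "e k > 0" "e k \<le> 1" for k unfolding e_def by (simp_all add: inverse_le_1_iff)
    have el: "e \<longlonglongrightarrow> 0" unfolding e_def by (rule LIMSEQ_inverse_real_of_nat)
    have Xb: "X (k + K) \<in> ball xb \<eta>" for k using K[of "k + K"] by (simp add: dist_commute)
    define R where "R k u d g \<longleftrightarrow> (d :: real) > 0 \<and> (AE t in M. u t \<in> \<Phi> t (X (k + K))) \<and>
      (AE t in M. \<forall>v\<in>\<Phi> t (X (k + K)). norm (v - u t) \<le> d \<longrightarrow> - e k * norm (v - u t) \<le> inner (Z (k + K)) (v - u t)) \<and>
      (\<forall>j::nat. integrable M (g j) \<and> (AE t in M. g j t \<le> (norm (Z (k + K)) + 2 * e k) * (l t * norm h)) \<and>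
        inner (P (k + K)) h - e k * norm h \<le> integral\<^sup>L M (g j)) \<and>
      (\<forall>t\<in>space M. \<forall>c. (\<exists>s0>0. \<forall>s. 0 < s \<and> s < s0 \<longrightarrow> (\<exists>v\<in>\<Phi> t (X (k + K) + s *\<^sub>R h). norm (v - u t) \<le> d / 2 \<and>
        inner (Z (k + K)) (v - u t) + 2 * e k * norm (v - u t) \<le> c * s)) \<longrightarrow> eventually (\<lambda>j. g j t \<le> c) sequentially)"
      for k u d g
    have "\<exists>u d g. R k u d g" for k
      unfolding R_def by (rule coderivative_difference_quotients[OF Xb Pk e(1)])
    then obtain u r g where R: "\<And>k. R k (u k) (r k) (g k)" by metis
    have r: "r k > 0" for k using R[of k] unfolding R_def by (elim conjE)
    have uAE: "AE t in M. \<forall>k. u k t \<in> \<Phi> t (X (k + K))"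
      unfolding AE_all_countable using R unfolding R_def by blast
    have locAE: "AE t in M. \<forall>k. \<forall>v\<in>\<Phi> t (X (k + K)). norm (v - u k t) \<le> r k \<longrightarrow>
        - e k * norm (v - u k t) \<le> inner (Z (k + K)) (v - u k t)"
      unfolding AE_all_countable using R unfolding R_def by blast
    have gj: "integrable M (g k j) \<and> (AE t in M. g k j t \<le> (norm (Z (k + K)) + 2 * e k) * (l t * norm h)) \<and>
        inner (P (k + K)) h - e k * norm h \<le> integral\<^sup>L M (g k j)" for k j
      using R[of k] unfolding R_def by blast
    have gev: "eventually (\<lambda>j. g k j t \<le> c) sequentially"
      if "t \<in> space M" "\<exists>s0>0. \<forall>s. 0 < s \<and> s < s0 \<longrightarrow> (\<exists>v\<in>\<Phi> t (X (k + K) + s *\<^sub>R h). norm (v - u k t) \<le> r k / 2 \<and>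
        inner (Z (k + K)) (v - u k t) + 2 * e k * norm (v - u k t) \<le> c * s)" for k t c
      using R[of k] that unfolding R_def by blast
    have "inner p h \<le> integral\<^sup>L M \<sigma>"
    \<comment> \<open>The constant 3 is 1 for the distance of \<open>Z (k + K)\<close> from
      \<open>ys\<close> plus 2 for \<open>2 * e k\<close>, as \<open>e k \<le> 1\<close>.\<close>
    proof (rule iterated_fatou_bound[where g = g and W = "\<lambda>t. (norm ys + 3) * (l t * norm h)"
          and a = "\<lambda>k. inner (P (k + K)) h - e k * norm h"])
      show "integrable M (g k j)" for k j using gj by blast
      show "integrable M \<sigma>" unfolding \<sigma>_def using di by simp
      show "integrable M (\<lambda>t. (norm ys + 3) * (l t * norm h))" using integrable_l by simp
      show "inner (P (k + K)) h - e k * norm h \<le> integral\<^sup>L M (g k j)" for k j using gj by blast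
      have "(\<lambda>k. inner (P (k + K)) h - e k * norm h) \<longlonglongrightarrow> inner p h - 0 * norm h"
        by (intro tendsto_intros el LIMSEQ_ignore_initial_segment Pl)
      then show "(\<lambda>k. inner (P (k + K)) h - e k * norm h) \<longlonglongrightarrow> inner p h" by simp
      show "AE t in M. g k j t \<le> (norm ys + 3) * (l t * norm h)" for k j
      proof -
        have "norm (Z (k + K)) \<le> norm ys + 1"
          using K[of "k + K"] norm_triangle_ineq[of "Z (k + K) - ys" ys] by (simp add: dist_norm)
        then have c: "norm (Z (k + K)) + 2 * e k \<le> norm ys + 3" using e(2)[of k] by simp
        show ?thesis
          using gj[of k j, THEN conjunct2, THEN conjunct1] AE_space
        proof eventually_elim
          case (elim t)
          have "0 \<le> l t * norm h" using l_nonneg[OF elim(2)] by simp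
          from mult_right_mono[OF c this] show ?case using elim(1) by (rule order_trans[rotated])
        qed
      qed
      show "AE t in M. \<forall>c>\<sigma> t. eventually (\<lambda>k. eventually (\<lambda>j. g k j t \<le> c) sequentially) sequentially"
        using uAE locAE reg AE_space
      proof eventually_elim
        case (elim t)
        note t = elim(4)
        show ?case
        proof (intro allI impI)
          fix c assume c: "c > \<sigma> t"
          have dc: "inner x h < c" if "x \<in> limiting_coderivative (\<Phi> t) xb (yb t) ys" for x
          proof -
            have "x \<in> D t" using that elim(3) unfolding D_def coderivative_regular_def by simp
            then have "inner a (d t) \<le> inner a x" by (rule dmin[OF t])
            then have "inner x h \<le> \<sigma> t" unfolding \<sigma>_def h_def by (simp add: inner_commute)
            then show ?thesis using c by simp
          qed
          from descent_direction[OF closed_gph[OF t] lip[OF t] eta_pos l_nonneg[OF t] single[OF t] dc]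
          obtain \<gamma> where \<gamma>: "\<gamma> > 0" and desc: "\<forall>x u z eps delta. u \<in> \<Phi> t x \<and> norm (x - xb) < \<gamma> \<and>
              norm (z - ys) < \<gamma> \<and> 0 < eps \<and> eps < \<gamma> \<and> 0 < delta \<and>
              (\<forall>v\<in>\<Phi> t x. norm (v - u) \<le> delta \<longrightarrow> - eps * norm (v - u) \<le> inner z (v - u)) \<longrightarrow>
            (\<exists>s0>0. \<forall>s. 0 < s \<and> s < s0 \<longrightarrow> (\<exists>v\<in>\<Phi> t (x + s *\<^sub>R h). norm (v - u) \<le> delta / 2 \<and>
              inner z (v - u) + 2 * eps * norm (v - u) \<le> c * s))" by blast
          have "eventually (\<lambda>k. dist (X (k + K)) xb < \<gamma> \<and> dist (Z (k + K)) ys < \<gamma> \<and> e k < \<gamma>) sequentially"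
            by (intro eventually_conj tendstoD[OF LIMSEQ_ignore_initial_segment[OF Xl] \<gamma>]
                tendstoD[OF LIMSEQ_ignore_initial_segment[OF Zl] \<gamma>] order_tendstoD(2)[OF el \<gamma>])
          then show "eventually (\<lambda>k. eventually (\<lambda>j. g k j t \<le> c) sequentially) sequentially"
          proof eventually_elim
            case k: (elim k)
            show ?case
              by (rule gev[OF t], rule desc[rule_format])
                 (use elim(1,2) k e r in \<open>auto simp: dist_norm\<close>)
          qed
        qed
      qed
    qed
    then have "inner p h \<le> inner (integral\<^sup>L M d) h" unfolding \<sigma>I .
    then have "inner a (integral\<^sup>L M d) \<le> inner a p" unfolding h_def by (simp add: inner_commute)
    then show False using ab[OF dC] ap by simp
  qed
  then show "p \<in> aumann_integral M (\<lambda>t. regular_coderivative (\<Phi> t) xb (yb t) ys)" unfolding D_def .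
qed

text \<open>A sequence of violations would give quotients \<open>q k\<close> whose integrals all
  exceed \<open>e\<close>. Pointwise, regularity bounds \<open>q k t\<close> from above by
  arbitrarily small numbers, an estimate on one side only; so dominated convergence is applied to
  the positive parts.\<close>

lemma aumann_integral_subset_regular_coderivative:
  "aumann_integral M (\<lambda>t. regular_coderivative (\<Phi> t) xb (yb t) ys)
    \<subseteq> regular_coderivative (expected_map M \<Phi>) xb (integral\<^sup>L M yb) ys"
proof
  let ?E = "expected_map M \<Phi>" and ?y = "integral\<^sup>L M yb"
  fix p assume "p \<in> aumann_integral M (\<lambda>t. regular_coderivative (\<Phi> t) xb (yb t) ys)"
  then obtain v where v: "integrable M v" "p = integral\<^sup>L M v"
    and vD: "AE t in M. v t \<in> regular_coderivative (\<Phi> t) xb (yb t) ys"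
    unfolding aumann_integral_def by blast
  show "p \<in> regular_coderivative ?E xb ?y ys"
    unfolding regular_coderivative_iff
  proof (intro conjI allI impI)
    show "?y \<in> ?E xb" using expected_map_single by simp
    fix e :: real assume e: "e > 0"
    show "\<exists>d>0. \<forall>x' y'. y' \<in> ?E x' \<and> dist (x', y') (xb, ?y) < d \<longrightarrow>
      inner p (x' - xb) - inner ys (y' - ?y) \<le> e * norm (x' - xb, y' - ?y)"
    proof (rule ccontr)
      assume neg: "\<not> ?thesis"
      have "\<exists>x y. y \<in> ?E x \<and> dist (x, y) (xb, ?y) < min \<eta> (inverse (real (Suc k))) \<and>
          e * norm (x - xb, y - ?y) < inner p (x - xb) - inner ys (y - ?y)" for k
      proof -
        have "min \<eta> (inverse (real (Suc k))) > 0" using eta_pos by simp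
        then show ?thesis using neg by (meson not_le)
      qed
      then obtain X Y where Y: "\<And>k. Y k \<in> ?E (X k)"
        and XY: "\<And>k. dist (X k, Y k) (xb, ?y) < min \<eta> (inverse (real (Suc k)))"
        and big: "\<And>k. e * norm (X k - xb, Y k - ?y) < inner p (X k - xb) - inner ys (Y k - ?y)" by metis
      define n where "n k = norm (X k - xb)" for k
      have nle: "n k < min \<eta> (inverse (real (Suc k)))" for k
        using order_le_less_trans[OF norm_le_norm_Pair(1)[of "X k - xb" "Y k - ?y"]] XY[of k]
        unfolding n_def by (simp add: dist_norm)
      have Xb: "X k \<in> cball xb \<eta>" for k using nle[of k] unfolding n_def by (simp add: dist_norm norm_minus_commute)
      \<comment> \<open>At \<open>xb\<close> the expectation has a single value, where both sides of
        the violated inequality are 0; so the division by \<open>n k\<close> is legitimate.\<close>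
      have npos: "n k > 0" for k
      proof (rule ccontr)
        assume "\<not> n k > 0"
        then have "X k = xb" unfolding n_def by simp
        then show False using Y[of k] big[of k] expected_map_single by simp
      qed
      have "\<forall>k. \<exists>u. integrable M u \<and> (AE t in M. u t \<in> \<Phi> t (X k)) \<and> Y k = integral\<^sup>L M u"
        using Y unfolding expected_map_def aumann_integral_def by blast
      from choice[OF this] obtain u where u: "\<And>k. integrable M (u k)" "\<And>k. AE t in M. u k t \<in> \<Phi> t (X k)"
        "\<And>k. Y k = integral\<^sup>L M (u k)" by blast
      define q where "q k t = (inner (v t) (X k - xb) - inner ys (u k t - yb t)) / n k" for k t
      have qi: "integrable M (q k)" for k unfolding q_def using v(1) u(1) integrable_yb by auto
      have nlim: "n \<longlonglongrightarrow> 0"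
        by (rule tendsto_sandwich[OF _ _ tendsto_const LIMSEQ_inverse_real_of_nat])
           (use nle npos in \<open>auto intro!: always_eventually less_imp_le\<close>)
      have "(\<lambda>k. \<integral>t. max 0 (q k t) \<partial>M) \<longlonglongrightarrow> (\<integral>t. 0 \<partial>M)"
      proof (rule integral_dominated_convergence[where w = "\<lambda>t. norm (v t) + norm ys * l t"])
        show "(\<lambda>t. max 0 (q k t)) \<in> borel_measurable M" for k
          using qi by (intro borel_measurable_max) auto
        show "integrable M (\<lambda>t. norm (v t) + norm ys * l t)" using v(1) integrable_l by simp
        show "AE t in M. norm (max 0 (q k t)) \<le> norm (v t) + norm ys * l t" for k
          using u(2)[of k] AE_space
        proof eventually_elim
          case (elim t)
          have "norm (u k t - yb t) \<le> l t * n k" unfolding n_def by (rule section_bound[OF elim(2) Xb elim(1)])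
          then have "norm ys * norm (u k t - yb t) \<le> norm ys * (l t * n k)" by (intro mult_left_mono) auto
          moreover have "- inner ys (u k t - yb t) \<le> norm ys * norm (u k t - yb t)"
            using Cauchy_Schwarz_ineq2[of ys "u k t - yb t"] by argo
          moreover have "inner (v t) (X k - xb) \<le> norm (v t) * n k" unfolding n_def by (rule norm_cauchy_schwarz)
          ultimately have "inner (v t) (X k - xb) - inner ys (u k t - yb t) \<le> (norm (v t) + norm ys * l t) * n k"
            by (simp add: algebra_simps)
          then have "q k t \<le> norm (v t) + norm ys * l t"
            unfolding q_def using npos[of k] by (simp add: pos_divide_le_eq)
          then show ?case using l_nonneg[OF elim(2)] by simp
        qed
        have "AE t in M. \<forall>k. u k t \<in> \<Phi> t (X k)" using u(2) by (simp add: AE_all_countable)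
        then show "AE t in M. (\<lambda>k. max 0 (q k t)) \<longlonglongrightarrow> 0"
          using vD AE_space
        proof eventually_elim
          case (elim t)
          show ?case
          proof (rule LIMSEQ_I)
            fix r :: real assume r: "r > 0"
            then have "r / 2 > 0" by simp
            with elim(2) obtain \<delta> where \<delta>: "\<delta> > 0" "\<And>x y. norm (x - xb) < \<delta> \<Longrightarrow> y \<in> \<Phi> t x \<Longrightarrow>
              inner (v t) (x - xb) - inner ys (y - yb t) \<le> r / 2 * norm (x - xb)"
              unfolding regular_coderivative_section_iff[OF elim(3)] by meson
            have "eventually (\<lambda>k. n k < \<delta>) sequentially" using nlim \<delta>(1) by (rule order_tendstoD(2))
            then obtain k0 where k0: "\<And>k. k \<ge> k0 \<Longrightarrow> n k < \<delta>" unfolding eventually_sequentially by blast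
            have "norm (max 0 (q k t) - 0) < r" if "k \<ge> k0" for k
            proof -
              have "inner (v t) (X k - xb) - inner ys (u k t - yb t) \<le> r / 2 * n k"
                unfolding n_def by (rule \<delta>(2)) (use k0[OF that] elim(1) in \<open>auto simp: n_def\<close>)
              then have "q k t \<le> r / 2" unfolding q_def using npos[of k] by (simp add: pos_divide_le_eq)
              then show ?thesis using r by simp
            qed
            then show "\<exists>k0. \<forall>k\<ge>k0. norm (max 0 (q k t) - 0) < r" by blast
          qed
        qed
      qed simp
      then have "eventually (\<lambda>k. (\<integral>t. max 0 (q k t) \<partial>M) < e) sequentially"
        using e by (intro order_tendstoD(2)) auto
      then obtain k where k: "(\<integral>t. max 0 (q k t) \<partial>M) < e" by (auto dest: eventually_happens)
      have "e * n k \<le> e * norm (X k - xb, Y k - ?y)"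
        unfolding n_def using e by (intro mult_left_mono norm_le_norm_Pair) auto
      also have "\<dots> < inner p (X k - xb) - inner ys (Y k - ?y)" by (rule big)
      also have "\<dots> = n k * integral\<^sup>L M (q k)"
        unfolding q_def v(2) u(3) using v(1) u(1)[of k] integrable_yb npos[of k] by simp
      also have "\<dots> \<le> n k * (\<integral>t. max 0 (q k t) \<partial>M)"
        using npos[of k] qi[of k] by (intro mult_left_mono integral_mono integrable_max) auto
      finally show False using k npos[of k] by simp
    qed
  qed
qed

text \<open>The inclusions close a cycle: integral of regular coderivatives, regular coderivative,
  limiting coderivative, and back.\<close>

theorem coderivative_expected_map:
  assumes reg: "AE t in M. coderivative_regular (\<Phi> t) xb (yb t) ys"
  shows "regular_coderivative (expected_map M \<Phi>) xb (integral\<^sup>L M yb) ys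
           = limiting_coderivative (expected_map M \<Phi>) xb (integral\<^sup>L M yb) ys"
    and "limiting_coderivative (expected_map M \<Phi>) xb (integral\<^sup>L M yb) ys
           = aumann_integral M (\<lambda>t. limiting_coderivative (\<Phi> t) xb (yb t) ys)"
proof -
  have "aumann_integral M (\<lambda>t. limiting_coderivative (\<Phi> t) xb (yb t) ys)
      = aumann_integral M (\<lambda>t. regular_coderivative (\<Phi> t) xb (yb t) ys)"
    using reg by (intro aumann_integral_cong_AE) (simp add: coderivative_regular_def)
  then show "regular_coderivative (expected_map M \<Phi>) xb (integral\<^sup>L M yb) ys
           = limiting_coderivative (expected_map M \<Phi>) xb (integral\<^sup>L M yb) ys"
    and "limiting_coderivative (expected_map M \<Phi>) xb (integral\<^sup>L M yb) ys
           = aumann_integral M (\<lambda>t. limiting_coderivative (\<Phi> t) xb (yb t) ys)"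
    using limiting_coderivative_expected_map_subset[OF reg]
      aumann_integral_subset_regular_coderivative[of ys]
      regular_subset_limiting_coderivative[of "expected_map M \<Phi>" xb "integral\<^sup>L M yb" ys]
    by auto
qed

end

section \<open>Passage from almost every parameter to every parameter\<close>

theorem theorem5p7:
  fixes M :: "'t measure"
    and \<Phi> :: "'t \<Rightarrow> (real ^ 'n) \<Rightarrow> (real ^ 'm) set"
    and xbar :: "real ^ 'n" and Ebar ystar :: "real ^ 'm"
    and ybar :: "'t \<Rightarrow> real ^ 'm"
    and \<kappa> :: "'t \<Rightarrow> real" and \<rho> :: real
    and Tpa Tna :: "'t set"
  assumes "finite_measure M" and "complete_measure M"
    and "atomic_decomposition M Tpa Tna"
    and "normal_integrand M \<Phi>"
    and "xbar \<in> setval_dom (expected_map M \<Phi>)"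
    and "\<rho> > 0" and "\<kappa> \<in> L1_pos M"
    and "\<forall>x\<in>cball xbar \<rho>. AE t in M. t \<in> Tna \<longrightarrow> convex (\<Phi> t x)"
    and "\<forall>x\<in>cball xbar \<rho>. AE t in M. \<Phi> t x \<subseteq> cball 0 (\<kappa> t)"
    and "expected_map M \<Phi> xbar = {Ebar}"
    and "integrably_locally_Lipschitz M \<Phi> xbar"
    and "AE t in M. \<Phi> t xbar = {ybar t} \<and> coderivative_regular (\<Phi> t) xbar (ybar t) ystar"
  shows "regular_coderivative (expected_map M \<Phi>) xbar Ebar ystar
           = limiting_coderivative (expected_map M \<Phi>) xbar Ebar ystar
       \<and> limiting_coderivative (expected_map M \<Phi>) xbar Ebar ystar
           = aumann_integral M (\<lambda>t. limiting_coderivative (\<Phi> t) xbar (ybar t) ystar)"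
proof -
  interpret finite_measure M by fact
  interpret complete_measure M by fact
  obtain v where v: "integrable M v" "AE t in M. v t \<in> \<Phi> t xbar" "Ebar = integral\<^sup>L M v"
    using assms(10) mem_expected_mapE[of Ebar M \<Phi> xbar] by blast
  obtain \<eta> l That where \<eta>: "\<eta> > 0" and l: "l \<in> L1_pos M" and That: "That \<in> sets M" "emeasure M (space M - That) = 0"
    and lip: "\<And>t x x'. t \<in> That \<Longrightarrow> x \<in> cball xbar \<eta> \<Longrightarrow> x' \<in> cball xbar \<eta> \<Longrightarrow>
      \<Phi> t x \<subseteq> {u + (l t * norm (x - x')) *\<^sub>R b | u b. u \<in> \<Phi> t x' \<and> b \<in> cball 0 1}"
    using assms(11) unfolding integrably_locally_Lipschitz_def by blast
  have li: "integrable M l" and lpos: "AE t in M. 0 < l t" using l unfolding L1_pos_def by auto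
  have T: "AE t in M. t \<in> That"
    by (rule AE_I[where N = "space M - That"]) (use That in auto)
  define good where "good t \<longleftrightarrow> t \<in> That \<and> 0 < l t \<and> v t \<in> \<Phi> t xbar \<and> \<Phi> t xbar = {ybar t} \<and>
    coderivative_regular (\<Phi> t) xbar (ybar t) ystar" for t
  have good: "AE t in M. good t"
    using T lpos v(2) assms(12) unfolding good_def by eventually_elim simp
  define B where "B = {t \<in> space M. \<not> good t}"
  have Bnull: "B \<in> null_sets M" using good unfolding B_def AE_iff_null_sets .
  then have B: "B \<in> sets M" by auto
  have nB: "AE t in M. t \<notin> B" using Bnull by (rule AE_not_in)
  \<comment> \<open>On the null set \<open>B\<close> the map is replaced by the constant
    \<open>{0}\<close> with modulus 0, which meets every requirement and changes no integral. The
    reference selection is built from \<open>v\<close>, which is integrable by its choice and equals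
    \<open>ybar\<close> off \<open>B\<close>.\<close>
  define \<Psi> where "\<Psi> t = (if t \<in> B then (\<lambda>x. {0}) else \<Phi> t)" for t
  define y where "y t = (if t \<in> B then 0 else v t)" for t
  define k where "k t = (if t \<in> B then 0 else l t)" for t
  have goodI: "good t" if "t \<in> space M" "t \<notin> B" for t using that unfolding B_def by blast
  have yv: "AE t in M. v t = y t" using nB by eventually_elim (simp add: y_def)
  have kl: "AE t in M. l t = k t" using nB by eventually_elim (simp add: k_def)
  interpret F: finite_complete_measure M by unfold_locales
  have ym: "y \<in> borel_measurable M"
    by (rule F.borel_measurable_AE_eq[OF _ yv]) (use v(1) in auto)
  have km: "k \<in> borel_measurable M"
    by (rule F.borel_measurable_AE_eq[OF _ kl]) (use li in auto)
  interpret lipschitz_integrand M \<Psi> xbar y k \<eta>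
  proof
    show "\<eta> > 0" by (rule \<eta>)
    show "closed (gph (\<Psi> t))" if "t \<in> space M" for t
    proof (cases "t \<in> B")
      case True
      have "gph (\<Psi> t) = UNIV \<times> {0}" unfolding \<Psi>_def gph_def using True by auto
      then show ?thesis by (simp add: closed_Times)
    next
      case False
      then show ?thesis using assms(4) that unfolding normal_integrand_def \<Psi>_def by simp
    qed
    let ?X = "M \<Otimes>\<^sub>M (borel :: ((real ^ 'n) \<times> (real ^ 'm)) measure)"
    have G: "{(t, z). t \<in> space M \<and> z \<in> gph (\<Phi> t)} \<in> sets ?X"
      using assms(4) unfolding normal_integrand_def by blast
    have "{(t, z). t \<in> space M \<and> z \<in> gph (\<Psi> t)}
      = {(t, z). t \<in> space M \<and> z \<in> gph (\<Phi> t)} \<inter> ((space M - B) \<times> UNIV) \<union> B \<times> (UNIV \<times> {0})"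
      unfolding \<Psi>_def gph_def using sets.sets_into_space[OF B] by (auto split: if_splits)
    also have "\<dots> \<in> sets ?X"
      by (intro sets.Un sets.Int G pair_measureI sets.Diff sets.top B borel_closed closed_Times closed_UNIV closed_singleton)
    finally show "{(t, z). t \<in> space M \<and> z \<in> gph (\<Psi> t)} \<in> sets ?X" .
    show "\<Psi> t xbar = {y t}" if "t \<in> space M" for t
      using goodI[OF that] unfolding \<Psi>_def y_def good_def by auto
    show "integrable M y" using v(1) yv ym by (subst integrable_cong_AE[of y M v]) (auto elim: eventually_mono)
    show "integrable M k" using li kl km by (subst integrable_cong_AE[of k M l]) (auto elim: eventually_mono)
    show "k t \<ge> 0" if "t \<in> space M" for t
      using goodI[OF that] unfolding k_def good_def by auto
    show "lipschitz_map (\<Psi> t) (k t) (cball xbar \<eta>)" if t: "t \<in> space M" for t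
      unfolding lipschitz_map_def
    proof (intro ballI)
      fix x x' w assume x: "x \<in> cball xbar \<eta>" "x' \<in> cball xbar \<eta>" and w: "w \<in> \<Psi> t x"
      show "\<exists>w'\<in>\<Psi> t x'. norm (w - w') \<le> k t * norm (x - x')"
      proof (cases "t \<in> B")
        case True
        then show ?thesis using w unfolding \<Psi>_def k_def by simp
      next
        case False
        then have "w \<in> \<Phi> t x" and g: "good t" using w goodI[OF t] unfolding \<Psi>_def by auto
        then obtain u b where ub: "w = u + (l t * norm (x - x')) *\<^sub>R b" "u \<in> \<Phi> t x'" "norm b \<le> 1"
          using lip[of t x x'] x unfolding good_def by auto
        have "norm (w - u) = l t * norm (x - x') * norm b"
          unfolding ub(1) using g by (simp add: good_def)
        also have "\<dots> \<le> l t * norm (x - x') * 1"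
          using ub(3) g by (intro mult_left_mono) (auto simp: good_def)
        finally show ?thesis using False ub(2) unfolding \<Psi>_def k_def by auto
      qed
    qed
  qed
  have reg: "AE t in M. coderivative_regular (\<Psi> t) xbar (y t) ystar"
    using nB AE_space
  proof eventually_elim
    case (elim t)
    then show ?case using goodI[OF elim(2,1)] unfolding good_def \<Psi>_def y_def by auto
  qed
  have E: "expected_map M \<Phi> = expected_map M \<Psi>"
  proof
    fix x
    have "AE t in M. \<Phi> t x = \<Psi> t x" using nB by eventually_elim (simp add: \<Psi>_def)
    then show "expected_map M \<Phi> x = expected_map M \<Psi> x"
      unfolding expected_map_def by (rule aumann_integral_cong_AE)
  qed
  have I: "Ebar = integral\<^sup>L M y"
    unfolding v(3) by (rule integral_cong_AE) (use v(1) ym yv in auto)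
  have "AE t in M. limiting_coderivative (\<Phi> t) xbar (ybar t) ystar = limiting_coderivative (\<Psi> t) xbar (y t) ystar"
    using nB AE_space
  proof eventually_elim
    case (elim t)
    then show ?case using goodI[OF elim(2,1)] unfolding good_def \<Psi>_def y_def by auto
  qed
  then have "aumann_integral M (\<lambda>t. limiting_coderivative (\<Phi> t) xbar (ybar t) ystar)
      = aumann_integral M (\<lambda>t. limiting_coderivative (\<Psi> t) xbar (y t) ystar)"
    by (rule aumann_integral_cong_AE)
  then show ?thesis using coderivative_expected_map[OF reg] unfolding E I by simp
qed

end
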